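(* Let $\epsilon>0$ and let $\bar B$ be a number with $\mathrm{OPT}_{\bar B}\le\bar B\le(1+\epsilon)\mathrm{opt}$. There is a polynomial-time algorithm that computes a solution to the $\ell$-centrum problem of cost at most $\bigl(12+O(\epsilon)\bigr)\bar B\le\bigl(12+O(\epsilon)\bigr)\mathrm{opt}$.
   Context: $\ell$-centrum problem: given a finite metric space $(\mathcal D,\{c_{ij}\})$ with $n=|\mathcal D|>k$ points (clients), an integer $k\ge0$ and an integer $\ell\in\{1,\dots,n\}$, choose a set $F\subseteq\mathcal D$ of $k$ centers and assign each client $j$ to a center $i(j)\in F$ so as to minimize $\mathrm{cost}(\ell;\vec c)$, the sum of the $\ell$ largest entries of the assignment-cost vector $\vec c=(c_{i(j)j})_{j\in\mathcal D}$. Let $\mathrm{opt}$ be the optimal value. For $B\ge0$ and $d\ge0$ define $f_B(d)=d$ if $d>B/\ell$ and $f_B(d)=0$ otherwise. $\mathrm{OPT}_B$ is the optimal value of the linear program (P$_B$): minimize $\sum_j\sum_i f_B(c_{ij})x_{ij}$ subject to $\sum_i x_{ij}\ge1$ for all $j$, $0\le x_{ij}\le y_i$ for all $i,j$, and $\sum_i y_i\le k$ (all indices range over $\mathcal D$). (Such a $\bar B$ can be found by binary search over $B$.) *)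

theory Defs
  imports
    "HOL-Analysis.Abstract_Metric_Spaces"
    "HOL-Library.Extended_Real"
    "HOL-Library.Landau_Symbols"
    "HOL-Library.Log_Nat"
    "HOL-Library.Multiset"
    "HOL-Computational_Algebra.Polynomial"
begin

definition top_sum :: "nat \<Rightarrow> 'a set \<Rightarrow> ('a \<Rightarrow> real) \<Rightarrow> real" where
  "top_sum l D v =
     sum_list (take l (rev (sorted_list_of_multiset (image_mset v (mset_set D)))))"

definition centrum_solution :: "'a set \<Rightarrow> nat \<Rightarrow> 'a set \<Rightarrow> ('a \<Rightarrow> 'a) \<Rightarrow> bool" where
  "centrum_solution D k F i \<longleftrightarrow> F \<subseteq> D \<and> card F = k \<and> (\<forall>j\<in>D. i j \<in> F)"

definition centrum_cost :: "'a set \<Rightarrow> ('a \<Rightarrow> 'a \<Rightarrow> real) \<Rightarrow> nat \<Rightarrow> ('a \<Rightarrow> 'a) \<Rightarrow> real" where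
  "centrum_cost D c l i = top_sum l D (\<lambda>j. c (i j) j)"

text \<open>Optimal values are extended reals, so that the optimal value of an infeasible problem
  (which happens for \<open>k = 0\<close>) is \<open>\<infinity>\<close>.\<close>

definition centrum_opt :: "'a set \<Rightarrow> ('a \<Rightarrow> 'a \<Rightarrow> real) \<Rightarrow> nat \<Rightarrow> nat \<Rightarrow> ereal" where
  "centrum_opt D c k l =
     (INF (F, i) \<in> {(F, i). centrum_solution D k F i}. ereal (centrum_cost D c l i))"

definition thresh :: "nat \<Rightarrow> real \<Rightarrow> real \<Rightarrow> real" where
  "thresh l B d = (if d > B / real l then d else 0)"

definition lp_feasible :: "'a set \<Rightarrow> nat \<Rightarrow> ('a \<Rightarrow> 'a \<Rightarrow> real) \<Rightarrow> ('a \<Rightarrow> real) \<Rightarrow> bool" where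
  "lp_feasible D k x y \<longleftrightarrow>
     (\<forall>j\<in>D. (\<Sum>i\<in>D. x i j) \<ge> 1) \<and>
     (\<forall>i\<in>D. \<forall>j\<in>D. 0 \<le> x i j \<and> x i j \<le> y i) \<and>
     (\<Sum>i\<in>D. y i) \<le> real k"

definition lp_opt :: "'a set \<Rightarrow> ('a \<Rightarrow> 'a \<Rightarrow> real) \<Rightarrow> nat \<Rightarrow> nat \<Rightarrow> real \<Rightarrow> ereal" where
  "lp_opt D c k l B =
     (INF (x, y) \<in> {(x, y). lp_feasible D k x y}.
        ereal (\<Sum>j\<in>D. \<Sum>i\<in>D. thresh l B (c i j) * x i j))"

text \<open>
  The machine model is a random access machine with integer registers and logarithmic cost,
  programmed by structured commands. Every value that occurs during a computation
  (constants, addresses, operands, results) is charged its length in binary, so that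
  running times are polynomially related to those of Turing machines, although
  multiplication and division are primitive.
\<close>

type_synonym memory = "int \<Rightarrow> int"

datatype expr =
    Const int
  | Load expr
  | Plus expr expr
  | Minus expr expr
  | Times expr expr
  | Quot expr expr

text \<open>Division rounds down, with \<open>a div 0 = 0\<close>.
  The tests of \<open>Cond\<close> and \<open>While\<close> succeed if the expression is positive;
  the first argument of \<open>Store\<close> is the address.\<close>

datatype prog =
    Skip
  | Store expr expr
  | Seq prog prog
  | Cond expr prog prog
  | While expr prog

fun val :: "expr \<Rightarrow> memory \<Rightarrow> int" where
  "val (Const a) s = a"
| "val (Load e) s = s (val e s)"
| "val (Plus e f) s = val e s + val f s"
| "val (Minus e f) s = val e s - val f s"
| "val (Times e f) s = val e s * val f s"
| "val (Quot e f) s = val e s div val f s"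

text \<open>The additional unit accounts for the sign.\<close>

definition int_size :: "int \<Rightarrow> nat" where
  "int_size a = nat (bitlen \<bar>a\<bar>) + 1"

fun expr_time :: "expr \<Rightarrow> memory \<Rightarrow> nat" where
  "expr_time (Const a) s = int_size a"
| "expr_time (Load e) s = expr_time e s + int_size (val (Load e) s)"
| "expr_time (Plus e f) s = expr_time e s + expr_time f s + int_size (val (Plus e f) s)"
| "expr_time (Minus e f) s = expr_time e s + expr_time f s + int_size (val (Minus e f) s)"
| "expr_time (Times e f) s = expr_time e s + expr_time f s + int_size (val (Times e f) s)"
| "expr_time (Quot e f) s = expr_time e s + expr_time f s + int_size (val (Quot e f) s)"

text \<open>\<open>runs P s t s'\<close>: started in memory \<open>s\<close>, program \<open>P\<close> halts
  after time \<open>t\<close> in memory \<open>s'\<close>.\<close>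

inductive runs :: "prog \<Rightarrow> memory \<Rightarrow> nat \<Rightarrow> memory \<Rightarrow> bool" where
  Skip: "runs Skip s 1 s"
| Store: "runs (Store a e) s (expr_time a s + expr_time e s + 1) (s(val a s := val e s))"
| Seq: "runs P s t s' \<Longrightarrow> runs Q s' t' s'' \<Longrightarrow> runs (Seq P Q) s (t + t' + 1) s''"
| CondTrue: "val e s > 0 \<Longrightarrow> runs P s t s' \<Longrightarrow> runs (Cond e P Q) s (expr_time e s + t + 1) s'"
| CondFalse: "\<not> val e s > 0 \<Longrightarrow> runs Q s t s' \<Longrightarrow> runs (Cond e P Q) s (expr_time e s + t + 1) s'"
| WhileFalse: "\<not> val e s > 0 \<Longrightarrow> runs (While e P) s (expr_time e s + 1) s"
| WhileTrue: "val e s > 0 \<Longrightarrow> runs P s t s' \<Longrightarrow> runs (While e P) s' t' s''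
    \<Longrightarrow> runs (While e P) s (expr_time e s + t + t' + 1) s''"

inductive_cases SkipE: "runs Skip s t s'"
inductive_cases StoreE: "runs (Store a e) s t s'"
inductive_cases SeqE: "runs (Seq P Q) s t s'"
inductive_cases CondE: "runs (Cond e P Q) s t s'"
inductive_cases WhileE: "runs (While e P) s t s'"

lemma runs_deterministic:
  "runs P s t s' \<Longrightarrow> runs P s u s'' \<Longrightarrow> u = t \<and> s'' = s'"
proof (induction arbitrary: u s'' rule: runs.induct)
  case (Skip s)
  then show ?case by (auto elim: SkipE)
next
  case (Store a e s)
  then show ?case by (auto elim: StoreE)
next
  case (Seq P s t s1 Q t1 s2)
  from Seq.prems obtain v r v' where "runs P s v r" "runs Q r v' s''" "u = v + v' + 1"
    by (rule SeqE) simp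
  with Seq.IH(1)[of v r] Seq.IH(2)[of v' s''] show ?case by simp
next
  case (CondTrue e s P t s1 Q)
  from CondTrue.prems CondTrue.hyps obtain v where "runs P s v s''" "u = expr_time e s + v + 1"
    by (auto elim: CondE)
  with CondTrue.IH[of v s''] show ?case by simp
next
  case (CondFalse e s Q t s1 P)
  from CondFalse.prems CondFalse.hyps obtain v where "runs Q s v s''" "u = expr_time e s + v + 1"
    by (auto elim: CondE)
  with CondFalse.IH[of v s''] show ?case by simp
next
  case (WhileFalse e s P)
  from WhileFalse.prems show ?case by (rule WhileE) (simp_all add: WhileFalse.hyps)
next
  case (WhileTrue e s P t s1 t1 s2)
  from WhileTrue.prems obtain v r v' where
    "runs P s v r" "runs (While e P) r v' s''" "u = expr_time e s + v + v' + 1"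
    by (rule WhileE) (use WhileTrue.hyps(1) in simp_all)
  with WhileTrue.IH(1)[of v r] WhileTrue.IH(2)[of v' s''] show ?case by simp
qed

text \<open>Lists are passed with their length in register \<open>0\<close> and their elements in the
  registers \<open>1, 2, \<dots>\<close>; initially, all other registers are \<open>0\<close>.\<close>

definition input_memory :: "int list \<Rightarrow> memory" where
  "input_memory xs a =
     (if a = 0 then int (length xs)
      else if 1 \<le> a \<and> a \<le> int (length xs) then xs ! nat (a - 1)
      else 0)"

definition output_of :: "memory \<Rightarrow> int list" where
  "output_of s = map s [1..s 0]"

definition input_size :: "int list \<Rightarrow> nat" where
  "input_size xs = (\<Sum>x\<leftarrow>xs. int_size x)"

text \<open>\<open>P\<close> is a polynomial-time algorithm for the problem with set of instances \<open>X\<close>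
  (encoded by \<open>enc\<close>) and relation \<open>R\<close> between instances and correct outputs.\<close>

definition poly_time_algorithm ::
    "prog \<Rightarrow> ('a \<Rightarrow> int list) \<Rightarrow> 'a set \<Rightarrow> ('a \<Rightarrow> int list \<Rightarrow> bool) \<Rightarrow> bool" where
  "poly_time_algorithm P enc X R \<longleftrightarrow>
     (\<exists>p :: nat poly. \<forall>I\<in>X. \<exists>t s. runs P (input_memory (enc I)) t s \<and>
        t \<le> poly p (input_size (enc I)) \<and> R I (output_of s))"

text \<open>An instance \<open>(n, k, l, c, B)\<close> given to an algorithm has the point set \<open>{..<n}\<close> and
  rational data, numerators and denominators being written in lowest terms.
  Only the entries of \<open>c\<close> on \<open>{..<n}\<close> are seen by the algorithm.\<close>

type_synonym centrum_instance = "nat \<times> nat \<times> nat \<times> (nat \<Rightarrow> nat \<Rightarrow> rat) \<times> rat"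

definition encode_rat :: "rat \<Rightarrow> int list" where
  "encode_rat q = [fst (quotient_of q), snd (quotient_of q)]"

fun encode_instance :: "centrum_instance \<Rightarrow> int list" where
  "encode_instance (n, k, l, c, B) =
     [int n, int k, int l] @ encode_rat B @
     concat (map (\<lambda>i. concat (map (\<lambda>j. encode_rat (c i j)) [0..<n])) [0..<n])"

definition encode_solution :: "nat \<Rightarrow> nat set \<Rightarrow> (nat \<Rightarrow> nat) \<Rightarrow> int list" where
  "encode_solution n F i =
     map (\<lambda>v. of_bool (v \<in> F)) [0..<n] @ map (\<lambda>j. int (i j)) [0..<n]"

abbreviation real_dist :: "(nat \<Rightarrow> nat \<Rightarrow> rat) \<Rightarrow> nat \<Rightarrow> nat \<Rightarrow> real" where
  "real_dist c i j \<equiv> real_of_rat (c i j)"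

definition admissible_instances :: "real \<Rightarrow> centrum_instance set" where
  "admissible_instances \<epsilon> = {(n, k, l, c, B).
     Metric_space {..<n} (real_dist c) \<and> k < n \<and> l \<in> {1..n} \<and> 0 \<le> B \<and>
     lp_opt {..<n} (real_dist c) k l (real_of_rat B) \<le> ereal (real_of_rat B) \<and>
     ereal (real_of_rat B) \<le> ereal (1 + \<epsilon>) * centrum_opt {..<n} (real_dist c) k l}"

end

theory Submission imports Defs begin

text \<open>
  Put \<open>t = B / l\<close> and measure distances in units of \<open>t\<close>, rounded up to integers and cut off at
  \<open>30 n\<close>. The result \<open>d\<close> is still a pseudometric, the excess \<open>max 0 (d - 1)\<close> is at most
  the thresholded distance divided by \<open>t\<close>, and all numbers are polynomial in \<open>n\<close>. Hence
  the linear program, relaxed slightly so that it has a solution with polynomial margin, can be solved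
  by the perceptron algorithm in integer arithmetic. (If \<open>B\<close> were \<open>0\<close>, the linear program
  would have to open all \<open>n > k\<close> points.)

  The fractional solution is rounded as in the \<open>k\<close>-median algorithm of Charikar, Guha, Tardos and
  Shmoys. Let \<open>C j\<close> be the fractional excess of client \<open>j\<close>. In the order of increasing
  \<open>C j\<close>, pick representatives such that every client has one within distance
  \<open>2 + 4 C j\<close>. By Markov's inequality the Voronoi cell of each representative carries
  fractional mass at least \<open>1/2\<close>, so there are at most \<open>2 k\<close> of them, and by an exchange
  argument a half-integral solution (the most valuable representatives are opened fully, the set
  \<open>H\<close> of the other ones by half) is not more expensive than \<open>2 \<Sum> C j\<close>. Colour
  \<open>H\<close> with two colours such that each element of \<open>H\<close> has a nearest other representative that
  is open or of the opposite colour, and open the smaller colour class. Then a client pays at most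
  \<open>4\<close> plus an excess, and the excesses add up to at most \<open>(4 + 4 + O(\<epsilon>)) l\<close>; in the
  original units, the \<open>l\<close> largest costs sum up to at most \<open>(12 + O(\<epsilon>)) B\<close>.
\<close>

section \<open>A language of bounded loops for the random access machine\<close>

text \<open>The obstacle is the running time on a concrete machine: every stored number needs a
  bound on its length, and a general algorithm for linear programs would have to be analysed at that
  level. What helps is that \<open>q\<close>, which is \<open>1 / \<epsilon>\<close> rounded up, is
  a constant of the program. The slack \<open>1 / q\<close> yields a solution with polynomial
  margin, so that polynomially many perceptron updates suffice and all stored values are
  polynomially bounded in absolute value. With loop bounds known on entry, polynomial time then
  follows once and for all from a general lemma. Even sorting becomes a loop over all possible
  values. In the \<open>4\<close> per client, \<open>2\<close> pays for the way to the
  representative and \<open>2\<close> for the way to the next one. In the excess, one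
  \<open>4\<close> is the factor of \<open>C j\<close> on the first way; the other arises since
  half-opening pays half of the second way, at most \<open>2 \<Sum> C j\<close>, whereas closing a
  representative pays all of it. The cut-off \<open>30 n\<close> is harmless, as the final excesses
  add up to at most \<open>24 l\<close>.\<close>

datatype ex =
    Cn int
  | Rd nat ex ex
  | In ex
  | Add ex ex (infixl "\<oplus>" 65)
  | Sub ex ex (infixl "\<ominus>" 65)
  | Mul ex ex (infixl "\<otimes>" 70)
  | Div ex ex (infixl "\<oslash>" 70)
  | Eq ex ex (infix "\<doteq>" 50)
  | Less ex ex (infix "\<lless>" 50)

text \<open>There is neither a conditional nor an unbounded loop: a case distinction is a
  multiplication by a test with value \<open>0\<close> or \<open>1\<close>, and a loop bound is
  evaluated once on entry. Hence every command terminates and \<open>sem\<close> can be a total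
  function.\<close>

datatype cmd = Asg nat ex ex ex | Sq cmd cmd (infixr ";;" 40) | For nat ex cmd

type_synonym state = "nat \<Rightarrow> int \<Rightarrow> int \<Rightarrow> int"

fun ev :: "memory \<Rightarrow> ex \<Rightarrow> state \<Rightarrow> int" where
  "ev u (Cn a) \<sigma> = a"
| "ev u (Rd k a b) \<sigma> = \<sigma> k (ev u a \<sigma>) (ev u b \<sigma>)"
| "ev u (In a) \<sigma> = u (max 0 (ev u a \<sigma>))"
| "ev u (a \<oplus> b) \<sigma> = ev u a \<sigma> + ev u b \<sigma>"
| "ev u (a \<ominus> b) \<sigma> = ev u a \<sigma> - ev u b \<sigma>"
| "ev u (a \<otimes> b) \<sigma> = ev u a \<sigma> * ev u b \<sigma>"
| "ev u (a \<oslash> b) \<sigma> = ev u a \<sigma> div ev u b \<sigma>"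
| "ev u (a \<doteq> b) \<sigma> = of_bool (ev u a \<sigma> = ev u b \<sigma>)"
| "ev u (a \<lless> b) \<sigma> = of_bool (ev u a \<sigma> < ev u b \<sigma>)"

definition put :: "state \<Rightarrow> nat \<Rightarrow> int \<Rightarrow> int \<Rightarrow> int \<Rightarrow> state" where
  "put \<sigma> k a b v = \<sigma>(k := (\<sigma> k)(a := (\<sigma> k a)(b := v)))"

lemma put_apply: "put \<sigma> k a b v k' a' b' = (if k' = k \<and> a' = a \<and> b' = b then v else \<sigma> k' a' b')"
  by (simp add: put_def)

lemma put_other [simp]: "k' \<noteq> k \<Longrightarrow> put \<sigma> k a b v k' = \<sigma> k'"
  by (simp add: put_def)

lemma put_same: "put \<sigma> k a b v k = (\<lambda>a' b'. if a' = a \<and> b' = b then v else \<sigma> k a' b')"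
  by (auto simp: put_def fun_eq_iff)

primrec sem :: "memory \<Rightarrow> cmd \<Rightarrow> state \<Rightarrow> state" where
  "sem u (Asg k a b e) = (\<lambda>\<sigma>. put \<sigma> k (ev u a \<sigma>) (ev u b \<sigma>) (ev u e \<sigma>))"
| "sem u (c ;; d) = (\<lambda>\<sigma>. sem u d (sem u c \<sigma>))"
| "sem u (For x N c) = (\<lambda>\<sigma>. fold (\<lambda>i \<tau>. sem u c (put \<tau> x 0 0 (int i))) [0..<nat (ev u N \<sigma>)] \<sigma>)"

text \<open>Only stored values and loop bounds are restricted. Values inside an expression may
  exceed \<open>W\<close>, in particular those computed from large input numbers; their lengths are
  controlled by the size of the expression.\<close>

primrec safe :: "memory \<Rightarrow> int \<Rightarrow> cmd \<Rightarrow> state \<Rightarrow> bool" where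
  "safe u W (Asg k a b e) = (\<lambda>\<sigma>. \<bar>ev u e \<sigma>\<bar> \<le> W)"
| "safe u W (c ;; d) = (\<lambda>\<sigma>. safe u W c \<sigma> \<and> safe u W d (sem u c \<sigma>))"
| "safe u W (For x N c) = (\<lambda>\<sigma>. \<bar>ev u N \<sigma>\<bar> \<le> W \<and> (\<forall>i<nat (ev u N \<sigma>). safe u W c
     (put (fold (\<lambda>i \<tau>. sem u c (put \<tau> x 0 0 (int i))) [0..<i] \<sigma>) x 0 0 (int i))))"

primrec mods :: "cmd \<Rightarrow> nat set" where
  "mods (Asg k a b e) = {k}"
| "mods (c ;; d) = mods c \<union> mods d"
| "mods (For x N c) = insert x (mods c)"

lemma sem_frame: "k \<notin> mods c \<Longrightarrow> sem u c \<sigma> k = \<sigma> k"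
proof (induction c arbitrary: \<sigma>)
  case (For x N c)
  have "fold (\<lambda>i \<tau>. sem u c (put \<tau> x 0 0 (int i))) xs \<tau> k = \<tau> k" for xs \<tau>
    using For by (induction xs arbitrary: \<tau>) auto
  then show ?case by simp
qed auto

text \<open>A triple at a single start state, so that postconditions can refer to
  \<open>\<sigma>\<close> directly.\<close>

definition htr :: "memory \<Rightarrow> int \<Rightarrow> cmd \<Rightarrow> state \<Rightarrow> (state \<Rightarrow> bool) \<Rightarrow> bool" where
  "htr u W c \<sigma> Q \<longleftrightarrow> safe u W c \<sigma> \<and> Q (sem u c \<sigma>)"

lemma htr_Asg: "\<bar>ev u e \<sigma>\<bar> \<le> W \<Longrightarrow> Q (put \<sigma> k (ev u a \<sigma>) (ev u b \<sigma>) (ev u e \<sigma>))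
    \<Longrightarrow> htr u W (Asg k a b e) \<sigma> Q"
  by (simp add: htr_def)

text \<open>The frame of \<open>c\<close> is handed to the proof about \<open>d\<close>, so
  \<open>P\<close> need only describe what \<open>c\<close> changes.\<close>

lemma htr_Sq:
  assumes "htr u W c \<sigma> P"
    and "\<And>\<tau>. P \<tau> \<Longrightarrow> (\<And>k. k \<notin> mods c \<Longrightarrow> \<tau> k = \<sigma> k) \<Longrightarrow> htr u W d \<tau> Q"
  shows "htr u W (c ;; d) \<sigma> Q"
proof -
  have "htr u W d (sem u c \<sigma>) Q"
    by (rule assms(2)) (use assms(1) in \<open>auto simp: htr_def sem_frame\<close>)
  with assms(1) show ?thesis by (auto simp: htr_def)
qed

text \<open>The counter is written at the start of each iteration, so \<open>I\<close> need not
  mention it; the bound stays \<open>m\<close> even if the body changes registers occurring in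
  \<open>N\<close>.\<close>

lemma htr_For:
  assumes "ev u N \<sigma> = int m" "int m \<le> W" "I 0 \<sigma>"
    and step: "\<And>i \<tau>. i < m \<Longrightarrow> I i \<tau> \<Longrightarrow> (\<And>k. k \<notin> insert x (mods c) \<Longrightarrow> \<tau> k = \<sigma> k)
      \<Longrightarrow> htr u W c (put \<tau> x 0 0 (int i)) (I (Suc i))"
  shows "htr u W (For x N c) \<sigma> (I m)"
proof -
  let ?F = "\<lambda>i. fold (\<lambda>i \<tau>. sem u c (put \<tau> x 0 0 (int i))) [0..<i] \<sigma>"
  have frame: "?F i k = \<sigma> k" if "k \<notin> insert x (mods c)" for i k
    using that by (induction i) (auto simp: sem_frame)
  have inv: "I i (?F i)" if "i \<le> m" for i
    using that
  proof (induction i)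
    case (Suc i)
    then have "htr u W c (put (?F i) x 0 0 (int i)) (I (Suc i))"
      by (intro step frame) auto
    then show ?case by (simp add: htr_def)
  qed (simp add: assms)
  have "safe u W c (put (?F i) x 0 0 (int i))" if "i < m" for i
    using step[OF that, of "?F i"] inv[of i] frame that by (auto simp: htr_def)
  then show ?thesis using assms(1,2) inv[of m] by (simp add: htr_def)
qed

lemma htr_conseq: "htr u W c \<sigma> P \<Longrightarrow> (\<And>\<tau>. P \<tau> \<Longrightarrow> (\<And>k. k \<notin> mods c \<Longrightarrow> \<tau> k = \<sigma> k) \<Longrightarrow> Q \<tau>) \<Longrightarrow> htr u W c \<sigma> Q"
  by (auto simp: htr_def sem_frame)

text \<open>Arrays live at negative addresses, so that the input at the nonnegative ones stays
  intact. The numbering is a polynomial because the machine has to compute it by sums and products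
  alone: \<open>zig\<close> sends the integers injectively to the triangular numbers, and
  \<open>pr a b\<close> lies between \<open>(a + b)\<^sup>2\<close> and the next square, which
  reveals \<open>a + b\<close> and then \<open>a\<close>.\<close>

definition zig :: "int \<Rightarrow> int" where "zig a = 2 * (a * a) + a"
definition pr :: "int \<Rightarrow> int \<Rightarrow> int" where "pr a b = (a + b) * (a + b) + a"
definition addr :: "nat \<Rightarrow> int \<Rightarrow> int \<Rightarrow> int" where
  "addr k a b = - 1 - pr (int k) (pr (zig a) (zig b))"

lemma abs_le_mult_self: "\<bar>a\<bar> \<le> a * (a :: int)"
proof -
  have "0 \<le> \<bar>a\<bar> * (\<bar>a\<bar> - 1)" by (cases "a = 0") auto
  then show ?thesis by (simp add: right_diff_distrib)
qed

lemma zig_nonneg: "zig a \<ge> 0"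
  using abs_le_mult_self[of a] by (simp add: zig_def)

lemma zig_inj: "zig a = zig b \<longleftrightarrow> a = b"
proof
  assume "zig a = zig b"
  then have "(a - b) * (2 * (a + b) + 1) = 0" by (simp add: zig_def algebra_simps)
  moreover have "2 * (a + b) + 1 \<noteq> 0" by presburger
  ultimately show "a = b" by simp
qed simp

lemma pr_nonneg: "a \<ge> 0 \<Longrightarrow> b \<ge> 0 \<Longrightarrow> pr a b \<ge> 0"
  by (simp add: pr_def)

lemma pr_inj:
  assumes "a \<ge> 0" "b \<ge> 0" "c \<ge> 0" "d \<ge> 0"
  shows "pr a b = pr c d \<longleftrightarrow> a = c \<and> b = d"
proof
  assume eq: "pr a b = pr c d"
  have less: "pr a b < pr c d" if "a \<ge> 0" "b \<ge> 0" "c \<ge> 0" "d \<ge> 0" "a + b < c + d" for a b c d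
  proof -
    have "(a + b + 1) * (a + b + 1) \<le> (c + d) * (c + d)" using that by (intro mult_mono) auto
    then show ?thesis using that by (simp add: pr_def algebra_simps)
  qed
  have "a + b = c + d" using less[of a b c d] less[of c d a b] assms eq by linarith
  with eq show "a = c \<and> b = d" by (simp add: pr_def)
qed simp

lemma addr_neg: "addr k a b < 0"
  using pr_nonneg[OF _ pr_nonneg[OF zig_nonneg zig_nonneg], of "int k" a b] by (simp add: addr_def)

lemma addr_inj [simp]: "addr k a b = addr k' a' b' \<longleftrightarrow> k = k' \<and> a = a' \<and> b = b'"
  by (simp add: addr_def pr_inj pr_nonneg zig_nonneg zig_inj)

section \<open>Machine expressions for array cells and tests\<close>

definition czig :: "expr \<Rightarrow> expr" where
  "czig a = Plus (Times (Const 2) (Times a a)) a"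
definition cpr :: "expr \<Rightarrow> expr \<Rightarrow> expr" where
  "cpr a b = Plus (Times (Plus a b) (Plus a b)) a"
definition caddr :: "nat \<Rightarrow> expr \<Rightarrow> expr \<Rightarrow> expr" where
  "caddr k a b = Minus (Const (- 1)) (cpr (Const (int k)) (cpr (czig a) (czig b)))"

lemma val_caddr [simp]: "val (caddr k a b) s = addr k (val a s) (val b s)"
  by (simp add: caddr_def addr_def cpr_def pr_def czig_def zig_def)

text \<open>Since \<open>\<bar>x\<bar> < x * x + 1\<close>, the quotient of \<open>x\<close> by \<open>x * x + 1\<close> is \<open>- 1\<close> or \<open>0\<close>,
  depending on the sign of \<open>x\<close>.\<close>

definition cneg :: "expr \<Rightarrow> expr" where
  "cneg x = Minus (Const 0) (Quot x (Plus (Times x x) (Const 1)))"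

lemma val_cneg [simp]: "val (cneg x) s = of_bool (val x s < 0)"
proof -
  define y where "y = val x s"
  have b: "\<bar>y\<bar> < y * y + 1"
    using abs_le_mult_self[of y] by simp
  have "y div (y * y + 1) = (if y < 0 then - 1 else 0)"
  proof (cases "y < 0")
    case True
    then show ?thesis using b by (auto intro!: int_div_pos_eq[of _ _ _ "y + (y * y + 1)"])
  next
    case False
    then show ?thesis using b by (simp add: div_pos_pos_trivial)
  qed
  then show ?thesis by (simp add: cneg_def y_def)
qed

definition ceq :: "expr \<Rightarrow> expr" where
  "ceq x = Quot (Const 1) (Plus (Times x x) (Const 1))"

lemma val_ceq [simp]: "val (ceq x) s = of_bool (val x s = 0)"
proof -
  have "0 < val x s * val x s" if "val x s \<noteq> 0"
    using that by (simp add: zero_less_mult_iff) linarith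
  then show ?thesis by (auto simp: ceq_def div_pos_pos_trivial)
qed

text \<open>The factor \<open>1 - [a < 0]\<close> in the address of \<open>In\<close> computes
  \<open>max 0 a\<close>; thus an input access can never read a working cell, and \<open>cex\<close>
  agrees with \<open>ev\<close> in every state.\<close>

fun cex :: "ex \<Rightarrow> expr" where
  "cex (Cn a) = Const a"
| "cex (Rd k a b) = Load (caddr (Suc k) (cex a) (cex b))"
| "cex (In a) = Load (Times (cex a) (Minus (Const 1) (cneg (cex a))))"
| "cex (a \<oplus> b) = Plus (cex a) (cex b)"
| "cex (a \<ominus> b) = Minus (cex a) (cex b)"
| "cex (a \<otimes> b) = Times (cex a) (cex b)"
| "cex (a \<oslash> b) = Quot (cex a) (cex b)"
| "cex (a \<doteq> b) = ceq (Minus (cex a) (cex b))"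
| "cex (a \<lless> b) = cneg (Minus (cex a) (cex b))"

text \<open>Array \<open>0\<close> of the machine holds the hidden loop registers: the loop at nesting depth \<open>D\<close>
  uses row \<open>D\<close>. Array \<open>k\<close> of the source language is array \<open>k + 1\<close> of the machine.\<close>

definition rel :: "memory \<Rightarrow> state \<Rightarrow> memory \<Rightarrow> bool" where
  "rel u \<sigma> s \<longleftrightarrow> (\<forall>k a b. s (addr (Suc k) a b) = \<sigma> k a b) \<and> (\<forall>a\<ge>0. s a = u a)"

lemma val_cex: "rel u \<sigma> s \<Longrightarrow> val (cex e) s = ev u e \<sigma>"
  by (induction e) (auto simp: rel_def max_def)

lemma rel_put: "rel u \<sigma> s \<Longrightarrow> rel u (put \<sigma> k a b v) (s(addr (Suc k) a b := v))"
  using addr_neg[of "Suc k" a b] by (auto simp: rel_def put_apply)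

lemma rel_hidden: "rel u \<sigma> s \<Longrightarrow> rel u \<sigma> (s(addr 0 a b := v))"
  using addr_neg[of 0 a b] by (auto simp: rel_def)

section \<open>Lengths of values and evaluation time of expressions\<close>

fun lsize :: "expr \<Rightarrow> nat" where
  "lsize (Const a) = int_size a"
| "lsize (Load e) = 1"
| "lsize (Plus e f) = lsize e + lsize f"
| "lsize (Minus e f) = lsize e + lsize f"
| "lsize (Times e f) = lsize e + lsize f"
| "lsize (Quot e f) = lsize e + lsize f"

text \<open>If all registers have length at most \<open>\<beta>\<close>, a value has length at most
  \<open>lsize e * \<beta>\<close>, because lengths are subadditive under all four operations; a
  loaded value is a register and counts \<open>1\<close>. Summed over all subexpressions this makes
  \<open>tcost e * \<beta>\<close> a bound on the time, with a factor that depends on the expression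
  only.\<close>

fun tcost :: "expr \<Rightarrow> nat" where
  "tcost (Const a) = int_size a"
| "tcost (Load e) = tcost e + 1"
| "tcost (Plus e f) = tcost e + tcost f + lsize e + lsize f"
| "tcost (Minus e f) = tcost e + tcost f + lsize e + lsize f"
| "tcost (Times e f) = tcost e + tcost f + lsize e + lsize f"
| "tcost (Quot e f) = tcost e + tcost f + lsize e + lsize f"

lemma int_size_pos: "int_size a \<ge> 1"
  by (simp add: int_size_def)

lemma int_size_le_iff: "int_size a \<le> Suc m \<longleftrightarrow> \<bar>a\<bar> < 2 ^ m"
  using bitlen_le_iff_power[of "\<bar>a\<bar>" m] by (auto simp: int_size_def nat_le_iff)

lemma int_size_add_le:
  assumes "\<bar>c\<bar> \<le> \<bar>a\<bar> + \<bar>b\<bar>"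
  shows "int_size c \<le> int_size a + int_size b"
proof -
  obtain m where m: "int_size a = Suc m" using int_size_pos[of a] by (cases "int_size a") auto
  obtain l where l: "int_size b = Suc l" using int_size_pos[of b] by (cases "int_size b") auto
  have "\<bar>a\<bar> < 2 ^ m" "\<bar>b\<bar> < 2 ^ l" using m l int_size_le_iff by (metis order_refl)+
  moreover have "(2::int) ^ m \<le> 2 ^ (m + l)" "(2::int) ^ l \<le> 2 ^ (m + l)"
    by (auto intro: power_increasing)
  ultimately have "\<bar>c\<bar> < 2 ^ (m + l) + 2 ^ (m + l)" using assms by linarith
  then have "\<bar>c\<bar> < 2 ^ Suc (m + l)" by simp
  then have "int_size c \<le> Suc (Suc (m + l))" by (simp only: int_size_le_iff)
  then show ?thesis using m l by simp
qed

lemma int_size_mult_le: "int_size (a * b) \<le> int_size a + int_size b"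
proof -
  obtain m where m: "int_size a = Suc m" using int_size_pos[of a] by (cases "int_size a") auto
  obtain l where l: "int_size b = Suc l" using int_size_pos[of b] by (cases "int_size b") auto
  have "\<bar>a\<bar> < 2 ^ m" "\<bar>b\<bar> < 2 ^ l" using m l int_size_le_iff by (metis order_refl)+
  then have "\<bar>a * b\<bar> < 2 ^ m * 2 ^ l" unfolding abs_mult by (intro mult_strict_mono) auto
  then have "int_size (a * b) \<le> Suc (m + l)" by (simp only: int_size_le_iff power_add)
  then show ?thesis using m l by simp
qed

lemma abs_div_le: "\<bar>a div b\<bar> \<le> \<bar>a :: int\<bar>"
proof -
  have pos: "\<bar>a div b\<bar> \<le> \<bar>a\<bar>" if b: "0 < b" for a b :: int
  proof (cases "0 \<le> a")
    case True
    then have "a div b \<le> a" using b by (smt (verit) div_by_1 zdiv_mono2)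
    moreover have "0 \<le> a div b" using True b by (simp add: pos_imp_zdiv_nonneg_iff)
    ultimately show ?thesis by linarith
  next
    case False
    then have "a \<le> a div b" using b by (smt (verit) div_by_1 zdiv_mono2_neg)
    moreover have "a div b < 0" using False b by (simp add: pos_imp_zdiv_neg_iff)
    ultimately show ?thesis by linarith
  qed
  show ?thesis
  proof (cases b "0 :: int" rule: linorder_cases)
    case less
    then show ?thesis using pos[of "- b" "- a"] by simp
  qed (use pos[of b a] in simp_all)
qed

lemma int_size_div_le: "int_size (a div b) \<le> int_size a + int_size b"
  by (rule int_size_add_le) (use abs_div_le[of a b] in linarith)

lemma int_size_val:
  assumes "\<And>a. int_size (s a) \<le> \<beta>"
  shows "int_size (val e s) \<le> lsize e * \<beta>"
proof -
  have "\<beta> \<ge> 1" using assms[of 0] int_size_pos[of "s 0"] by linarith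
  show ?thesis
  proof (induction e)
    case (Const x)
    then show ?case using \<open>\<beta> \<ge> 1\<close> by simp
  next
    case (Load e)
    then show ?case using assms by simp
  next
    case (Plus e f)
    then show ?case using int_size_add_le[OF abs_triangle_ineq, of "val e s" "val f s"]
      by (simp add: add_mult_distrib)
  next
    case (Minus e f)
    then show ?case using int_size_add_le[OF abs_triangle_ineq4, of "val e s" "val f s"]
      by (simp add: add_mult_distrib)
  next
    case (Times e f)
    then show ?case using int_size_mult_le[of "val e s" "val f s"]
      by (simp add: add_mult_distrib)
  next
    case (Quot e f)
    then show ?case using int_size_div_le[of "val e s" "val f s"]
      by (simp add: add_mult_distrib)
  qed
qed

lemma expr_time_le:
  assumes b: "\<And>a. int_size (s a) \<le> \<beta>"
  shows "expr_time e s \<le> tcost e * \<beta>"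
proof -
  have "\<beta> \<ge> 1" using assms[of 0] int_size_pos[of "s 0"] by linarith
  have v: "int_size (val e s) \<le> lsize e * \<beta>" for e by (rule int_size_val[OF b])
  show ?thesis
  proof (induction e)
    case (Const x)
    then show ?case using \<open>\<beta> \<ge> 1\<close> by simp
  next
    case (Load e)
    then show ?case using b[of "val e s"] by (simp add: add_mult_distrib)
  next
    case (Plus e f)
    then show ?case using v[of "Plus e f"] by (simp add: add_mult_distrib)
  next
    case (Minus e f)
    then show ?case using v[of "Minus e f"] by (simp add: add_mult_distrib)
  next
    case (Times e f)
    then show ?case using v[of "Times e f"] by (simp add: add_mult_distrib)
  next
    case (Quot e f)
    then show ?case using v[of "Quot e f"] by (simp add: add_mult_distrib)
  qed
qed

text \<open>Very wasteful, as a logarithm would do; but with \<open>m\<close> polynomial in the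
  input size, a polynomial bound on lengths is all that matters.\<close>

lemma int_size_le_nat: "\<bar>a\<bar> \<le> int m \<Longrightarrow> int_size a \<le> m + 2"
proof -
  assume "\<bar>a\<bar> \<le> int m"
  moreover have "int m < 2 ^ Suc m" using of_nat_less_two_power[of "Suc m", where 'a = int] by simp
  ultimately have "\<bar>a\<bar> < 2 ^ Suc m" by linarith
  then have "int_size a \<le> Suc (Suc m)" by (simp only: int_size_le_iff)
  then show ?thesis by simp
qed


section \<open>Compilation of loops and its running time\<close>

abbreviation (input) climit :: "nat \<Rightarrow> expr" where "climit D \<equiv> Const (addr 0 (int D) 0)"
abbreviation (input) ccount :: "nat \<Rightarrow> expr" where "ccount D \<equiv> Const (addr 0 (int D) 1)"

text \<open>Column \<open>0\<close> of the hidden row \<open>D\<close> keeps the loop bound and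
  column \<open>1\<close> the true counter. The visible counter \<open>x\<close> is only a copy, so
  a body that overwrites \<open>x\<close> or the registers in \<open>N\<close> cannot change the
  number of iterations.\<close>

fun comp :: "nat \<Rightarrow> cmd \<Rightarrow> prog" where
  "comp D (Asg k a b e) = Store (caddr (Suc k) (cex a) (cex b)) (cex e)"
| "comp D (c ;; d) = Seq (comp D c) (comp D d)"
| "comp D (For x N c) =
     Seq (Store (climit D) (cex N)) (Seq (Store (ccount D) (Const 0))
       (While (Minus (Load (climit D)) (Load (ccount D)))
         (Seq (Store (Const (addr (Suc x) 0 0)) (Load (ccount D)))
           (Seq (comp (Suc D) c)
             (Store (ccount D) (Plus (Load (ccount D)) (Const 1)))))))"

text \<open>The factor \<open>\<beta>\<close> in front of the cost of one iteration stands for the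
  number of iterations, which safety bounds by \<open>W\<close>.\<close>

fun comp_time :: "nat \<Rightarrow> cmd \<Rightarrow> nat \<Rightarrow> nat" where
  "comp_time D (Asg k a b e) \<beta> =
     (tcost (caddr (Suc k) (cex a) (cex b)) + tcost (cex e)) * \<beta> + 1"
| "comp_time D (c ;; d) \<beta> = comp_time D c \<beta> + comp_time D d \<beta> + 1"
| "comp_time D (For x N c) \<beta> =
     (tcost (climit D) + tcost (cex N) + tcost (ccount D) + tcost (Const 0)
       + tcost (Minus (Load (climit D)) (Load (ccount D)))) * \<beta> + 5
     + \<beta> * ((tcost (Minus (Load (climit D)) (Load (ccount D)))
         + tcost (Const (addr (Suc x) 0 0)) + tcost (Load (ccount D))
         + tcost (ccount D) + tcost (Plus (Load (ccount D)) (Const 1))) * \<beta>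
         + comp_time (Suc D) c \<beta> + 5)"

lemma runs_mono_Store: "expr_time a s + expr_time e s + 1 = t \<Longrightarrow> s(val a s := val e s) = s'
    \<Longrightarrow> runs (Store a e) s t s'"
  using runs.Store[of a e s] by simp

text \<open>The last conjunct is what the induction needs: the body of a loop at depth
  \<open>D\<close> is compiled at depth \<open>Suc D\<close> and leaves the hidden bounds and
  counters of the enclosing loops alone.\<close>

lemma comp_runs:
  assumes "rel u \<sigma> s" "safe u (int W) c \<sigma>" "\<And>a. int_size (s a) \<le> \<beta>" "W + 2 \<le> \<beta>"
  shows "\<exists>t s'. runs (comp D c) s t s' \<and> t \<le> comp_time D c \<beta> \<and> rel u (sem u c \<sigma>) s' \<and>
    (\<forall>a. int_size (s' a) \<le> \<beta>) \<and> (\<forall>E<D. \<forall>b. s' (addr 0 (int E) b) = s (addr 0 (int E) b))"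
  using assms
proof (induction c arbitrary: D \<sigma> s)
  case (Asg k a b e)
  let ?s = "s(addr (Suc k) (ev u a \<sigma>) (ev u b \<sigma>) := ev u e \<sigma>)"
  let ?t = "expr_time (caddr (Suc k) (cex a) (cex b)) s + expr_time (cex e) s + 1"
  have "runs (comp D (Asg k a b e)) s ?t ?s"
    by (simp, rule runs_mono_Store) (auto simp: val_cex[OF Asg.prems(1)])
  moreover have "?t \<le> comp_time D (Asg k a b e) \<beta>"
    using expr_time_le[of s \<beta> "caddr (Suc k) (cex a) (cex b)"]
      expr_time_le[of s \<beta> "cex e"] Asg.prems(3) by (simp add: add_mult_distrib)
  moreover have "rel u (sem u (Asg k a b e) \<sigma>) ?s"
    using rel_put[OF Asg.prems(1)] by simp
  moreover have "int_size (ev u e \<sigma>) \<le> \<beta>"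
    using Asg.prems(2,4) int_size_le_nat[of "ev u e \<sigma>" W] by simp
  then have "\<forall>a. int_size (?s a) \<le> \<beta>" using Asg.prems(3) by simp
  moreover have "\<forall>E<D. \<forall>b. ?s (addr 0 (int E) b) = s (addr 0 (int E) b)" by simp
  ultimately show ?case by blast
next
  case (Sq c d)
  from Sq.IH(1)[of \<sigma> s D] Sq.prems obtain t1 s1 where 1: "runs (comp D c) s t1 s1"
    "t1 \<le> comp_time D c \<beta>" "rel u (sem u c \<sigma>) s1" "\<And>a. int_size (s1 a) \<le> \<beta>"
    "\<forall>E<D. \<forall>b. s1 (addr 0 (int E) b) = s (addr 0 (int E) b)" by auto
  from Sq.IH(2)[of "sem u c \<sigma>" s1 D] Sq.prems 1 obtain t2 s2 where 2: "runs (comp D d) s1 t2 s2"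
    "t2 \<le> comp_time D d \<beta>" "rel u (sem u d (sem u c \<sigma>)) s2" "\<And>a. int_size (s2 a) \<le> \<beta>"
    "\<forall>E<D. \<forall>b. s2 (addr 0 (int E) b) = s1 (addr 0 (int E) b)" by auto
  from runs.Seq[OF 1(1) 2(1)] 1 2 show ?case
    by (intro exI[of _ "t1 + t2 + 1"] exI[of _ s2]) auto
next
  case (For x N c)
  define m where "m = nat (ev u N \<sigma>)"
  define F where "F = (\<lambda>i. fold (\<lambda>i \<tau>. sem u c (put \<tau> x 0 0 (int i))) [0..<i] \<sigma>)"
  define test where "test = Minus (Load (climit D)) (Load (ccount D))"
  define body where "body = Seq (Store (Const (addr (Suc x) 0 0)) (Load (ccount D)))
           (Seq (comp (Suc D) c)
             (Store (ccount D) (Plus (Load (ccount D)) (Const 1))))"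
  define K where "K = (tcost test
         + tcost (Const (addr (Suc x) 0 0)) + tcost (Load (ccount D))
         + tcost (ccount D) + tcost (Plus (Load (ccount D)) (Const 1))) * \<beta>
         + comp_time (Suc D) c \<beta> + 5"
  have N: "\<bar>ev u N \<sigma>\<bar> \<le> int W" using For.prems(2) by simp
  have m: "m \<le> W" using N by (simp add: m_def)
  have sz: "int_size v \<le> \<beta>" if "\<bar>v\<bar> \<le> int W" for v
    using int_size_le_nat[OF that] For.prems(4) by simp
  \<comment> \<open>Induction on the number \<open>j\<close> of iterations still to come;
    \<open>F (m - j)\<close> is the source state reached so far.\<close>
  have loop: "\<exists>t s'. runs (While test body) r t s' \<and> t \<le> j * K + tcost test * \<beta> + 1 \<and> rel u (F m) s' \<and>
      (\<forall>a. int_size (s' a) \<le> \<beta>) \<and> (\<forall>E<D. \<forall>b. s' (addr 0 (int E) b) = r (addr 0 (int E) b))"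
    if "j \<le> m" "rel u (F (m - j)) r" "\<And>a. int_size (r a) \<le> \<beta>"
      "r (addr 0 (int D) 0) = ev u N \<sigma>" "r (addr 0 (int D) 1) = int (m - j)" for j r
    using that
  proof (induction j arbitrary: r)
    case 0
    have "\<not> val test r > 0" using 0 by (simp add: test_def m_def)
    from runs.WhileFalse[OF this] show ?case
      using 0 expr_time_le[of r \<beta> test] by (intro exI conjI) auto
  next
    case (Suc j)
    define i where "i = m - Suc j"
    have i: "i < m" "m - j = Suc i" using Suc.prems(1) by (auto simp: i_def)
    define r1 where "r1 = r(addr (Suc x) 0 0 := int i)"
    have b1: "int_size (r1 a) \<le> \<beta>" for a
      using Suc.prems(3) sz[of "int i"] i m by (simp add: r1_def)
    have rel1: "rel u (put (F i) x 0 0 (int i)) r1"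
      unfolding r1_def by (rule rel_put) (use Suc.prems i_def in simp)
    have "safe u (int W) c (put (F i) x 0 0 (int i))"
      using For.prems(2) i by (simp add: F_def m_def)
    from For.IH[OF rel1 this b1 For.prems(4), of "Suc D"] obtain t2 r2 where
      2: "runs (comp (Suc D) c) r1 t2 r2" "t2 \<le> comp_time (Suc D) c \<beta>"
      "rel u (sem u c (put (F i) x 0 0 (int i))) r2" "\<And>a. int_size (r2 a) \<le> \<beta>"
      "\<forall>E<Suc D. \<forall>b. r2 (addr 0 (int E) b) = r1 (addr 0 (int E) b)" by auto
    define r3 where "r3 = r2(addr 0 (int D) 1 := int (Suc i))"
    have F_Suc: "sem u c (put (F i) x 0 0 (int i)) = F (Suc i)" by (simp add: F_def)
    have rel3: "rel u (F (m - j)) r3" unfolding r3_def i(2)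
      by (rule rel_hidden) (use 2(3) F_Suc in simp)
    have b3: "int_size (r3 a) \<le> \<beta>" for a
      using 2(4) sz[of "int (Suc i)"] i m by (simp add: r3_def)
    have c2: "r2 (addr 0 (int D) 1) = int i" "r2 (addr 0 (int D) 0) = ev u N \<sigma>"
      using 2(5) Suc.prems(4,5) by (auto simp: r1_def i_def)
    have "\<exists>t s'. runs (While test body) r3 t s' \<and> t \<le> j * K + tcost test * \<beta> + 1 \<and> rel u (F m) s' \<and>
      (\<forall>a. int_size (s' a) \<le> \<beta>) \<and> (\<forall>E<D. \<forall>b. s' (addr 0 (int E) b) = r3 (addr 0 (int E) b))"
    proof (rule Suc.IH[OF _ rel3 b3])
      show "r3 (addr 0 (int D) 0) = ev u N \<sigma>" "r3 (addr 0 (int D) 1) = int (m - j)"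
        using c2 i by (auto simp: r3_def)
    qed (use Suc.prems(1) in simp)
    then obtain t4 r4 where 4: "runs (While test body) r3 t4 r4" "t4 \<le> j * K + tcost test * \<beta> + 1"
      "rel u (F m) r4" "\<forall>a. int_size (r4 a) \<le> \<beta>"
      "\<forall>E<D. \<forall>b. r4 (addr 0 (int E) b) = r3 (addr 0 (int E) b)" by blast
    let ?A = "Store (Const (addr (Suc x) 0 0)) (Load (ccount D))"
    let ?C = "Store (ccount D) (Plus (Load (ccount D)) (Const 1))"
    let ?tA = "expr_time (Const (addr (Suc x) 0 0)) r + expr_time (Load (ccount D)) r + 1"
    let ?tC = "expr_time (ccount D) r2 + expr_time (Plus (Load (ccount D)) (Const 1)) r2 + 1"
    have A: "runs ?A r ?tA r1"
      by (rule runs_mono_Store) (use Suc.prems in \<open>auto simp: r1_def i_def\<close>)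
    have C: "runs ?C r2 ?tC r3"
      by (rule runs_mono_Store) (use c2 in \<open>auto simp: r3_def\<close>)
    have B: "runs body r (?tA + (t2 + ?tC + 1) + 1) r3"
      unfolding body_def by (intro runs.Seq[OF A] runs.Seq[OF 2(1)] C)
    have "ev u N \<sigma> = int m" using i(1) unfolding m_def by linarith
    then have "val test r > 0" using Suc.prems(4,5) i(1) unfolding i_def[symmetric] by (simp add: test_def)
    from runs.WhileTrue[OF this B 4(1)]
    have "runs (While test body) r (expr_time test r + (?tA + (t2 + ?tC + 1) + 1) + t4 + 1) r4" .
    moreover have "expr_time test r + (?tA + (t2 + ?tC + 1) + 1) + 1 \<le> K"
      using expr_time_le[of r \<beta> test, OF Suc.prems(3)]
        expr_time_le[of r \<beta> "Const (addr (Suc x) 0 0)", OF Suc.prems(3)]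
        expr_time_le[of r \<beta> "Load (ccount D)", OF Suc.prems(3)]
        expr_time_le[of r2 \<beta> "ccount D", OF 2(4)]
        expr_time_le[of r2 \<beta> "Plus (Load (ccount D)) (Const 1)", OF 2(4)] 2(2)
      unfolding K_def add_mult_distrib by linarith
    then have "expr_time test r + (?tA + (t2 + ?tC + 1) + 1) + t4 + 1 \<le> Suc j * K + tcost test * \<beta> + 1"
      using 4(2) by simp
    moreover have "\<forall>E<D. \<forall>b. r4 (addr 0 (int E) b) = r (addr 0 (int E) b)"
      using 4(5) 2(5) by (auto simp: r3_def r1_def)
    ultimately show ?case using 4(3,4) by blast
  qed
  define s1 where "s1 = s(addr 0 (int D) 0 := ev u N \<sigma>)"
  define s2 where "s2 = s1(addr 0 (int D) 1 := 0)"
  have b1: "int_size (s1 a) \<le> \<beta>" for a using For.prems(3) sz[OF N] by (simp add: s1_def)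
  have b2: "int_size (s2 a) \<le> \<beta>" for a using b1 sz[of 0] by (simp add: s2_def)
  let ?A = "Store (climit D) (cex N)"
  let ?B = "Store (ccount D) (Const 0)"
  let ?tA = "expr_time (climit D) s + expr_time (cex N) s + 1"
  let ?tB = "expr_time (ccount D) s1 + expr_time (Const 0) s1 + 1"
  have A: "runs ?A s ?tA s1"
    by (rule runs_mono_Store) (auto simp: s1_def val_cex[OF For.prems(1)])
  have B: "runs ?B s1 ?tB s2"
    by (rule runs_mono_Store) (auto simp: s2_def)
  have "rel u (F (m - m)) s2"
    unfolding s2_def s1_def by (intro rel_hidden) (use For.prems(1) in \<open>simp add: F_def\<close>)
  moreover have "s2 (addr 0 (int D) 0) = ev u N \<sigma>" "s2 (addr 0 (int D) 1) = int (m - m)"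
    by (simp_all add: s2_def s1_def)
  ultimately obtain t3 s3 where
    3: "runs (While test body) s2 t3 s3" "t3 \<le> m * K + tcost test * \<beta> + 1" "rel u (F m) s3"
      "\<forall>a. int_size (s3 a) \<le> \<beta>" "\<forall>E<D. \<forall>b. s3 (addr 0 (int E) b) = s2 (addr 0 (int E) b)"
    using loop[of m s2] b2 by blast
  have "runs (comp D (For x N c)) s (?tA + (?tB + t3 + 1) + 1) s3"
    using runs.Seq[OF A runs.Seq[OF B 3(1)]] by (simp add: test_def body_def)
  moreover have "m * K \<le> \<beta> * K" using m For.prems(4) by simp
  then have "?tA + (?tB + t3 + 1) + 1 \<le> comp_time D (For x N c) \<beta>"
    using expr_time_le[of s \<beta> "climit D", OF For.prems(3)] expr_time_le[of s \<beta> "cex N", OF For.prems(3)]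
      expr_time_le[of s1 \<beta> "ccount D", OF b1] expr_time_le[of s1 \<beta> "Const 0", OF b1] 3(2)
    unfolding comp_time.simps test_def[symmetric] K_def[symmetric]
    unfolding add_mult_distrib by linarith
  moreover have "sem u (For x N c) \<sigma> = F m" by (simp add: F_def m_def)
  moreover have "\<forall>E<D. \<forall>b. s3 (addr 0 (int E) b) = s (addr 0 (int E) b)"
    using 3(5) by (auto simp: s2_def s1_def)
  ultimately show ?case using 3(3,4) by metis
qed

lemma comp_time_poly: "\<exists>p :: nat poly. \<forall>\<beta>. comp_time D c \<beta> = poly p \<beta>"
proof (induction c arbitrary: D)
  case (Asg k a b e)
  show ?case
    by (rule exI[of _ "[:1, tcost (caddr (Suc k) (cex a) (cex b)) + tcost (cex e):]"]) simp
next
  case (Sq c d)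
  from Sq.IH[of D] obtain p q :: "nat poly" where "\<forall>\<beta>. comp_time D c \<beta> = poly p \<beta>" "\<forall>\<beta>. comp_time D d \<beta> = poly q \<beta>"
    by blast
  then show ?case by (intro exI[of _ "p + q + [:1:]"]) simp
next
  case (For x N c)
  from For.IH[of "Suc D"] obtain p :: "nat poly" where p: "\<forall>\<beta>. comp_time (Suc D) c \<beta> = poly p \<beta>"
    by blast
  have "\<exists>p' :: nat poly. \<forall>\<beta>. A * \<beta> + 5 + \<beta> * (B * \<beta> + poly p \<beta> + 5) = poly p' \<beta>" for A B
    by (rule exI[of _ "[:5, A:] + [:0, 1:] * ([:5, B:] + p)"]) (simp add: algebra_simps)
  then show ?case unfolding comp_time.simps p[rule_format] .
qed

text \<open>The output is expected at the nonnegative addresses, which a compiled command never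
  writes. So array \<open>0\<close>, including its length in cell \<open>0\<close>, is finally moved
  there, over the input; the hidden cell in row \<open>0\<close> and column \<open>1\<close> serves
  as counter.\<close>

definition copy_body :: prog where
  "copy_body = Seq (Store (Load (ccount 0)) (Load (caddr 1 (Load (ccount 0)) (Const 0))))
     (Store (ccount 0) (Plus (Load (ccount 0)) (Const 1)))"

definition copy_test :: expr where
  "copy_test = Minus (Plus (Load (Const (addr 1 0 0))) (Const 1)) (Load (ccount 0))"

definition copy_prog :: prog where
  "copy_prog = Seq (Store (ccount 0) (Const 0)) (While copy_test copy_body)"

definition copy_time :: "nat \<Rightarrow> nat" where
  "copy_time \<beta> = (tcost (ccount 0) + tcost (Const 0) + tcost copy_test) * \<beta> + 5
     + \<beta> * ((tcost copy_test + tcost (Load (ccount 0)) + tcost (Load (caddr 1 (Load (ccount 0)) (Const 0)))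
        + tcost (ccount 0) + tcost (Plus (Load (ccount 0)) (Const 1))) * \<beta> + 5)"

lemma copy_runs:
  assumes "rel u \<sigma> s" "\<And>a. int_size (s a) \<le> \<beta>" "\<sigma> 0 0 0 = int L" "L + 3 \<le> \<beta>"
  shows "\<exists>t s'. runs copy_prog s t s' \<and> t \<le> copy_time \<beta> \<and> output_of s' = map (\<lambda>a. \<sigma> 0 a 0) [1..int L]"
proof -
  define K where "K = (tcost copy_test + tcost (Load (ccount 0)) + tcost (Load (caddr 1 (Load (ccount 0)) (Const 0)))
        + tcost (ccount 0) + tcost (Plus (Load (ccount 0)) (Const 1))) * \<beta> + 5"
  have sz: "int_size (int v) \<le> \<beta>" if "v \<le> L + 1" for v
    using int_size_le_nat[of "int v" "L + 1"] that assms(4) by simp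
  have loop: "\<exists>t s'. runs (While copy_test copy_body) r t s' \<and> t \<le> j * K + tcost copy_test * \<beta> + 1 \<and>
      (\<forall>a. 0 \<le> a \<and> a \<le> int L \<longrightarrow> s' a = \<sigma> 0 a 0)"
    if "j \<le> L + 1" "\<And>a. r (addr 1 a 0) = \<sigma> 0 a 0" "\<And>a. int_size (r a) \<le> \<beta>"
      "r (addr 0 0 1) = int (L + 1 - j)" "\<forall>a. 0 \<le> a \<and> a < int (L + 1 - j) \<longrightarrow> r a = \<sigma> 0 a 0" for j r
    using that
  proof (induction j arbitrary: r)
    case 0
    have "\<not> val copy_test r > 0" using 0 assms(3) by (simp add: copy_test_def)
    from runs.WhileFalse[OF this] show ?case
      using 0 expr_time_le[of r \<beta> copy_test] by (intro exI conjI) auto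
  next
    case (Suc j)
    define i where "i = L + 1 - Suc j"
    have i: "i \<le> L" "L + 1 - j = Suc i" using Suc.prems(1) by (auto simp: i_def)
    have ri: "r (addr 0 0 1) = int i" using Suc.prems(4) by (simp add: i_def)
    have ne: "addr k a b \<noteq> int v" for k a b v using addr_neg[of k a b] by linarith
    define r1 where "r1 = r(int i := \<sigma> 0 (int i) 0)"
    define r3 where "r3 = r1(addr 0 0 1 := int (Suc i))"
    have b1: "int_size (r1 a) \<le> \<beta>" for a
      using Suc.prems(3)[of a] Suc.prems(3)[of "addr 1 (int i) 0"] unfolding Suc.prems(2)
      by (simp add: r1_def)
    have b3: "int_size (r3 a) \<le> \<beta>" for a
      using b1 sz[of "Suc i"] i by (simp add: r3_def)
    have "\<exists>t s'. runs (While copy_test copy_body) r3 t s' \<and> t \<le> j * K + tcost copy_test * \<beta> + 1 \<and>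
      (\<forall>a. 0 \<le> a \<and> a \<le> int L \<longrightarrow> s' a = \<sigma> 0 a 0)"
    proof (rule Suc.IH)
      show "\<forall>a. 0 \<le> a \<and> a < int (L + 1 - j) \<longrightarrow> r3 a = \<sigma> 0 a 0"
        using Suc.prems(5) addr_neg[of 0 0 1] unfolding i(2) i_def[symmetric]
        by (auto simp: r3_def r1_def)
    qed (use Suc.prems i b3 ne in \<open>auto simp: r3_def r1_def\<close>)
    then obtain t4 r4 where 4: "runs (While copy_test copy_body) r3 t4 r4" "t4 \<le> j * K + tcost copy_test * \<beta> + 1"
      "\<forall>a. 0 \<le> a \<and> a \<le> int L \<longrightarrow> r4 a = \<sigma> 0 a 0" by blast
    let ?e = "Load (caddr 1 (Load (ccount 0)) (Const 0))"
    let ?tA = "expr_time (Load (ccount 0)) r + expr_time ?e r + 1"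
    let ?tC = "expr_time (ccount 0) r1 + expr_time (Plus (Load (ccount 0)) (Const 1)) r1 + 1"
    have A: "runs (Store (Load (ccount 0)) ?e) r ?tA r1"
      by (rule runs_mono_Store) (use Suc.prems ri in \<open>auto simp: r1_def\<close>)
    have C: "runs (Store (ccount 0) (Plus (Load (ccount 0)) (Const 1))) r1 ?tC r3"
      by (rule runs_mono_Store) (use ri ne in \<open>auto simp: r3_def r1_def\<close>)
    have B: "runs copy_body r (?tA + ?tC + 1) r3"
      unfolding copy_body_def by (intro runs.Seq[OF A] C)
    have "val copy_test r > 0" using Suc.prems i ri assms(3) by (simp add: copy_test_def)
    from runs.WhileTrue[OF this B 4(1)]
    have "runs (While copy_test copy_body) r (expr_time copy_test r + (?tA + ?tC + 1) + t4 + 1) r4" .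
    moreover have "expr_time copy_test r + (?tA + ?tC + 1) + 1 \<le> K"
      using expr_time_le[of r \<beta> copy_test, OF Suc.prems(3)]
        expr_time_le[of r \<beta> "Load (ccount 0)", OF Suc.prems(3)]
        expr_time_le[of r \<beta> ?e, OF Suc.prems(3)]
        expr_time_le[of r1 \<beta> "ccount 0", OF b1]
        expr_time_le[of r1 \<beta> "Plus (Load (ccount 0)) (Const 1)", OF b1]
      unfolding K_def add_mult_distrib by linarith
    then have "expr_time copy_test r + (?tA + ?tC + 1) + t4 + 1 \<le> Suc j * K + tcost copy_test * \<beta> + 1"
      using 4(2) by simp
    ultimately show ?case using 4(3) by blast
  qed
  define s1 where "s1 = s(addr 0 0 1 := 0)"
  have b1: "int_size (s1 a) \<le> \<beta>" for a using assms(2) sz[of 0] by (simp add: s1_def)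
  have "s1 (addr 1 a 0) = \<sigma> 0 a 0" for a
    using assms(1) by (simp add: s1_def rel_def)
  moreover have "s1 (addr 0 0 1) = int (L + 1 - (L + 1))" by (simp add: s1_def)
  ultimately have "\<exists>t s'. runs (While copy_test copy_body) s1 t s' \<and>
      t \<le> (L + 1) * K + tcost copy_test * \<beta> + 1 \<and> (\<forall>a. 0 \<le> a \<and> a \<le> int L \<longrightarrow> s' a = \<sigma> 0 a 0)"
    by (intro loop[of "L + 1" s1] b1) auto
  then obtain t3 s3 where
    3: "runs (While copy_test copy_body) s1 t3 s3" "t3 \<le> (L + 1) * K + tcost copy_test * \<beta> + 1"
      "\<forall>a. 0 \<le> a \<and> a \<le> int L \<longrightarrow> s3 a = \<sigma> 0 a 0"
    by blast
  let ?tA = "expr_time (ccount 0) s + expr_time (Const 0) s + 1"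
  have A: "runs (Store (ccount 0) (Const 0)) s ?tA s1"
    by (rule runs_mono_Store) (auto simp: s1_def)
  have "runs copy_prog s (?tA + t3 + 1) s3"
    unfolding copy_prog_def using runs.Seq[OF A 3(1)] by simp
  moreover have "(L + 1) * K \<le> \<beta> * K" using assms(4) by (intro mult_right_mono) auto
  then have "?tA + t3 + 1 \<le> copy_time \<beta>"
    using expr_time_le[of s \<beta> "ccount 0", OF assms(2)] expr_time_le[of s \<beta> "Const 0", OF assms(2)] 3(2)
    unfolding copy_time_def K_def[symmetric] unfolding add_mult_distrib by linarith
  moreover have "output_of s3 = map (\<lambda>a. \<sigma> 0 a 0) [1..int L]"
    using 3(3) assms(3) by (auto simp: output_of_def)
  ultimately show ?thesis by blast
qed

lemma copy_time_poly: "\<exists>p :: nat poly. \<forall>\<beta>. copy_time \<beta> = poly p \<beta>"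
proof -
  have "\<exists>p :: nat poly. \<forall>\<beta>. A * \<beta> + 5 + \<beta> * (B * \<beta> + 5) = poly p \<beta>" for A B
    by (rule exI[of _ "[:5, A:] + [:0, 1:] * [:5, B:]"]) (simp add: algebra_simps)
  then show ?thesis unfolding copy_time_def .
qed

section \<open>Polynomial time from bounded register contents\<close>

lemma int_size_input: "int_size (input_memory xs a) \<le> input_size xs + 2"
proof (cases "1 \<le> a \<and> a \<le> int (length xs)")
  case True
  then have "xs ! nat (a - 1) \<in> set xs" by (intro nth_mem) linarith
  then have "int_size (xs ! nat (a - 1)) \<le> (\<Sum>x\<leftarrow>xs. int_size x)"
    by (intro member_le_sum_list) auto
  then show ?thesis using True by (simp add: input_memory_def input_size_def)
next
  case False
  have "length xs \<le> (\<Sum>x\<leftarrow>xs. int_size x)"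
    using sum_list_mono[of xs "\<lambda>_. 1" int_size] int_size_pos by (simp add: sum_list_triv)
  moreover have "\<bar>input_memory xs a\<bar> \<le> int (length xs)" using False by (auto simp: input_memory_def)
  ultimately have "\<bar>input_memory xs a\<bar> \<le> int (input_size xs)" by (simp add: input_size_def)
  then show ?thesis using int_size_le_nat by blast
qed

text \<open>All registers have length at most \<open>\<beta>\<close>, a polynomial in the input
  size: the stored values by safety, the input by \<open>int_size_input\<close>. The costs of the
  compiled command and of copying are polynomials in \<open>\<beta>\<close>, so composition of
  polynomials bounds the time.\<close>

lemma poly_time_algorithm_cmd:
  fixes w :: "nat poly"
  assumes main: "\<And>I. I \<in> X \<Longrightarrow> \<exists>L. htr (input_memory (enc I)) (int (poly w (input_size (enc I)))) c (\<lambda>_ _ _. 0)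
    (\<lambda>\<sigma>. \<sigma> 0 0 0 = int L \<and> L \<le> poly w (input_size (enc I)) \<and> R I (map (\<lambda>a. \<sigma> 0 a 0) [1..int L]))"
  shows "\<exists>P. poly_time_algorithm P enc X R"
proof -
  obtain p1 p2 :: "nat poly" where p: "\<forall>\<beta>. comp_time 1 c \<beta> = poly p1 \<beta>" "\<forall>\<beta>. copy_time \<beta> = poly p2 \<beta>"
    using comp_time_poly copy_time_poly by meson
  define b where "b = w + [:0, 1:] + [:3:]"
  have "poly_time_algorithm (Seq (comp 1 c) copy_prog) enc X R"
    unfolding poly_time_algorithm_def
  proof (intro exI[of _ "pcompose (p1 + p2 + [:1:]) b"] ballI)
    fix I assume I: "I \<in> X"
    define u where "u = input_memory (enc I)"
    define n where "n = input_size (enc I)"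
    define \<beta> where "\<beta> = poly b n"
    have \<beta>: "\<beta> = poly w n + n + 3" by (simp add: \<beta>_def b_def)
    define s where "s = (\<lambda>a. if a \<ge> 0 then u a else 0)"
    have "u a = 0" if "a < 0" for a using that by (simp add: u_def input_memory_def)
    then have s: "u = s" by (auto simp: s_def fun_eq_iff)
    have rel: "rel u (\<lambda>_ _ _. 0) u"
      using addr_neg by (auto simp: rel_def u_def input_memory_def) (smt (verit) addr_neg)+
    have sz: "int_size (u a) \<le> \<beta>" for a
      using int_size_input[of "enc I" a] by (simp add: u_def \<beta> n_def)
    from main[OF I] obtain L where L: "safe u (int (poly w n)) c (\<lambda>_ _ _. 0)"
      "sem u c (\<lambda>_ _ _. 0) 0 0 0 = int L" "L \<le> poly w n"
      "R I (map (\<lambda>a. sem u c (\<lambda>_ _ _. 0) 0 a 0) [1..int L])"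
      by (auto simp: htr_def u_def n_def)
    from comp_runs[OF rel L(1) sz, of 1] \<beta> obtain t1 s1 where 1: "runs (comp 1 c) u t1 s1"
      "t1 \<le> comp_time 1 c \<beta>" "rel u (sem u c (\<lambda>_ _ _. 0)) s1" "\<And>a. int_size (s1 a) \<le> \<beta>"
      by auto
    from copy_runs[OF 1(3,4) L(2)] L(3) \<beta> obtain t2 s2 where 2: "runs copy_prog s1 t2 s2"
      "t2 \<le> copy_time \<beta>" "output_of s2 = map (\<lambda>a. sem u c (\<lambda>_ _ _. 0) 0 a 0) [1..int L]"
      by auto
    show "\<exists>t s. runs (Seq (comp 1 c) copy_prog) (input_memory (enc I)) t s \<and>
        t \<le> poly (pcompose (p1 + p2 + [:1:]) b) (input_size (enc I)) \<and> R I (output_of s)"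
    proof (intro exI conjI)
      show "runs (Seq (comp 1 c) copy_prog) (input_memory (enc I)) (t1 + t2 + 1) s2"
        using runs.Seq[OF 1(1) 2(1)] by (simp add: u_def)
      show "t1 + t2 + 1 \<le> poly (pcompose (p1 + p2 + [:1:]) b) (input_size (enc I))"
        using 1(2) 2(2) p by (simp add: poly_pcompose \<beta>_def n_def)
      show "R I (output_of s2)" using L(4) 2(3) by simp
    qed
  qed
  then show ?thesis by blast
qed

section \<open>Rounding a fractional solution\<close>

text \<open>Let \<open>t\<close> be the largest value in \<open>R - T\<close>; values in
  \<open>T\<close> are at least \<open>t\<close>. Moving opening mass of \<open>y\<close> from
  \<open>R - T\<close> to \<open>T\<close> at the price \<open>t\<close> per unit never increases
  the cost and leads to \<open>1\<close> on \<open>T\<close> and \<open>1/2\<close> elsewhere, with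
  total exactly \<open>k\<close>. The surplus \<open>\<eta>\<close> of \<open>y\<close> over
  \<open>k\<close> is worth at most \<open>t * \<eta>\<close>; since \<open>t\<close> is one of the
  summands on the left, the factor \<open>1 - 2 * \<eta>\<close> absorbs it.\<close>

lemma knapsack_half_integral:
  fixes v y :: "'a \<Rightarrow> real"
  assumes "finite R" "T \<subseteq> R" "card R \<le> 2 * k" "k < card R" "card T = 2 * k - card R"
    and top: "\<And>i j. i \<in> T \<Longrightarrow> j \<in> R - T \<Longrightarrow> v j \<le> v i"
    and v: "\<And>j. j \<in> R \<Longrightarrow> 0 \<le> v j" and y: "\<And>j. j \<in> R \<Longrightarrow> 1 / 2 \<le> y j \<and> y j \<le> 1"
    and sum: "(\<Sum>j\<in>R. y j) \<le> k + \<eta>" and \<eta>: "0 \<le> \<eta>"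
  shows "(1 - 2 * \<eta>) / 2 * (\<Sum>j\<in>R - T. v j) \<le> (\<Sum>j\<in>R. v j * (1 - y j))"
proof -
  let ?H = "R - T"
  have fin: "finite T" "finite ?H" using assms finite_subset by auto
  have cardH: "card ?H = 2 * (card R - k)"
    using assms fin by (simp add: card_Diff_subset)
  then have "0 < card ?H" using assms(4) by simp
  then have ne: "?H \<noteq> {}" by (metis card.empty less_irrefl)
  define t where "t = Max (v ` ?H)"
  have t_le: "v j \<le> t" if "j \<in> ?H" for j using that fin by (simp add: t_def)
  have "t \<in> v ` ?H" unfolding t_def using ne fin by (intro Max_in) auto
  then obtain j0 where j0: "j0 \<in> ?H" "t = v j0" by auto
  then have t0: "0 \<le> t" using v by auto
  have tT: "t \<le> v i" if "i \<in> T" for i using top[OF that j0(1)] j0(2) by simp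
  have tH: "t \<le> (\<Sum>j\<in>?H. v j)" unfolding j0(2) using j0(1) fin v by (intro member_le_sum) auto
  have split: "sum f R = sum f T + sum f ?H" for f :: "'a \<Rightarrow> real"
    using sum.subset_diff[OF assms(2,1), of f] by simp
  have 1: "(\<Sum>j\<in>T. t * (1 - y j)) \<le> (\<Sum>j\<in>T. v j * (1 - y j))"
    using tT y assms(2) by (intro sum_mono mult_right_mono) auto
  have 2: "(\<Sum>j\<in>?H. v j / 2 - t * (y j - 1 / 2)) \<le> (\<Sum>j\<in>?H. v j * (1 - y j))"
  proof (rule sum_mono)
    fix j assume j: "j \<in> ?H"
    \<comment> \<open>Above one half, opening \<open>j\<close> saves \<open>v j\<close> per unit,
      which is at most the price \<open>t\<close>.\<close>
    have "0 \<le> (t - v j) * (y j - 1 / 2)" using t_le[OF j] y[of j] j by (intro mult_nonneg_nonneg) auto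
    then show "v j / 2 - t * (y j - 1 / 2) \<le> v j * (1 - y j)"
      by (simp add: algebra_simps diff_divide_distrib)
  qed
  have e1: "(\<Sum>j\<in>T. t * (1 - y j)) = t * (card T - (\<Sum>j\<in>T. y j))"
    by (simp add: sum_distrib_left[symmetric] sum_subtractf)
  have e2: "(\<Sum>j\<in>?H. v j / 2 - t * (y j - 1 / 2)) = (\<Sum>j\<in>?H. v j) / 2 - t * ((\<Sum>j\<in>?H. y j) - card ?H / 2)"
    by (simp add: sum_distrib_left[symmetric] sum_subtractf sum_divide_distrib)
  have "real (card T) + real (card ?H) / 2 = k"
    unfolding cardH assms(5) using assms(3,4) by (simp add: of_nat_diff diff_divide_distrib)
  moreover have "t * (real (card T) + real (card ?H) / 2 - (\<Sum>j\<in>R. y j)) \<ge> t * (- \<eta>)"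
    if "real (card T) + real (card ?H) / 2 = k"
    using sum t0 that by (intro mult_left_mono) auto
  ultimately have "t * (real (card T) + real (card ?H) / 2) - t * (\<Sum>j\<in>R. y j) \<ge> - (t * \<eta>)"
    by (simp add: right_diff_distrib)
  then have "(\<Sum>j\<in>R. v j * (1 - y j)) \<ge> (\<Sum>j\<in>?H. v j) / 2 - t * \<eta>"
    using 1 2 unfolding e1 e2 split[of y] split[of "\<lambda>j. v j * (1 - y j)"] by (simp add: algebra_simps)
  moreover have "t * \<eta> \<le> (\<Sum>j\<in>?H. v j) * \<eta>" using tH \<eta> by (intro mult_right_mono)
  ultimately show ?thesis by (simp add: algebra_simps)
qed

text \<open>Distances are in units of \<open>B / l\<close>, so the fractional cost is about
  \<open>l\<close>. \<open>R_sep\<close> applies to both orders of a pair, hence with the larger of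
  the two costs. The strict sign in \<open>x_pos\<close> is what the perceptron delivers, and it
  makes Markov's inequality strict.\<close>

locale fractional_clustering =
  fixes n k l q :: nat and d x :: "nat \<Rightarrow> nat \<Rightarrow> real" and y C :: "nat \<Rightarrow> real" and R :: "nat set"
  assumes q: "1 \<le> q" and k: "1 \<le> k"
    and d_nonneg: "\<And>i j. i < n \<Longrightarrow> j < n \<Longrightarrow> 0 \<le> d i j"
    and d_sym: "\<And>i j. i < n \<Longrightarrow> j < n \<Longrightarrow> d i j = d j i"
    and d_tri: "\<And>i j h. i < n \<Longrightarrow> j < n \<Longrightarrow> h < n \<Longrightarrow> d i j \<le> d i h + d h j"
    and x_pos: "\<And>i j. i < n \<Longrightarrow> j < n \<Longrightarrow> 0 < x i j"
    and x_le: "\<And>i j. i < n \<Longrightarrow> j < n \<Longrightarrow> x i j \<le> y i"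
    and x_sum: "\<And>j. j < n \<Longrightarrow> 1 \<le> (\<Sum>i<n. x i j)"
    and y_sum: "(\<Sum>i<n. y i) \<le> k + 1 / (4 * real q)"
    and C_eq: "\<And>j. j < n \<Longrightarrow> C j = (\<Sum>i<n. max 0 (d i j - 1) * x i j)"
    and C_sum: "(\<Sum>j<n. C j) \<le> (1 + 1 / q) * l"
    and R: "R \<subseteq> {..<n}"
    and R_sep: "\<And>i j. i \<in> R \<Longrightarrow> j \<in> R \<Longrightarrow> i \<noteq> j \<Longrightarrow> 2 + 4 * C j < d i j"
begin

definition near :: "nat \<Rightarrow> nat" where
  "near i = arg_min_on (\<lambda>j. d i j) R"

lemma fin_R: "finite R"
  using R finite_subset by blast

lemma R_less: "j \<in> R \<Longrightarrow> j < n"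
  using R by auto

lemma near:
  assumes "R \<noteq> {}"
  shows "near i \<in> R" "j \<in> R \<Longrightarrow> d i (near i) \<le> d i j"
  using arg_min_if_finite(1)[OF fin_R assms] arg_min_least[OF fin_R assms] by (auto simp: near_def)

lemma C_nonneg: "j < n \<Longrightarrow> 0 \<le> C j"
  unfolding C_eq using x_pos by (intro sum_nonneg mult_nonneg_nonneg) (auto intro: less_imp_le)

text \<open>Every point outside the ball has excess above \<open>2 * C j\<close>, so mass
  \<open>1/2\<close> or more out there would cost more than \<open>C j\<close>. By strictness this
  includes \<open>C j = 0\<close>, where nothing lies outside.\<close>

lemma ball_mass:
  assumes j: "j < n"
  shows "1 / 2 \<le> (\<Sum>i | i < n \<and> d i j \<le> 1 + 2 * C j. x i j)"
proof -
  let ?I = "{i. i < n \<and> d i j \<le> 1 + 2 * C j}" and ?O = "{i. i < n \<and> 1 + 2 * C j < d i j}"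
  have "{..<n} = ?I \<union> ?O" "?I \<inter> ?O = {}" by auto
  then have s: "(\<Sum>i<n. f i) = (\<Sum>i\<in>?I. f i) + (\<Sum>i\<in>?O. f i)" for f :: "nat \<Rightarrow> real"
    by (metis (no_types, lifting) finite_Un finite_lessThan sum.union_disjoint)
  have ge: "(\<Sum>i\<in>?O. max 0 (d i j - 1) * x i j) \<le> C j"
    unfolding C_eq[OF j] using j by (intro sum_mono2) (auto simp: x_pos less_imp_le)
  show ?thesis
  proof (cases "?O = {}")
    case True
    show ?thesis using s[of "\<lambda>i. x i j"] x_sum[OF j] unfolding True by simp
  next
    case False
    have "(\<Sum>i\<in>?O. 2 * C j * x i j) < (\<Sum>i\<in>?O. max 0 (d i j - 1) * x i j)"
      using False j by (intro sum_strict_mono mult_strict_right_mono) (auto simp: x_pos)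
    with ge have "2 * C j * (\<Sum>i\<in>?O. x i j) < C j" by (simp add: sum_distrib_left)
    then have "0 < C j" "2 * (\<Sum>i\<in>?O. x i j) < 1"
    proof -
      assume a: "2 * C j * (\<Sum>i\<in>?O. x i j) < C j"
      show "0 < C j" using a C_nonneg[OF j] by (cases "C j = 0") auto
      then show "2 * (\<Sum>i\<in>?O. x i j) < 1" using a by (simp add: field_simps)
    qed
    then show ?thesis using s[of "\<lambda>i. x i j"] x_sum[OF j] by simp
  qed
qed

text \<open>Voronoi cells; ties are broken by \<open>near\<close>, so that cells are
  disjoint.\<close>

definition cell :: "nat \<Rightarrow> nat set" where
  "cell j = {i. i < n \<and> near i = j}"

text \<open>If another representative were at most as far from \<open>i\<close> as \<open>j\<close>
  is, it would be within twice \<open>1 + 2 * C j\<close> of \<open>j\<close>, against the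
  separation.\<close>

lemma ball_subset_cell:
  assumes j: "j \<in> R"
  shows "{i. i < n \<and> d i j \<le> 1 + 2 * C j} \<subseteq> cell j"
proof
  fix i assume "i \<in> {i. i < n \<and> d i j \<le> 1 + 2 * C j}"
  then have i: "i < n" "d i j \<le> 1 + 2 * C j" by auto
  have ne: "R \<noteq> {}" using j by auto
  let ?m = "near i"
  have m: "?m \<in> R" "d i ?m \<le> d i j" using near[OF ne] j by auto
  have "?m = j"
  proof (rule ccontr)
    assume "?m \<noteq> j"
    then have "2 + 4 * C j < d ?m j" using R_sep m(1) j by blast
    also have "\<dots> \<le> d ?m i + d i j" using R_less m(1) j i(1) by (intro d_tri) auto
    also have "d ?m i = d i ?m" using R_less m(1) i(1) by (intro d_sym) auto
    finally show False using m(2) i(2) by linarith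
  qed
  then show "i \<in> cell j" using i by (simp add: cell_def)
qed

lemma cell_mass:
  assumes "j \<in> R"
  shows "1 / 2 \<le> (\<Sum>i\<in>cell j. y i)"
proof -
  have "1 / 2 \<le> (\<Sum>i | i < n \<and> d i j \<le> 1 + 2 * C j. x i j)"
    by (rule ball_mass[OF R_less[OF assms]])
  also have "\<dots> \<le> (\<Sum>i\<in>cell j. x i j)"
    using R_less[OF assms] by (intro sum_mono2 ball_subset_cell assms) (auto simp: cell_def x_pos less_imp_le)
  also have "\<dots> \<le> (\<Sum>i\<in>cell j. y i)"
    using R_less[OF assms] by (intro sum_mono x_le) (auto simp: cell_def)
  finally show ?thesis .
qed

lemma y_nonneg: "i < n \<Longrightarrow> 0 \<le> y i"
  using x_pos[of i i] x_le[of i i] by simp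

lemma cells_sum: "(\<Sum>j\<in>R. \<Sum>i\<in>cell j. y i) \<le> k + 1 / (4 * real q)"
proof -
  have "(\<Sum>j\<in>R. \<Sum>i\<in>cell j. y i) = (\<Sum>i\<in>(\<Union>j\<in>R. cell j). y i)"
    by (intro sum.UNION_disjoint[symmetric] fin_R) (auto simp: cell_def)
  also have "\<dots> \<le> (\<Sum>i<n. y i)"
    by (intro sum_mono2) (auto simp: cell_def y_nonneg)
  finally show ?thesis using y_sum by simp
qed

lemma eta_le: "1 / (4 * real q) \<le> 1 / 4"
  using q by (simp add: field_simps)

text \<open>Disjoint cells of mass at least \<open>1/2\<close> share a total of at most
  \<open>k + 1/4\<close>; the slack stays below one half, so integrality removes it.\<close>

lemma card_R: "card R \<le> 2 * k"
proof -
  have "(\<Sum>j\<in>R. 1 / 2) \<le> (\<Sum>j\<in>R. \<Sum>i\<in>cell j. y i)" by (intro sum_mono cell_mass)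
  then have "card R / 2 \<le> k + 1 / 4" using cells_sum eta_le by simp
  then have "real (card R) < real (2 * k + 1)" by simp
  then show ?thesis by linarith
qed

text \<open>The cap provides the upper bound that the exchange argument requires of an
  opening.\<close>

definition Y :: "nat \<Rightarrow> real" where
  "Y j = min 1 (\<Sum>i\<in>cell j. y i)"

end

text \<open>\<open>r j\<close> stands for the distance from \<open>j\<close> to the nearest other
  representative. The size of \<open>T\<close> is such that \<open>T\<close> opened fully and the
  rest by half has total \<open>k\<close>; if \<open>R\<close> has at most \<open>k\<close>
  elements, the minimum makes \<open>T\<close> all of \<open>R\<close>. \<open>T_top\<close>
  compares only the part of \<open>r\<close> beyond \<open>2\<close>, because the first
  \<open>2\<close> units belong to the additive \<open>4\<close> per client.\<close>

locale centrum_rounding = fractional_clustering +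
  fixes rep :: "nat \<Rightarrow> nat" and r :: "nat \<Rightarrow> real" and T :: "nat set"
  assumes rep: "\<And>j. j < n \<Longrightarrow> rep j \<in> R \<and> C (rep j) \<le> C j \<and> d (rep j) j \<le> 2 + 4 * C j"
    and r_le: "\<And>i j. i \<in> R \<Longrightarrow> j \<in> R \<Longrightarrow> i \<noteq> j \<Longrightarrow> r j \<le> d i j"
    and T: "T \<subseteq> R" "card T = min (card R) (2 * k - card R)"
    and T_top: "\<And>i j. i \<in> T \<Longrightarrow> j \<in> R - T \<Longrightarrow>
      card {a. a < n \<and> rep a = j} * max 0 (r j - 2) \<le> card {a. a < n \<and> rep a = i} * max 0 (r i - 2)"
begin

definition v :: "nat \<Rightarrow> real" where
  "v j = card {a. a < n \<and> rep a = j} * max 0 (r j - 2)"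

text \<open>At least \<open>1 - Y j\<close> of the assignment of \<open>j\<close> lies outside its
  cell. A point \<open>i\<close> there is at most as far from some other representative as from
  \<open>j\<close>, so \<open>r j \<le> 2 * d i j\<close>, and the excess of \<open>r j\<close> over
  \<open>2\<close> is at most twice that of \<open>d i j\<close> over \<open>1\<close>.\<close>

lemma move_cost:
  assumes j: "j \<in> R"
  shows "max 0 (r j - 2) * (1 - Y j) \<le> 2 * C j"
proof (cases "Y j = 1")
  case True
  then show ?thesis using C_nonneg[OF R_less[OF j]] by simp
next
  case False
  let ?O = "{..<n} - cell j"
  have jn: "j < n" using R_less j .
  have Yj: "Y j = (\<Sum>i\<in>cell j. y i)" using False by (auto simp: Y_def min_def)
  have cs: "cell j \<subseteq> {..<n}" by (auto simp: cell_def)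
  have "(\<Sum>i\<in>cell j. x i j) \<le> (\<Sum>i\<in>cell j. y i)" using cs jn by (intro sum_mono x_le) auto
  moreover have "(\<Sum>i<n. x i j) = (\<Sum>i\<in>?O. x i j) + (\<Sum>i\<in>cell j. x i j)"
    using cs by (intro sum.subset_diff) auto
  ultimately have "1 - Y j \<le> (\<Sum>i\<in>?O. x i j)" using x_sum[OF jn] Yj by simp
  then have "max 0 (r j - 2) * (1 - Y j) \<le> max 0 (r j - 2) * (\<Sum>i\<in>?O. x i j)"
    by (intro mult_left_mono) auto
  also have "\<dots> = (\<Sum>i\<in>?O. max 0 (r j - 2) * x i j)" by (simp add: sum_distrib_left)
  also have "\<dots> \<le> (\<Sum>i\<in>?O. 2 * (max 0 (d i j - 1) * x i j))"
  proof (rule sum_mono)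
    fix i assume i: "i \<in> ?O"
    have ne: "R \<noteq> {}" using j by auto
    let ?m = "near i"
    have m: "?m \<in> R" "d i ?m \<le> d i j" using near[OF ne] j by auto
    have "?m \<noteq> j" using i by (auto simp: cell_def)
    then have "r j \<le> d ?m j" using r_le m(1) j by blast
    also have "\<dots> \<le> d ?m i + d i j" using R_less m(1) j i by (intro d_tri) auto
    also have "d ?m i = d i ?m" using R_less m(1) i by (intro d_sym) auto
    finally have "max 0 (r j - 2) \<le> 2 * max 0 (d i j - 1)" using m(2) by (simp add: max_def)
    then have "max 0 (r j - 2) * x i j \<le> 2 * max 0 (d i j - 1) * x i j"
      using i jn by (intro mult_right_mono) (auto simp: x_pos less_imp_le)
    then show "max 0 (r j - 2) * x i j \<le> 2 * (max 0 (d i j - 1) * x i j)" by simp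
  qed
  also have "\<dots> = 2 * (\<Sum>i\<in>?O. max 0 (d i j - 1) * x i j)" by (simp add: sum_distrib_left)
  also have "\<dots> \<le> 2 * C j"
    unfolding C_eq[OF jn] using jn by (intro mult_left_mono sum_mono2) (auto simp: x_pos less_imp_le)
  finally show ?thesis .
qed

lemma sum_rep: "(\<Sum>j\<in>R. card {a. a < n \<and> rep a = j} * f j) = (\<Sum>a<n. f (rep a))" for f :: "nat \<Rightarrow> real"
proof -
  have "(\<Sum>a<n. f (rep a)) = (\<Sum>j\<in>R. \<Sum>a | a < n \<and> rep a = j. f (rep a))"
    using sum.group[of "{..<n}" R rep "\<lambda>a. f (rep a)"] fin_R rep
    by (auto simp: Collect_conj_eq lessThan_def image_subset_iff)
  also have "\<dots> = (\<Sum>j\<in>R. card {a. a < n \<and> rep a = j} * f j)"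
    by (intro sum.cong) auto
  finally show ?thesis by simp
qed

text \<open>Half of the left side is the cost of the half-integral solution. Up to the slack it is
  at most the cost of \<open>Y\<close>, which by \<open>move_cost\<close> is at most
  \<open>2 * C j\<close> for each client moved to its representative \<open>j\<close>;
  \<open>C (rep a) \<le> C a\<close> leads back to the original clients.\<close>

lemma half_cost: "(\<Sum>j\<in>R - T. v j) \<le> (1 + 1 / q) * (4 * (\<Sum>j<n. C j))"
proof (cases "k < card R")
  case True
  let ?\<eta> = "1 / (4 * real q)"
  have "(1 - 2 * ?\<eta>) / 2 * (\<Sum>j\<in>R - T. v j) \<le> (\<Sum>j\<in>R. v j * (1 - Y j))"
  proof (rule knapsack_half_integral[OF fin_R T(1) card_R True])
    show "card T = 2 * k - card R" using T(2) True by simp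
    show "v j \<le> v i" if "i \<in> T" "j \<in> R - T" for i j using T_top that by (simp add: v_def)
    show "0 \<le> v j" for j by (simp add: v_def)
    show "1 / 2 \<le> Y j \<and> Y j \<le> 1" if "j \<in> R" for j using cell_mass[OF that] by (simp add: Y_def)
    have "(\<Sum>j\<in>R. Y j) \<le> (\<Sum>j\<in>R. \<Sum>i\<in>cell j. y i)" by (intro sum_mono) (simp add: Y_def)
    then show "(\<Sum>j\<in>R. Y j) \<le> k + ?\<eta>" using cells_sum by linarith
  qed simp
  also have "\<dots> \<le> (\<Sum>j\<in>R. card {a. a < n \<and> rep a = j} * (2 * C j))"
  proof (rule sum_mono)
    fix j assume "j \<in> R"
    show "v j * (1 - Y j) \<le> card {a. a < n \<and> rep a = j} * (2 * C j)"
      using mult_left_mono[OF move_cost[OF \<open>j \<in> R\<close>], of "card {a. a < n \<and> rep a = j}"]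
      by (simp add: v_def algebra_simps)
  qed
  also have "\<dots> = (\<Sum>a<n. 2 * C (rep a))" by (rule sum_rep)
  also have "\<dots> \<le> (\<Sum>a<n. 2 * C a)" using rep by (intro sum_mono) auto
  finally have a: "(1 - 2 * ?\<eta>) * (\<Sum>j\<in>R - T. v j) \<le> 4 * (\<Sum>j<n. C j)"
    by (simp add: sum_distrib_left[symmetric])
  \<comment> \<open>The product is \<open>1 + 1 / (2 * q) - 1 / (2 * q\<^sup>2)\<close>; the
    relaxation \<open>1 / (4 * q)\<close> of the budget is small enough for this.\<close>
  have b: "1 \<le> (1 + 1 / q) * (1 - 2 * ?\<eta>)" using q by (simp add: field_simps)
  have v0: "0 \<le> (\<Sum>j\<in>R - T. v j)" by (intro sum_nonneg) (simp add: v_def)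
  have "(\<Sum>j\<in>R - T. v j) \<le> (1 + 1 / q) * (1 - 2 * ?\<eta>) * (\<Sum>j\<in>R - T. v j)"
    using mult_right_mono[OF b v0] by simp
  also have "\<dots> \<le> (1 + 1 / q) * (4 * (\<Sum>j<n. C j))"
    using mult_left_mono[OF a, of "1 + 1 / q"] by (simp add: mult.assoc)
  finally show ?thesis .
next
  case False
  then have "T = R" using T fin_R by (intro card_subset_eq) auto
  then show ?thesis using C_nonneg by (auto intro!: mult_nonneg_nonneg sum_nonneg)
qed

text \<open>A client walks at most \<open>2 + 4 * C j\<close> to its representative and, if that is
  not in \<open>T\<close>, at most \<open>r\<close> further, where \<open>2\<close> units are free
  again; hence the threshold \<open>4\<close>. What remains is \<open>4 * C j\<close> and the values
  \<open>v\<close> of the representatives outside \<open>T\<close>, which by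
  \<open>half_cost\<close> add up to about \<open>4 \<Sum> C\<close> as well.\<close>

lemma rounding_cost:
  assumes F: "F \<subseteq> {..<n}" "T \<subseteq> F" and H: "\<And>j. j \<in> R - T \<Longrightarrow> \<exists>i\<in>F. d i j \<le> r j \<or> i = j"
    and D: "\<And>i j. i \<in> F \<Longrightarrow> j < n \<Longrightarrow> D j \<le> d i j"
    and d_self: "\<And>i. i < n \<Longrightarrow> d i i = 0"
  shows "(\<Sum>j<n. max 0 (D j - 4)) \<le> (8 + 16 / q) * l"
proof -
  have "max 0 (D j - 4) \<le> 4 * C j + of_bool (rep j \<notin> T) * max 0 (r (rep j) - 2)" if j: "j < n" for j
  proof -
    note rj = rep[OF j]
    have rn: "rep j < n" using rj R_less by auto
    have via: "D j \<le> d i (rep j) + (2 + 4 * C j)" if "i \<in> F" for i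
      using D[OF that j] d_tri[of i j "rep j"] that F(1) rn j rj by fastforce
    show ?thesis
    proof (cases "rep j \<in> T")
      case True
      then show ?thesis using via[of "rep j"] F d_self rn C_nonneg[OF j] by auto
    next
      case False
      then obtain i where i: "i \<in> F" "d i (rep j) \<le> r (rep j) \<or> i = rep j" using H[of "rep j"] rj by blast
      then show ?thesis using via[OF i(1)] d_self rn False C_nonneg[OF j] by auto
    qed
  qed
  then have "(\<Sum>j<n. max 0 (D j - 4)) \<le> (\<Sum>j<n. 4 * C j + of_bool (rep j \<notin> T) * max 0 (r (rep j) - 2))"
    by (intro sum_mono) auto
  also have "\<dots> = 4 * (\<Sum>j<n. C j) + (\<Sum>j\<in>R. card {a. a < n \<and> rep a = j} * (of_bool (j \<notin> T) * max 0 (r j - 2)))"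
    by (simp add: sum.distrib sum_distrib_left sum_rep)
  also have "(\<Sum>j\<in>R. card {a. a < n \<and> rep a = j} * (of_bool (j \<notin> T) * max 0 (r j - 2))) = (\<Sum>j\<in>R - T. v j)"
    using fin_R by (intro sum.mono_neutral_cong_right) (auto simp: v_def)
  also have "\<dots> \<le> (1 + 1 / q) * (4 * (\<Sum>j<n. C j))" by (rule half_cost)
  also have "4 * (\<Sum>j<n. C j) + (1 + 1 / q) * (4 * (\<Sum>j<n. C j)) = 4 * (2 + 1 / q) * (\<Sum>j<n. C j)"
    by (simp add: algebra_simps)
  also have "\<dots> \<le> 4 * (2 + 1 / q) * ((1 + 1 / q) * l)" using C_sum by (intro mult_left_mono) auto
  also have "\<dots> = 4 * ((2 + 1 / q) * (1 + 1 / q)) * l" by simp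
  also have "\<dots> \<le> 4 * (2 + 4 / q) * l"
  proof (intro mult_right_mono mult_left_mono)
    \<comment> \<open>The left side is \<open>2 + 3 / q + 1 / q\<^sup>2\<close>; four times the
      error \<open>4 / q\<close> is the final \<open>16 / q\<close>.\<close>
    show "(2 + 1 / real q) * (1 + 1 / real q) \<le> 2 + 4 / real q"
      using q by (simp add: field_simps)
  qed auto
  finally show ?thesis by (simp add: algebra_simps)
qed

end

section \<open>Perceptron estimates and sums of the largest entries\<close>

lemma perceptron_step:
  fixes a w :: "'a \<Rightarrow> int" and z :: "'a \<Rightarrow> real"
  assumes "real m \<le> (\<Sum>u\<in>U. z u * w u)" "(\<Sum>u\<in>U. (w u)\<^sup>2) \<le> int m * G"
    and "(\<Sum>u\<in>U. a u * w u) \<le> 0" "(\<Sum>u\<in>U. (a u)\<^sup>2) \<le> G" "1 \<le> (\<Sum>u\<in>U. z u * a u)"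
  shows "real (Suc m) \<le> (\<Sum>u\<in>U. z u * (w u + a u))"
    and "(\<Sum>u\<in>U. (w u + a u)\<^sup>2) \<le> int (Suc m) * G"
proof -
  show "real (Suc m) \<le> (\<Sum>u\<in>U. z u * (w u + a u))"
    using assms(1,5) by (simp add: distrib_left sum.distrib)
  have "(\<Sum>u\<in>U. (w u + a u)\<^sup>2) = (\<Sum>u\<in>U. (w u)\<^sup>2) + (\<Sum>u\<in>U. (a u)\<^sup>2) + 2 * (\<Sum>u\<in>U. a u * w u)"
    by (simp add: power2_sum sum.distrib sum_distrib_left algebra_simps)
  then show "(\<Sum>u\<in>U. (w u + a u)\<^sup>2) \<le> int (Suc m) * G" using assms by (simp add: algebra_simps)
qed

text \<open>By Cauchy-Schwarz, \<open>m\<^sup>2\<close> is at most the product of the squared norms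
  of \<open>z\<close> and \<open>w\<close>. The latter grows only linearly in \<open>m\<close>,
  because an update adds a vector whose inner product with \<open>w\<close> is not positive.\<close>

lemma perceptron_bound:
  fixes w :: "'a \<Rightarrow> int" and z :: "'a \<Rightarrow> real"
  assumes "real m \<le> (\<Sum>u\<in>U. z u * w u)" "(\<Sum>u\<in>U. (w u)\<^sup>2) \<le> int m * G" "0 \<le> G"
  shows "real m \<le> G * (\<Sum>u\<in>U. (z u)\<^sup>2)"
proof (cases "m = 0")
  case False
  have "(real m)\<^sup>2 \<le> (\<Sum>u\<in>U. z u * w u)\<^sup>2" using assms(1) by (intro power_mono) auto
  also have "\<dots> \<le> (\<Sum>u\<in>U. (z u)\<^sup>2) * (\<Sum>u\<in>U. (real_of_int (w u))\<^sup>2)" by (rule Cauchy_Schwarz_ineq_sum)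
  also have "(\<Sum>u\<in>U. (real_of_int (w u))\<^sup>2) = of_int (\<Sum>u\<in>U. (w u)\<^sup>2)" by simp
  also have "\<dots> \<le> of_int (int m * G)" using assms(2) by (simp only: of_int_le_iff)
  finally have "(real m)\<^sup>2 \<le> (\<Sum>u\<in>U. (z u)\<^sup>2) * (m * G)"
    by (simp add: mult_left_mono sum_nonneg)
  then have "real m * real m \<le> real m * (G * (\<Sum>u\<in>U. (z u)\<^sup>2))" by (simp add: power2_eq_square algebra_simps)
  then show ?thesis using False by simp
qed (use assms(3) in \<open>auto intro!: mult_nonneg_nonneg sum_nonneg\<close>)

text \<open>Each of the at most \<open>l\<close> summands is at most \<open>t\<close> plus its
  excess, and the excesses left out are nonnegative. This passes from costs at a fixed threshold to
  the objective of the problem.\<close>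

lemma top_sum_le:
  assumes "finite D" "0 \<le> t"
  shows "top_sum l D v \<le> real l * t + (\<Sum>j\<in>D. max 0 (v j - t))"
proof -
  have *: "sum_list (take l xs) \<le> real l * t + (\<Sum>x\<leftarrow>xs. max 0 (x - t))" for xs :: "real list" and l
  proof (induction xs arbitrary: l)
    case (Cons x xs)
    show ?case
    proof (cases l)
      case 0
      have "0 \<le> (\<Sum>x\<leftarrow>xs. max 0 (x - t))" by (intro sum_list_nonneg) auto
      then show ?thesis using 0 by simp
    next
      case (Suc m)
      then show ?thesis using Cons.IH[of m] by (simp add: algebra_simps)
    qed
  qed (use assms in simp)
  let ?M = "image_mset v (mset_set D)"
  have "(\<Sum>x\<leftarrow>rev (sorted_list_of_multiset ?M). max 0 (x - t)) = (\<Sum>x\<in>#?M. max 0 (x - t))"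
    by (subst sum_mset_sum_list[symmetric]) (simp add: mset_map)
  also have "\<dots> = (\<Sum>j\<in>D. max 0 (v j - t))"
    by (simp add: image_mset.compositionality comp_def sum_unfold_sum_mset)
  finally show ?thesis using *[of l "rev (sorted_list_of_multiset ?M)"] by (simp add: top_sum_def)
qed


section \<open>The linear program as a system of strict homogeneous inequalities\<close>

text \<open>The linear program is made homogeneous: entry \<open>(i, j)\<close> of an \<open>(n + 1) \<times> (n + 1)\<close> matrix is
  \<open>x\<^bsub>ij\<^esub>\<close> for \<open>i, j < n\<close>, entry \<open>(i, n)\<close> is \<open>y\<^sub>i\<close>, and entry \<open>(n, n)\<close> is the common
  denominator. Constraint \<open>(h, p, r)\<close> says that the inner product with the following
  matrix is positive. The bound on the number of centers is relaxed by \<open>1 / (4 q)\<close> and the one on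
  the objective by the factor \<open>1 + 1 / q\<close>, so that there is a solution with polynomial margin.\<close>

definition coef :: "nat \<Rightarrow> nat \<Rightarrow> nat \<Rightarrow> nat \<Rightarrow> (nat \<Rightarrow> nat \<Rightarrow> int) \<Rightarrow> nat \<Rightarrow> nat \<Rightarrow> nat \<Rightarrow> nat \<Rightarrow> nat \<Rightarrow> int" where
  "coef n k l q f h p r i j =
     (if h = 0 then of_bool (i = p \<and> j = r)
      else if h = 1 then of_bool (i = p \<and> j = n) - of_bool (i = p \<and> j = r)
      else if h = 2 then of_bool (i < n \<and> j = r) - of_bool (i = n \<and> j = n)
      else if h = 3 then (4 * int q * int k + 1) * of_bool (i = n \<and> j = n) - 4 * int q * of_bool (i < n \<and> j = n)
      else (int q + 1) * int l * of_bool (i = n \<and> j = n) - int q * (f i j * of_bool (i < n \<and> j < n)))"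

text \<open>Polymorphic because the formula is needed both for the integral vector of the algorithm
  and for the real solution with margin. Each family is indexed by \<open>p\<close> and
  \<open>r\<close>, even where they do not occur, so that the program visits all constraints in
  uniform nested loops.\<close>

definition lin :: "nat \<Rightarrow> nat \<Rightarrow> nat \<Rightarrow> nat \<Rightarrow> (nat \<Rightarrow> nat \<Rightarrow> int) \<Rightarrow> nat \<Rightarrow> nat \<Rightarrow> nat \<Rightarrow> (nat \<Rightarrow> nat \<Rightarrow> 'a) \<Rightarrow> 'a :: comm_ring_1" where
  "lin n k l q f h p r w =
     (if h = 0 then w p r
      else if h = 1 then w p n - w p r
      else if h = 2 then (\<Sum>i<n. w i r) - w n n
      else if h = 3 then (4 * of_nat q * of_nat k + 1) * w n n - 4 * of_nat q * (\<Sum>i<n. w i n)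
      else (of_nat q + 1) * of_nat l * w n n - of_nat q * (\<Sum>i<n. \<Sum>j<n. of_int (f i j) * w i j))"

lemma sum_entry:
  fixes w :: "nat \<Rightarrow> nat \<Rightarrow> 'a :: comm_ring_1"
  assumes "p \<le> n" "r \<le> n"
  shows "(\<Sum>i\<le>n. \<Sum>j\<le>n. w i j * of_bool (i = p \<and> j = r)) = w p r"
proof -
  have "(\<Sum>i\<le>n. \<Sum>j\<le>n. w i j * of_bool (i = p \<and> j = r)) = (\<Sum>i\<le>n. of_bool (i = p) * w i r)"
  proof (rule sum.cong)
    fix i
    have "(\<Sum>j\<le>n. w i j * of_bool (i = p \<and> j = r)) = (\<Sum>j\<le>n. if j = r then of_bool (i = p) * w i j else 0)"
      by (intro sum.cong) auto
    then show "(\<Sum>j\<le>n. w i j * of_bool (i = p \<and> j = r)) = of_bool (i = p) * w i r"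
      using assms by simp
  qed simp
  also have "\<dots> = (\<Sum>i\<le>n. if i = p then w i r else 0)" by (intro sum.cong) auto
  finally show ?thesis using assms by simp
qed

lemma sum_atMost_of_bool:
  fixes g :: "nat \<Rightarrow> 'a :: comm_ring_1"
  shows "(\<Sum>i\<le>n. g i * of_bool (i < n)) = (\<Sum>i<n. g i)"
proof -
  have "{..n} = insert n {..<n}" "{..<n} \<inter> {i. i < n} = {..<n}" by auto
  then show ?thesis by simp
qed

lemma sum_column:
  fixes w :: "nat \<Rightarrow> nat \<Rightarrow> 'a :: comm_ring_1"
  assumes "r \<le> n"
  shows "(\<Sum>i\<le>n. \<Sum>j\<le>n. w i j * of_bool (i < n \<and> j = r)) = (\<Sum>i<n. w i r)"
proof -
  have "(\<Sum>j\<le>n. w i j * of_bool (i < n \<and> j = r)) = w i r * of_bool (i < n)" for i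
  proof -
    have "(\<Sum>j\<le>n. w i j * of_bool (i < n \<and> j = r)) = (\<Sum>j\<le>n. if j = r then w i j * of_bool (i < n) else 0)"
      by (intro sum.cong) auto
    then show ?thesis using assms by simp
  qed
  then show ?thesis by (simp add: sum_atMost_of_bool)
qed

lemma sum_block:
  fixes w :: "nat \<Rightarrow> nat \<Rightarrow> 'a :: comm_ring_1"
  shows "(\<Sum>i\<le>n. \<Sum>j\<le>n. w i j * of_bool (i < n \<and> j < n)) = (\<Sum>i<n. \<Sum>j<n. w i j)"
proof -
  have "(\<Sum>j\<le>n. w i j * of_bool (i < n \<and> j < n)) = (\<Sum>j<n. w i j) * of_bool (i < n)" for i
    using sum_atMost_of_bool[where n = n and g = "\<lambda>j. w i j"] by (simp add: of_bool_conj)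
  then show ?thesis by (simp add: sum_atMost_of_bool)
qed

lemma sum_coef:
  fixes w :: "nat \<Rightarrow> nat \<Rightarrow> 'a :: comm_ring_1"
  assumes "p < n" "r < n"
  shows "(\<Sum>i\<le>n. \<Sum>j\<le>n. w i j * of_int (coef n k l q f h p r i j)) = lin n k l q f h p r w"
proof -
  let ?S = "\<lambda>g. \<Sum>i\<le>n. \<Sum>j\<le>n. w i j * g i j"
  have diff: "?S (\<lambda>i j. g i j - g' i j) = ?S g - ?S g'" for g g'
    by (simp add: right_diff_distrib sum_subtractf)
  have scale: "?S (\<lambda>i j. c * g i j) = c * ?S g" for c g
    by (simp add: sum_distrib_left mult.left_commute)
  have block: "?S (\<lambda>i j. of_int (f i j) * of_bool (i < n \<and> j < n)) = (\<Sum>i<n. \<Sum>j<n. of_int (f i j) * w i j)"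
    using sum_block[of "\<lambda>i j. of_int (f i j) * w i j" n] by (simp add: mult_ac)
  consider "h = 0" | "h = 1" | "h = 2" | "h = 3" | "h \<notin> {0, 1, 2, 3}" by auto
  then show ?thesis
  proof cases
    case 1
    then show ?thesis using assms by (simp del: sum_mult_of_bool_eq sum_of_bool_mult_eq add: coef_def lin_def sum_entry)
  next
    case 2
    then show ?thesis using assms
      by (simp del: sum_mult_of_bool_eq sum_of_bool_mult_eq add: coef_def lin_def sum_entry diff)
  next
    case 3
    then show ?thesis using assms
      by (simp del: sum_mult_of_bool_eq sum_of_bool_mult_eq add: coef_def lin_def sum_entry sum_column diff)
  next
    case 4
    then show ?thesis using assms
      by (simp del: sum_mult_of_bool_eq sum_of_bool_mult_eq add: coef_def lin_def sum_entry sum_column diff scale)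
  next
    case 5
    then show ?thesis using assms
      by (simp del: sum_mult_of_bool_eq sum_of_bool_mult_eq add: coef_def lin_def sum_entry block diff scale)
  qed
qed

lemma abs_coef_le:
  assumes "k < n" "l \<le> n" "1 \<le> q" "\<And>i j. i < n \<Longrightarrow> j < n \<Longrightarrow> 0 \<le> f i j \<and> f i j \<le> 30 * int n"
  shows "\<bar>coef n k l q f h p r i j\<bar> \<le> 30 * int q * int n"
proof -
  have n: "1 \<le> int n" using assms by simp
  have q: "1 \<le> int q" using assms by simp
  have qn: "1 \<le> int q * int n" using mult_mono[OF q n] by simp
  have qk: "int q * int k \<le> int q * int n" using assms by (intro mult_left_mono) auto
  have ql: "int q * int l \<le> int q * int n" "int l \<le> int q * int n" "0 \<le> int q * int l"
    using assms mult_mono[of 1 "int q" "int l" "int n"] by (auto intro: mult_left_mono)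
  have q1: "int q \<le> int q * int n" using n q by simp
  consider "h = 0 \<or> h = 1 \<or> h = 2" | "h = 3" | "h \<notin> {0, 1, 2, 3}" by blast
  then show ?thesis
  proof cases
    case 1
    then show ?thesis using qn by (auto simp: coef_def)
  next
    case 2
    then show ?thesis using qn qk q1 by (auto simp: coef_def algebra_simps)
  next
    case 3
    have "int q * f i j \<le> int q * (30 * int n)" "0 \<le> int q * f i j" if "i < n" "j < n"
      using assms(4)[OF that] by (auto intro!: mult_left_mono mult_nonneg_nonneg)
    then show ?thesis using 3 qn ql by (auto simp: coef_def algebra_simps)
  qed
qed

text \<open>There are \<open>(n + 1)\<^sup>2 \<le> (2 * n)\<^sup>2\<close> entries of absolute value
  at most \<open>30 * q * n\<close>, whence \<open>4 * 900 = 3600\<close>.\<close>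

lemma coef_norm_le:
  assumes "k < n" "l \<le> n" "1 \<le> q" "\<And>i j. i < n \<Longrightarrow> j < n \<Longrightarrow> 0 \<le> f i j \<and> f i j \<le> 30 * int n"
  shows "(\<Sum>i\<le>n. \<Sum>j\<le>n. (coef n k l q f h p r i j)\<^sup>2) \<le> 3600 * int q ^ 2 * int n ^ 4"
proof -
  have "(coef n k l q f h p r i j)\<^sup>2 \<le> (30 * int q * int n)\<^sup>2" for i j
    using abs_coef_le[OF assms] by (simp add: abs_le_square_iff[symmetric])
  then have "(\<Sum>i\<le>n. \<Sum>j\<le>n. (coef n k l q f h p r i j)\<^sup>2) \<le> (\<Sum>i\<le>n. \<Sum>j\<le>n. (30 * int q * int n)\<^sup>2)"
    by (intro sum_mono)
  also have "\<dots> = (int n + 1) ^ 2 * (30 * int q * int n)\<^sup>2" by (simp add: power2_eq_square algebra_simps)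
  also have "\<dots> \<le> (2 * int n) ^ 2 * (30 * int q * int n)\<^sup>2"
    using assms(1) by (intro mult_right_mono power_mono) auto
  also have "\<dots> = 3600 * int q ^ 2 * int n ^ 4" by (simp add: power_mult_distrib power2_eq_square power4_eq_xxxx)
  finally show ?thesis .
qed

text \<open>A solution of the linear program satisfies its constraints only weakly. Scaling it by a
  large \<open>s\<close> and adding \<open>1\<close> to every \<open>x\<close> and \<open>2\<close>
  to every \<open>y\<close> gives each inequality room \<open>1\<close>; the losses in the budget
  and in the objective are paid by the relaxations, which are scaled by \<open>s\<close>
  too.\<close>

lemma margin:
  fixes x :: "nat \<Rightarrow> nat \<Rightarrow> real" and y :: "nat \<Rightarrow> real"
  assumes kn: "1 \<le> k" "k < n" and l: "1 \<le> l" and q: "1 \<le> q"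
    and x: "\<And>i j. i < n \<Longrightarrow> j < n \<Longrightarrow> 0 \<le> x i j \<and> x i j \<le> y i"
    and cover: "\<And>j. j < n \<Longrightarrow> 1 \<le> (\<Sum>i<n. x i j)" and y: "(\<Sum>i<n. y i) \<le> k"
    and f: "\<And>i j. i < n \<Longrightarrow> j < n \<Longrightarrow> 0 \<le> f i j \<and> f i j \<le> 30 * int n"
    and cost: "(\<Sum>i<n. \<Sum>j<n. of_int (f i j) * x i j) \<le> l * (1 + 1 / (8 * real q))"
  shows "\<exists>z :: nat \<Rightarrow> nat \<Rightarrow> real. (\<forall>h p r. p < n \<longrightarrow> r < n \<longrightarrow>
       1 \<le> (\<Sum>i\<le>n. \<Sum>j\<le>n. z i j * of_int (coef n k l q f h p r i j))) \<and>
     (\<Sum>i\<le>n. \<Sum>j\<le>n. (z i j)\<^sup>2) \<le> 360000 * real q ^ 2 * real n ^ 10"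
proof -
  \<comment> \<open>Large enough to dominate both losses: \<open>8 * q * n\<close> in the budget,
    and \<open>30 * q * n ^ 3\<close> in the objective, which has \<open>n\<^sup>2\<close>
    coefficients of size at most \<open>30 * n\<close>.\<close>
  define s where "s = 100 * real q * real n ^ 3"
  have n1: "1 \<le> real n" using kn by simp
  have q1: "1 \<le> real q" using q by simp
  have pow: "1 \<le> real n ^ 3" "real n \<le> real n ^ 3" "real n \<le> real n ^ 2"
    using n1 power_increasing[of 1 3 "real n"] power_increasing[of 1 2 "real n"] by auto
  have s_ge: "100 * real q * real n \<le> s"
    unfolding s_def using pow(2) q1 by (intro mult_left_mono) auto
  have qn: "1 \<le> real q * real n" "real n \<le> real q * real n" "real q \<le> real q * real n"
    using mult_mono[OF q1 n1] n1 q1 by auto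
  have s1: "100 \<le> s" "100 * real n \<le> s" using s_ge qn by auto
  define z where "z = (\<lambda>i j. if i < n \<and> j < n then s * x i j + 1 else if i < n \<and> j = n then s * y i + 2
     else if i = n \<and> j = n then s else 0)"
  have zx: "z i j = s * x i j + 1" if "i < n" "j < n" for i j using that by (simp add: z_def)
  have zy: "z i n = s * y i + 2" if "i < n" for i using that by (simp add: z_def)
  have zz: "z n n = s" by (simp add: z_def)
  have lin_ge: "1 \<le> lin n k l q f h p r z" if "p < n" "r < n" for h p r
  proof -
    consider "h = 0" | "h = 1" | "h = 2" | "h = 3" | "h \<notin> {0, 1, 2, 3}" by auto
    then show ?thesis
    proof cases
      case 1
      then show ?thesis using that x s1 by (simp add: lin_def zx)
    next
      case 2
      have "s * x p r \<le> s * y p" using x that s1 by (intro mult_left_mono) auto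
      then show ?thesis using 2 that by (simp add: lin_def zx zy)
    next
      case 3
      have "(\<Sum>i<n. z i r) = s * (\<Sum>i<n. x i r) + n"
        using that by (simp add: zx sum.distrib sum_distrib_left)
      moreover have "s * 1 \<le> s * (\<Sum>i<n. x i r)" using cover[OF that(2)] s1 by (intro mult_left_mono) auto
      ultimately show ?thesis using 3 n1 by (simp add: lin_def zz)
    next
      case 4
      have e: "(\<Sum>i<n. z i n) = s * (\<Sum>i<n. y i) + 2 * n"
        by (simp add: zy sum.distrib sum_distrib_left)
      have "s * (\<Sum>i<n. y i) \<le> s * k" using y s1 by (intro mult_left_mono) auto
      then have "4 * real q * (\<Sum>i<n. z i n) \<le> 4 * real q * (s * k + 2 * n)"
        unfolding e by (intro mult_left_mono) auto
      moreover have "(4 * real q * real k + 1) * s - 4 * real q * (s * k + 2 * n) = s - 8 * (real q * real n)"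
        by (simp add: algebra_simps)
      ultimately show ?thesis using 4 s_ge qn by (simp add: lin_def zz)
    next
      case 5
      have e: "(\<Sum>i<n. \<Sum>j<n. of_int (f i j) * z i j) =
          s * (\<Sum>i<n. \<Sum>j<n. of_int (f i j) * x i j) + (\<Sum>i<n. \<Sum>j<n. of_int (f i j))"
        by (simp add: zx sum.distrib sum_distrib_left algebra_simps)
      have "(\<Sum>i<n. \<Sum>j<n. real_of_int (f i j)) \<le> (\<Sum>i<n. \<Sum>j<n. 30 * real n)"
      proof (intro sum_mono)
        fix i j assume "i \<in> {..<n}" "j \<in> {..<n}"
        then have "f i j \<le> 30 * int n" using f by auto
        then have "real_of_int (f i j) \<le> real_of_int (30 * int n)" by (simp only: of_int_le_iff)
        then show "real_of_int (f i j) \<le> 30 * real n" by simp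
      qed
      also have "\<dots> = 30 * real n ^ 3" by (simp add: power3_eq_cube)
      finally have b: "(\<Sum>i<n. \<Sum>j<n. real_of_int (f i j)) \<le> 30 * real n ^ 3" .
      have "s * (\<Sum>i<n. \<Sum>j<n. of_int (f i j) * x i j) \<le> s * (l * (1 + 1 / (8 * real q)))"
        using cost s1 by (intro mult_left_mono) auto
      then have "real q * (\<Sum>i<n. \<Sum>j<n. of_int (f i j) * z i j)
          \<le> real q * (s * (l * (1 + 1 / (8 * real q))) + 30 * real n ^ 3)"
        unfolding e using b by (intro mult_left_mono) auto
      also have "\<dots> = real q * real l * s + s * real l / 8 + 3 / 10 * s"
        using q by (simp add: s_def field_simps)
      \<comment> \<open>Of the relaxation \<open>s * l\<close>, one eighth goes to the inexact
        optimum in \<open>cost\<close> and \<open>3/10 * s\<close> to the ones added to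
        \<open>x\<close>.\<close>
      finally have "lin n k l q f h p r z \<ge> s * real l * (7 / 8) - 3 / 10 * s"
        using 5 by (simp add: lin_def zz algebra_simps)
      moreover have "s * 1 \<le> s * real l" using l s1 by (intro mult_left_mono) auto
      ultimately show ?thesis using s1 by linarith
    qed
  qed
  have "(\<Sum>i\<le>n. \<Sum>j\<le>n. (z i j)\<^sup>2) \<le> 360000 * real q ^ 2 * real n ^ 10"
  proof -
    have yk: "y i \<le> n" if "i < n" for i
    proof -
      have "y i \<le> (\<Sum>i<n. y i)" using that x by (intro member_le_sum) force+
      then show ?thesis using y kn by linarith
    qed
    have "0 \<le> z i j \<and> z i j \<le> 3 * real n * s" for i j
    proof -
      have "z i j \<le> s * n + 2" "0 \<le> z i j"
      proof -
        have "s * x i j \<le> s * n" if "i < n" "j < n"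
          using that x[OF that] yk[OF that(1)] s1 by (intro mult_left_mono) auto
        moreover have "s * y i \<le> s * n" if "i < n"
          using yk[OF that] s1 by (intro mult_left_mono) auto
        moreover have "s * 1 \<le> s * n" using mult_left_mono[OF n1, of s] s1 by linarith
        ultimately show "z i j \<le> s * n + 2" using s1 unfolding z_def by (smt (verit))
        have "0 \<le> y i" if "i < n" using x[OF that that] by linarith
        then show "0 \<le> z i j" using x s1
          by (auto simp: z_def intro!: add_nonneg_nonneg mult_nonneg_nonneg)
      qed
      moreover have "s * 1 \<le> s * n" using mult_left_mono[OF n1, of s] s1 by linarith
      moreover have "3 * real n * s = 3 * (s * n)" by simp
      ultimately show ?thesis using s1(1) by linarith
    qed
    then have "(z i j)\<^sup>2 \<le> (3 * real n * s)\<^sup>2" for i j by (intro power_mono) auto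
    then have "(\<Sum>i\<le>n. \<Sum>j\<le>n. (z i j)\<^sup>2) \<le> (\<Sum>i\<le>n. \<Sum>j\<le>n. (3 * real n * s)\<^sup>2)" by (intro sum_mono)
    also have "\<dots> = (real n + 1) ^ 2 * (3 * real n * s)\<^sup>2" by (simp add: power2_eq_square algebra_simps)
    also have "\<dots> \<le> (2 * real n) ^ 2 * (3 * real n * s)\<^sup>2"
      using n1 by (intro mult_right_mono power_mono) auto
    also have "\<dots> = 360000 * real q ^ 2 * real n ^ 10" by (simp add: s_def power_mult_distrib flip: power_mult power_add)
    finally show ?thesis .
  qed
  moreover have "1 \<le> (\<Sum>i\<le>n. \<Sum>j\<le>n. z i j * of_int (coef n k l q f h p r i j))"
    if "p < n" "r < n" for h p r
    unfolding sum_coef[OF that] by (rule lin_ge[OF that])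
  ultimately show ?thesis by blast
qed

section \<open>Loop rules and the perceptron\<close>

lemma htr_sum:
  assumes m: "ev u N \<sigma> = int m" "int m \<le> W" and "S \<noteq> x"
    and idx: "\<And>\<tau>. (\<And>k. k \<noteq> x \<Longrightarrow> k \<noteq> S \<Longrightarrow> \<tau> k = \<sigma> k) \<Longrightarrow> ev u ea \<tau> = a \<and> ev u eb \<tau> = b"
    and e: "\<And>i \<tau>. i < m \<Longrightarrow> (\<And>k. k \<noteq> x \<Longrightarrow> k \<noteq> S \<Longrightarrow> \<tau> k = \<sigma> k) \<Longrightarrow> \<tau> x 0 0 = int i \<Longrightarrow> ev u e \<tau> = g i"
    and K: "\<And>i. i < m \<Longrightarrow> \<bar>g i\<bar> \<le> K" and bound: "\<bar>\<sigma> S a b\<bar> + int m * K \<le> W"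
  shows "htr u W (For x N (Asg S ea eb (Rd S ea eb \<oplus> e))) \<sigma>
    (\<lambda>\<tau>. \<tau> S = (\<lambda>a' b'. if a' = a \<and> b' = b then \<sigma> S a b + (\<Sum>i<m. g i) else \<sigma> S a' b'))"
proof -
  define I where "I = (\<lambda>j (\<tau> :: state). \<tau> S = (\<lambda>a' b'. if a' = a \<and> b' = b then \<sigma> S a b + (\<Sum>i<j. g i) else \<sigma> S a' b'))"
  have "htr u W (For x N (Asg S ea eb (Rd S ea eb \<oplus> e))) \<sigma> (I m)"
  proof (rule htr_For[OF m])
    show "I 0 \<sigma>" by (auto simp: I_def fun_eq_iff)
    fix i \<tau> assume i: "i < m" and inv: "I i \<tau>"
      and frame: "\<And>k. k \<notin> insert x (mods (Asg S ea eb (Rd S ea eb \<oplus> e))) \<Longrightarrow> \<tau> k = \<sigma> k"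
    let ?\<tau> = "put \<tau> x 0 0 (int i)"
    have fr: "k \<noteq> x \<Longrightarrow> k \<noteq> S \<Longrightarrow> ?\<tau> k = \<sigma> k" for k using frame by simp
    have ab: "ev u ea ?\<tau> = a" "ev u eb ?\<tau> = b" using idx[of ?\<tau>] fr by auto
    have ei: "ev u e ?\<tau> = g i" using i fr by (intro e) (auto simp: put_apply)
    have S: "?\<tau> S = (\<lambda>a' b'. if a' = a \<and> b' = b then \<sigma> S a b + (\<Sum>i<i. g i) else \<sigma> S a' b')"
      using inv \<open>S \<noteq> x\<close> by (simp add: I_def)
    have "\<bar>\<Sum>j<Suc i. g j\<bar> \<le> (\<Sum>j<Suc i. K)"
      using i K by (intro order.trans[OF sum_abs] sum_mono) auto
    also have "\<dots> = int (Suc i) * K" by simp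
    also have "\<dots> \<le> int m * K"
      using i K[OF i] by (intro mult_right_mono) linarith+
    finally have "\<bar>\<sigma> S a b + (\<Sum>j<Suc i. g j)\<bar> \<le> W" using bound by linarith
    then show "htr u W (Asg S ea eb (Rd S ea eb \<oplus> e)) ?\<tau> (I (Suc i))"
      by (intro htr_Asg) (auto simp: ab ei S I_def put_same fun_eq_iff)
  qed
  then show ?thesis by (simp add: I_def)
qed

lemma htr_sum2:
  assumes m: "ev u N \<sigma> = int m" "int m \<le> W" and neq: "S \<noteq> x" "S \<noteq> y" "x \<noteq> y"
    and m': "\<And>\<tau>. (\<And>k. k \<noteq> x \<Longrightarrow> k \<noteq> y \<Longrightarrow> k \<noteq> S \<Longrightarrow> \<tau> k = \<sigma> k) \<Longrightarrow> ev u N' \<tau> = int m'" "int m' \<le> W"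
    and e: "\<And>i j \<tau>. i < m \<Longrightarrow> j < m' \<Longrightarrow> (\<And>k. k \<noteq> x \<Longrightarrow> k \<noteq> y \<Longrightarrow> k \<noteq> S \<Longrightarrow> \<tau> k = \<sigma> k)
      \<Longrightarrow> \<tau> x 0 0 = int i \<Longrightarrow> \<tau> y 0 0 = int j \<Longrightarrow> ev u e \<tau> = g i j"
    and K: "\<And>i j. i < m \<Longrightarrow> j < m' \<Longrightarrow> \<bar>g i j\<bar> \<le> K"
    and bound: "\<sigma> S 0 0 = 0" "int m * (int m' * K) \<le> W" "0 \<le> K"
  shows "htr u W (For x N (For y N' (Asg S (Cn 0) (Cn 0) (Rd S (Cn 0) (Cn 0) \<oplus> e)))) \<sigma>
    (\<lambda>\<tau>. \<tau> S 0 0 = (\<Sum>i<m. \<Sum>j<m'. g i j))"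
proof (rule htr_For[OF m])
  show "\<sigma> S 0 0 = (\<Sum>i<0. \<Sum>j<m'. g i j)" using bound by simp
  let ?body = "For y N' (Asg S (Cn 0) (Cn 0) (Rd S (Cn 0) (Cn 0) \<oplus> e))"
  fix i \<tau> assume i: "i < m" and inv: "\<tau> S 0 0 = (\<Sum>i<i. \<Sum>j<m'. g i j)"
    and frame: "\<And>k. k \<notin> insert x (mods ?body) \<Longrightarrow> \<tau> k = \<sigma> k"
  let ?\<tau> = "put \<tau> x 0 0 (int i)"
  have fr: "k \<noteq> x \<Longrightarrow> k \<noteq> y \<Longrightarrow> k \<noteq> S \<Longrightarrow> ?\<tau> k = \<sigma> k" for k using frame by simp
  have "\<bar>\<tau> S 0 0\<bar> \<le> (\<Sum>i<i. \<Sum>j<m'. K)"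
    unfolding inv using i K by (intro order.trans[OF sum_abs] sum_mono) auto
  then have b: "\<bar>\<tau> S 0 0\<bar> \<le> int i * (int m' * K)" by simp
  have "(int i + 1) * (int m' * K) \<le> int m * (int m' * K)"
    using i bound(3) by (intro mult_right_mono) auto
  then have bd: "\<bar>?\<tau> S 0 0\<bar> + int m' * K \<le> W"
    using b bound(2) neq by (simp add: algebra_simps)
  have "htr u W ?body ?\<tau> (\<lambda>\<tau>'. \<tau>' S = (\<lambda>a' b'. if a' = 0 \<and> b' = 0 then ?\<tau> S 0 0 + (\<Sum>j<m'. g i j) else ?\<tau> S a' b'))"
  proof (rule htr_sum[OF _ m'(2) neq(2)])
    show "ev u N' ?\<tau> = int m'" using fr by (rule m'(1))
    fix j \<tau>' assume j: "j < m'" and \<tau>': "\<And>k. k \<noteq> y \<Longrightarrow> k \<noteq> S \<Longrightarrow> \<tau>' k = ?\<tau> k" "\<tau>' y 0 0 = int j"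
    show "ev u e \<tau>' = g i j"
    proof (rule e[OF i j])
      show "\<tau>' x 0 0 = int i" using \<tau>'(1)[of x] neq by (simp add: put_apply)
      show "k \<noteq> x \<Longrightarrow> k \<noteq> y \<Longrightarrow> k \<noteq> S \<Longrightarrow> \<tau>' k = \<sigma> k" for k using \<tau>'(1)[of k] fr[of k] by simp
    qed (rule \<tau>')
  qed (use K[OF i] bd in auto)
  then show "htr u W ?body ?\<tau> (\<lambda>\<tau>. \<tau> S 0 0 = (\<Sum>i<Suc i. \<Sum>j<m'. g i j))"
    by (rule htr_conseq) (use inv neq in simp)
qed

text \<open>The premise \<open>e\<close> may assume that cell \<open>(i, j)\<close> of
  \<open>A\<close> still has its initial value, so an array can be updated in place, as the
  perceptron does.\<close>

lemma htr_map2: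
  assumes m: "ev u N \<sigma> = int m" "int m \<le> W" and neq: "A \<noteq> x" "A \<noteq> y" "x \<noteq> y"
    and m': "\<And>\<tau>. (\<And>k. k \<noteq> x \<Longrightarrow> k \<noteq> y \<Longrightarrow> k \<noteq> A \<Longrightarrow> \<tau> k = \<sigma> k) \<Longrightarrow> ev u N' \<tau> = int m'" "int m' \<le> W"
    and e: "\<And>i j \<tau>. i < m \<Longrightarrow> j < m' \<Longrightarrow> (\<And>k. k \<noteq> x \<Longrightarrow> k \<noteq> y \<Longrightarrow> k \<noteq> A \<Longrightarrow> \<tau> k = \<sigma> k)
      \<Longrightarrow> \<tau> x 0 0 = int i \<Longrightarrow> \<tau> y 0 0 = int j \<Longrightarrow> \<tau> A (int i) (int j) = \<sigma> A (int i) (int j) \<Longrightarrow> ev u e \<tau> = g i j"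
    and bound: "\<And>i j. i < m \<Longrightarrow> j < m' \<Longrightarrow> \<bar>g i j\<bar> \<le> W"
  shows "htr u W (For x N (For y N' (Asg A (Rd x (Cn 0) (Cn 0)) (Rd y (Cn 0) (Cn 0)) e))) \<sigma>
    (\<lambda>\<tau>. \<forall>i<m. \<forall>j<m'. \<tau> A (int i) (int j) = g i j)"
proof -
  define I where "I = (\<lambda>i (\<tau> :: state). \<forall>i'<m. \<forall>j<m'. \<tau> A (int i') (int j) = (if i' < i then g i' j else \<sigma> A (int i') (int j)))"
  let ?asg = "Asg A (Rd x (Cn 0) (Cn 0)) (Rd y (Cn 0) (Cn 0)) e"
  have "htr u W (For x N (For y N' ?asg)) \<sigma> (I m)"
  proof (rule htr_For[OF m])
    show "I 0 \<sigma>" by (simp add: I_def)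
    fix i \<tau> assume i: "i < m" and inv: "I i \<tau>"
      and frame: "\<And>k. k \<notin> insert x (mods (For y N' ?asg)) \<Longrightarrow> \<tau> k = \<sigma> k"
    let ?\<tau> = "put \<tau> x 0 0 (int i)"
    have fr: "k \<noteq> x \<Longrightarrow> k \<noteq> y \<Longrightarrow> k \<noteq> A \<Longrightarrow> ?\<tau> k = \<sigma> k" for k using frame by simp
    define J where "J = (\<lambda>j (\<tau> :: state). \<forall>i'<m. \<forall>j'<m'. \<tau> A (int i') (int j') =
      (if i' < i \<or> i' = i \<and> j' < j then g i' j' else \<sigma> A (int i') (int j')))"
    have "htr u W (For y N' ?asg) ?\<tau> (J m')"
    proof (rule htr_For[OF _ m'(2)])
      show "ev u N' ?\<tau> = int m'" using fr by (rule m'(1))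
      show "J 0 ?\<tau>" using inv neq by (simp add: I_def J_def)
      fix j \<tau>1 assume j: "j < m'" and inv1: "J j \<tau>1"
        and frame1: "\<And>k. k \<notin> insert y (mods ?asg) \<Longrightarrow> \<tau>1 k = ?\<tau> k"
      let ?\<tau>1 = "put \<tau>1 y 0 0 (int j)"
      have x1: "?\<tau>1 x 0 0 = int i" using frame1[of x] neq by (simp add: put_apply)
      have y1: "?\<tau>1 y 0 0 = int j" by (simp add: put_apply)
      have "ev u e ?\<tau>1 = g i j"
      proof (rule e[of i j ?\<tau>1, OF i j _ x1 y1])
        show "k \<noteq> x \<Longrightarrow> k \<noteq> y \<Longrightarrow> k \<noteq> A \<Longrightarrow> ?\<tau>1 k = \<sigma> k" for k using frame1[of k] fr[of k] by simp
        show "?\<tau>1 A (int i) (int j) = \<sigma> A (int i) (int j)"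
          using inv1 i j neq by (simp add: J_def)
      qed
      then show "htr u W ?asg ?\<tau>1 (J (Suc j))"
        using inv1 bound[OF i j] x1 y1 neq by (intro htr_Asg) (auto simp: J_def put_apply)
    qed
    then show "htr u W (For y N' ?asg) ?\<tau> (I (Suc i))"
      by (rule htr_conseq) (auto simp: I_def J_def less_Suc_eq)
  qed
  then show ?thesis by (rule htr_conseq) (auto simp: I_def)
qed

text \<open>The target index may be shifted, as for the output, where two arrays are written one
  after the other. Injectivity protects earlier iterations, and the last conjunct protects the half
  that is already written.\<close>

lemma htr_map1:
  assumes m: "ev u N \<sigma> = int m" "int m \<le> W" and neq: "A \<noteq> x"
    and e: "\<And>i \<tau>. i < m \<Longrightarrow> (\<And>k. k \<noteq> x \<Longrightarrow> k \<noteq> A \<Longrightarrow> \<tau> k = \<sigma> k)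
      \<Longrightarrow> \<tau> x 0 0 = int i \<Longrightarrow> ev u e \<tau> = g i"
    and a: "\<And>i \<tau>. i < m \<Longrightarrow> \<tau> x 0 0 = int i \<Longrightarrow> ev u a \<tau> = f i" and f: "inj_on f {..<m}"
    and bound: "\<And>i. i < m \<Longrightarrow> \<bar>g i\<bar> \<le> W"
  shows "htr u W (For x N (Asg A a (Cn 0) e)) \<sigma>
    (\<lambda>\<tau>. (\<forall>i<m. \<tau> A (f i) 0 = g i) \<and> (\<forall>b. b \<notin> f ` {..<m} \<longrightarrow> \<tau> A b = \<sigma> A b))"
proof -
  define I where "I = (\<lambda>i (\<tau> :: state). (\<forall>i'<i. \<tau> A (f i') 0 = g i') \<and> (\<forall>b. b \<notin> f ` {..<m} \<longrightarrow> \<tau> A b = \<sigma> A b))"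
  have "htr u W (For x N (Asg A a (Cn 0) e)) \<sigma> (I m)"
  proof (rule htr_For[OF m])
    show "I 0 \<sigma>" by (simp add: I_def)
    fix i \<tau> assume i: "i < m" and inv: "I i \<tau>"
      and frame: "\<And>k. k \<notin> insert x (mods (Asg A a (Cn 0) e)) \<Longrightarrow> \<tau> k = \<sigma> k"
    let ?\<tau> = "put \<tau> x 0 0 (int i)"
    have x: "?\<tau> x 0 0 = int i" by (simp add: put_apply)
    have "ev u e ?\<tau> = g i" using frame x i by (intro e) auto
    moreover have "f i' \<noteq> f i" if "i' < i" for i' using f i that by (auto simp: inj_on_def)
    ultimately show "htr u W (Asg A a (Cn 0) e) ?\<tau> (I (Suc i))"
      using inv bound[OF i] a[of i ?\<tau>, OF i x] neq i
      by (intro htr_Asg) (auto simp: I_def put_same fun_eq_iff less_Suc_eq)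
  qed
  then show ?thesis by (simp add: I_def)
qed

section \<open>Programs for the distances and the perceptron\<close>

primrec epow :: "ex \<Rightarrow> nat \<Rightarrow> ex" where
  "epow e 0 = Cn 1"
| "epow e (Suc m) = e \<otimes> epow e m"

lemma ev_epow [simp]: "ev u (epow e m) \<sigma> = ev u e \<sigma> ^ m"
  by (induction m) auto

abbreviation Sc :: "nat \<Rightarrow> ex" where "Sc k \<equiv> Rd k (Cn 0) (Cn 0)"
abbreviation Ar :: "nat \<Rightarrow> ex \<Rightarrow> ex" where "Ar k e \<equiv> Rd k e (Cn 0)"
abbreviation eN :: ex where "eN \<equiv> In (Cn 1)"
abbreviation eK :: ex where "eK \<equiv> In (Cn 2)"
abbreviation eL :: ex where "eL \<equiv> In (Cn 3)"
abbreviation cI :: ex where "cI \<equiv> Sc 1"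
abbreviation cJ :: ex where "cJ \<equiv> Sc 2"
abbreviation eD :: ex where "eD \<equiv> Rd 15 cI cJ"
abbreviation setS :: "nat \<Rightarrow> ex \<Rightarrow> cmd" where "setS k e \<equiv> Asg k (Cn 0) (Cn 0) e"
abbreviation addS :: "nat \<Rightarrow> ex \<Rightarrow> cmd" where "addS k e \<equiv> setS k (Sc k \<oplus> e)"

text \<open>Register arrays of the program. Scalars: \<open>1\<close> to \<open>7\<close> are loop counters (\<open>1\<close>
  and \<open>2\<close> run over points \<open>i\<close> and \<open>j\<close>, \<open>3\<close> to \<open>5\<close> over the constraints),
  \<open>8\<close> and \<open>9\<close> are temporary, \<open>10\<close> to \<open>14\<close> are cardinalities. Arrays:
  \<open>15\<close> distances, \<open>16\<close> variables of the linear program, \<open>17\<close> fractional costs,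
  \<open>18\<close> the set of representatives, \<open>19\<close> and \<open>20\<close> distance to and index of the
  representative of a client, \<open>21\<close> number of clients of a representative, \<open>22\<close> and
  \<open>23\<close> distance to and index of the nearest other representative, \<open>24\<close> colours,
  \<open>25\<close> the set of centers, \<open>26\<close> and \<open>27\<close> distance to and index of the nearest
  center. Array \<open>0\<close> is the output.\<close>

definition e_ceil :: ex where
  "e_ceil = Cn 0 \<ominus> (Cn 0 \<ominus> In (Cn 6 \<oplus> Cn 2 \<otimes> (cI \<otimes> eN \<oplus> cJ)) \<otimes> eL \<otimes> In (Cn 5))
     \<oslash> (In (Cn 7 \<oplus> Cn 2 \<otimes> (cI \<otimes> eN \<oplus> cJ)) \<otimes> In (Cn 4))"

text \<open>\<open>e_ceil\<close> is \<open>\<lceil>c / (B / l)\<rceil>\<close>, computed as the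
  negative of a rounded-down quotient; registers \<open>4\<close> and \<open>5\<close> hold the
  fraction \<open>B\<close>, and the distances follow row by row from register \<open>6\<close>, two
  registers each. The ceiling may be huge, but only its minimum with \<open>30 * n\<close> is
  stored.\<close>

definition p_dist :: cmd where
  "p_dist = For 1 eN (For 2 eN (Asg 15 cI cJ
     (e_ceil \<oplus> (Cn 30 \<otimes> eN \<lless> e_ceil) \<otimes> (Cn 30 \<otimes> eN \<ominus> e_ceil))))"

definition e_excess :: ex where
  "e_excess = (eD \<ominus> Cn 1) \<otimes> (Cn 1 \<lless> eD)"

text \<open>A test on the family number selects the summand. \<open>q\<close> enters as a constant:
  there is one program for each \<open>\<epsilon>\<close>.\<close>

definition e_coef :: "nat \<Rightarrow> ex" where
  "e_coef q =
     (Sc 3 \<doteq> Cn 0) \<otimes> ((cI \<doteq> Sc 4) \<otimes> (cJ \<doteq> Sc 5))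
     \<oplus> (Sc 3 \<doteq> Cn 1) \<otimes> ((cI \<doteq> Sc 4) \<otimes> (cJ \<doteq> eN) \<ominus> (cI \<doteq> Sc 4) \<otimes> (cJ \<doteq> Sc 5))
     \<oplus> (Sc 3 \<doteq> Cn 2) \<otimes> ((cI \<lless> eN) \<otimes> (cJ \<doteq> Sc 5) \<ominus> (cI \<doteq> eN) \<otimes> (cJ \<doteq> eN))
     \<oplus> (Sc 3 \<doteq> Cn 3) \<otimes> ((Cn (4 * int q) \<otimes> eK \<oplus> Cn 1) \<otimes> ((cI \<doteq> eN) \<otimes> (cJ \<doteq> eN))
          \<ominus> Cn (4 * int q) \<otimes> ((cI \<lless> eN) \<otimes> (cJ \<doteq> eN)))
     \<oplus> (Sc 3 \<doteq> Cn 4) \<otimes> (Cn (int q + 1) \<otimes> eL \<otimes> ((cI \<doteq> eN) \<otimes> (cJ \<doteq> eN))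
          \<ominus> Cn (int q) \<otimes> (e_excess \<otimes> ((cI \<lless> eN) \<otimes> (cJ \<lless> eN))))"

definition p_update :: "nat \<Rightarrow> cmd" where
  "p_update q = (setS 8 (Cn 0)
     ;; For 1 (eN \<oplus> Cn 1) (For 2 (eN \<oplus> Cn 1) (addS 8 (e_coef q \<otimes> Rd 16 cI cJ)))
     ;; For 1 (eN \<oplus> Cn 1) (For 2 (eN \<oplus> Cn 1) (Asg 16 cI cJ (Rd 16 cI cJ \<oplus> (Sc 8 \<lless> Cn 1) \<otimes> e_coef q))))"

text \<open>The number of sweeps is one more than the bound
  \<open>3600 * 360000 * q ^ 4 * n ^ 14\<close> on the number of updates, so some sweep makes none.
  All later sweeps change nothing, which replaces an early exit.\<close>

definition p_perceptron :: "nat \<Rightarrow> cmd" where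
  "p_perceptron q = For 6 (Cn (1296000000 * int q ^ 4) \<otimes> epow eN 14 \<oplus> Cn 1)
     (For 3 (Cn 5) (For 4 eN (For 5 eN (p_update q))))"

text \<open>The bound \<open>W\<close> is dictated by the inner product of an update: at most
  \<open>4 * n\<^sup>2\<close> terms, each at most \<open>30 * q * n\<close> times the bound on the
  variables, which is the factor in parentheses.\<close>

locale centrum_program =
  fixes u :: memory and W :: int and n k l q :: nat and d :: "nat \<Rightarrow> nat \<Rightarrow> int"
  assumes u1: "u 1 = int n" and u2: "u 2 = int k" and u3: "u 3 = int l"
    and kn: "1 \<le> k" "k < n" and ln: "1 \<le> l" "l \<le> n" and q: "1 \<le> q"
    and d_eq: "\<And>i j. i < n \<Longrightarrow> j < n \<Longrightarrow> d i j = min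
        (- ((- (u (6 + 2 * (int i * int n + int j)) * int l * u 5)) div (u (7 + 2 * (int i * int n + int j)) * u 4)))
        (30 * int n)"
    and d_nonneg: "\<And>i j. i < n \<Longrightarrow> j < n \<Longrightarrow> 0 \<le> d i j"
    and d_self: "\<And>i. i < n \<Longrightarrow> d i i = 0"
    and d_sym: "\<And>i j. i < n \<Longrightarrow> j < n \<Longrightarrow> d i j = d j i"
    and d_tri: "\<And>i j h. i < n \<Longrightarrow> j < n \<Longrightarrow> h < n \<Longrightarrow> d i j \<le> d i h + d h j"
    and W: "1000 * int q * int n ^ 3 * (4665600000000 * int q ^ 6 * int n ^ 18) \<le> W"
begin

definition f :: "nat \<Rightarrow> nat \<Rightarrow> int" where "f i j = max 0 (d i j - 1)"

abbreviation cf :: "nat \<Rightarrow> nat \<Rightarrow> nat \<Rightarrow> nat \<Rightarrow> nat \<Rightarrow> int" where "cf \<equiv> coef n k l q f"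

definition U :: int where "U = 4665600000000 * int q ^ 6 * int n ^ 18"

definition has_dist :: "state \<Rightarrow> bool" where
  "has_dist \<sigma> \<longleftrightarrow> (\<forall>i<n. \<forall>j<n. \<sigma> 15 (int i) (int j) = d i j)"

lemma d_le: "i < n \<Longrightarrow> j < n \<Longrightarrow> d i j \<le> 30 * int n"
  by (simp add: d_eq)

lemma f_bounds: "i < n \<Longrightarrow> j < n \<Longrightarrow> 0 \<le> f i j \<and> f i j \<le> 30 * int n"
  using d_le[of i j] by (auto simp: f_def)

lemma n_pos: "1 \<le> int n" and q_pos: "1 \<le> int q"
  using kn q by auto

lemma U_pos: "1 \<le> U"
proof -
  have "1 * 1 \<le> int q ^ 6 * int n ^ 18" using n_pos q_pos by (intro mult_mono one_le_power) auto
  then show ?thesis by (simp add: U_def)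
qed

lemma W_ge: "1000 * int q * int n ^ 3 * U \<le> W"
  using W by (simp add: U_def)

lemma W_big: "1000 * int n ^ 2 \<le> W" "1000 * int n \<le> W" "1000 \<le> W" "1000 * int n ^ 3 * U \<le> W"
  "1000 * int n ^ 2 * U \<le> W" "1000 * int n * U \<le> W"  "1000 * U \<le> W"
proof -
  have U: "x \<le> x * U" if "0 \<le> x" for x using mult_left_mono[OF U_pos that] by simp
  have qq: "x \<le> int q * x" if "0 \<le> x" for x using mult_right_mono[OF q_pos that] by simp
  have nn: "x \<le> int n * x" if "0 \<le> x" for x using mult_right_mono[OF n_pos that] by simp
  have U0: "0 \<le> U" using U_pos by simp
  show a: "1000 * int n ^ 3 * U \<le> W"
    using qq[of "1000 * int n ^ 3 * U"] W_ge U0 by (simp add: algebra_simps)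
  show b: "1000 * int n ^ 2 * U \<le> W"
    using nn[of "1000 * int n ^ 2 * U"] a U0 by (simp add: power3_eq_cube power2_eq_square algebra_simps)
  show c: "1000 * int n * U \<le> W"
    using nn[of "1000 * int n * U"] b U0 by (simp add: power2_eq_square algebra_simps)
  show "1000 * U \<le> W" using nn[of "1000 * U"] c U0 by (simp add: algebra_simps)
  show e: "1000 * int n ^ 2 \<le> W" using U[of "1000 * int n ^ 2"] b by simp
  show g: "1000 * int n \<le> W" using nn[of "1000 * int n"] e by (simp add: power2_eq_square)
  show "1000 \<le> W" using nn[of 1000] g by simp
qed

lemma ev_inputs [simp]: "ev u eN \<sigma> = int n" "ev u eK \<sigma> = int k" "ev u eL \<sigma> = int l"
  using u1 u2 u3 by auto

lemma int_div_nonneg_index: "0 \<le> 6 + 2 * (int i * int n + int j)"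
  by (simp add: add_nonneg_nonneg)

lemma htr_p_dist: "htr u W p_dist \<sigma> has_dist"
  unfolding p_dist_def
proof (rule htr_conseq[OF htr_map2[where m = n and m' = n and g = d]])
  show "ev u (e_ceil \<oplus> (Cn 30 \<otimes> eN \<lless> e_ceil) \<otimes> (Cn 30 \<otimes> eN \<ominus> e_ceil)) \<tau> = d i j"
    if "i < n" "j < n" "\<tau> 1 0 0 = int i" "\<tau> 2 0 0 = int j" for i j \<tau>
  proof -
    have "ev u e_ceil \<tau> = - ((- (u (6 + 2 * (int i * int n + int j)) * int l * u 5)) div (u (7 + 2 * (int i * int n + int j)) * u 4))"
      using that int_div_nonneg_index[of i j] u1 u3 by (simp add: e_ceil_def max_def)
    then show ?thesis using that by (simp add: d_eq min_def del: ev.simps(3))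
  qed
  show "\<bar>d i j\<bar> \<le> W" if "i < n" "j < n" for i j
    using d_nonneg[OF that] d_le[OF that] W_big by linarith
qed (use W_big n_pos u1 in \<open>auto simp: has_dist_def\<close>)

lemma ev_e_excess:
  assumes "has_dist \<tau>" "i < n" "j < n" "\<tau> 1 0 0 = int i" "\<tau> 2 0 0 = int j"
  shows "ev u e_excess \<tau> = f i j"
  using assms by (auto simp: e_excess_def f_def has_dist_def)

lemma ev_e_coef:
  assumes "has_dist \<tau>" "h < 5" "\<tau> 3 0 0 = int h" "\<tau> 4 0 0 = int p" "\<tau> 5 0 0 = int r"
    "\<tau> 1 0 0 = int i" "\<tau> 2 0 0 = int j"
  shows "ev u (e_coef q) \<tau> = cf h p r i j"
proof -
  have ex: "ev u (e_excess \<otimes> ((cI \<lless> eN) \<otimes> (cJ \<lless> eN))) \<tau> = f i j * of_bool (i < n \<and> j < n)"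
  proof (cases "i < n \<and> j < n")
    case True
    then show ?thesis using ev_e_excess assms u1 by simp
  next
    case False
    then show ?thesis using assms u1 by auto
  qed
  consider "h = 0" | "h = 1" | "h = 2" | "h = 3" | "h = 4" using assms(2) by linarith
  then show ?thesis
    using assms ex u1 u2 u3
    by cases (simp_all add: e_coef_def coef_def of_bool_conj)
qed

lemma abs_cf_le: "\<bar>cf h p r i j\<bar> \<le> 30 * int q * int n"
  by (rule abs_coef_le) (use kn ln q f_bounds in auto)

definition dot :: "nat \<Rightarrow> nat \<Rightarrow> nat \<Rightarrow> (nat \<Rightarrow> nat \<Rightarrow> int) \<Rightarrow> int" where
  "dot h p r w = (\<Sum>i\<le>n. \<Sum>j\<le>n. cf h p r i j * w i j)"

definition vars :: "state \<Rightarrow> nat \<Rightarrow> nat \<Rightarrow> int" where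
  "vars \<sigma> i j = \<sigma> 16 (int i) (int j)"

lemma htr_p_update:
  assumes "has_dist \<sigma>" "h < 5" "p < n" "r < n"
    "\<sigma> 3 0 0 = int h" "\<sigma> 4 0 0 = int p" "\<sigma> 5 0 0 = int r"
    and w: "\<And>i j. i \<le> n \<Longrightarrow> j \<le> n \<Longrightarrow> \<bar>vars \<sigma> i j\<bar> \<le> U"
  shows "htr u W (p_update q) \<sigma> (\<lambda>\<tau>. \<forall>i\<le>n. \<forall>j\<le>n.
    vars \<tau> i j = vars \<sigma> i j + of_bool (dot h p r (vars \<sigma>) < 1) * cf h p r i j)" (is "htr u W _ _ ?Q")
proof -
  have W': "int (Suc n) \<le> W" using W_big n_pos by simp
  have e1: "int n + 1 = int (Suc n)" by simp
  show ?thesis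
    unfolding p_update_def
  proof (rule htr_Sq)
    show "htr u W (setS 8 (Cn 0)) \<sigma> (\<lambda>\<tau>. \<tau> 8 0 0 = 0)"
      using W_big by (intro htr_Asg) (auto simp: put_apply)
    fix \<sigma>1 :: state assume s1: "\<sigma>1 8 0 0 = 0" "\<And>k. k \<notin> mods (setS 8 (Cn 0)) \<Longrightarrow> \<sigma>1 k = \<sigma> k"
    then have fr1: "k \<noteq> 8 \<Longrightarrow> \<sigma>1 k = \<sigma> k" for k by simp
    show "htr u W (For 1 (eN \<oplus> Cn 1) (For 2 (eN \<oplus> Cn 1) (addS 8 (e_coef q \<otimes> Rd 16 cI cJ)))
     ;; For 1 (eN \<oplus> Cn 1) (For 2 (eN \<oplus> Cn 1) (Asg 16 cI cJ (Rd 16 cI cJ \<oplus> (Sc 8 \<lless> Cn 1) \<otimes> e_coef q)))) \<sigma>1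
       ?Q"
    proof (rule htr_Sq)
      show "htr u W (For 1 (eN \<oplus> Cn 1) (For 2 (eN \<oplus> Cn 1) (addS 8 (e_coef q \<otimes> Rd 16 cI cJ)))) \<sigma>1
        (\<lambda>\<tau>. \<tau> 8 0 0 = (\<Sum>i<Suc n. \<Sum>j<Suc n. cf h p r i j * vars \<sigma> i j))"
      proof (rule htr_sum2[where K = "30 * int q * int n * U"])
        fix i j \<tau> assume ij: "i < Suc n" "j < Suc n" and fr: "\<And>k. k \<noteq> 1 \<Longrightarrow> k \<noteq> 2 \<Longrightarrow> k \<noteq> 8 \<Longrightarrow> \<tau> k = \<sigma>1 k"
          and c: "\<tau> 1 0 0 = int i" "\<tau> 2 0 0 = int j"
        have "ev u (e_coef q) \<tau> = cf h p r i j"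
          using assms(1-7) c by (intro ev_e_coef) (auto simp: has_dist_def fr fr1)
        then show "ev u (e_coef q \<otimes> Rd 16 cI cJ) \<tau> = cf h p r i j * vars \<sigma> i j"
          using c by (simp add: fr fr1 vars_def)
      next
        fix i j assume "i < Suc n" "j < Suc n"
        then show "\<bar>cf h p r i j * vars \<sigma> i j\<bar> \<le> 30 * int q * int n * U"
          unfolding abs_mult using w[of i j] by (intro mult_mono abs_cf_le) auto
      next
        have "int (Suc n) * int (Suc n) \<le> (2 * int n) * (2 * int n)"
          using n_pos by (intro mult_mono) auto
        then have "int (Suc n) * int (Suc n) * (30 * int q * int n * U) \<le> (2 * int n) * (2 * int n) * (30 * int q * int n * U)"
          using U_pos by (intro mult_right_mono) auto
        also have "\<dots> = 120 * (int q * int n ^ 3 * U)" by (simp add: power3_eq_cube)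
        also have "\<dots> \<le> 1000 * int q * int n ^ 3 * U" using U_pos by simp
        finally show "int (Suc n) * (int (Suc n) * (30 * int q * int n * U)) \<le> W"
          using W_ge unfolding mult.assoc by (rule order.trans)
        show "0 \<le> 30 * int q * int n * U" using U_pos by simp
      qed (use W' u1 s1 in auto)
      fix \<sigma>2 assume s2: "\<sigma>2 8 0 0 = (\<Sum>i<Suc n. \<Sum>j<Suc n. cf h p r i j * vars \<sigma> i j)"
        "\<And>k. k \<notin> mods (For 1 (eN \<oplus> Cn 1) (For 2 (eN \<oplus> Cn 1) (addS 8 (e_coef q \<otimes> Rd 16 cI cJ)))) \<Longrightarrow> \<sigma>2 k = \<sigma>1 k"
      then have fr2: "k \<noteq> 1 \<Longrightarrow> k \<noteq> 2 \<Longrightarrow> k \<noteq> 8 \<Longrightarrow> \<sigma>2 k = \<sigma> k" for k using fr1 by simp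
      have dt: "\<sigma>2 8 0 0 = dot h p r (vars \<sigma>)" using s2(1) unfolding dot_def lessThan_Suc_atMost .
      show "htr u W (For 1 (eN \<oplus> Cn 1) (For 2 (eN \<oplus> Cn 1) (Asg 16 cI cJ (Rd 16 cI cJ \<oplus> (Sc 8 \<lless> Cn 1) \<otimes> e_coef q)))) \<sigma>2
       ?Q"
      proof (rule htr_conseq[OF htr_map2[where m = "Suc n" and m' = "Suc n"
            and g = "\<lambda>i j. vars \<sigma> i j + of_bool (dot h p r (vars \<sigma>) < 1) * cf h p r i j"]])
        fix i j \<tau> assume ij: "i < Suc n" "j < Suc n" and fr: "\<And>k. k \<noteq> 1 \<Longrightarrow> k \<noteq> 2 \<Longrightarrow> k \<noteq> 16 \<Longrightarrow> \<tau> k = \<sigma>2 k"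
          and c: "\<tau> 1 0 0 = int i" "\<tau> 2 0 0 = int j" "\<tau> 16 (int i) (int j) = \<sigma>2 16 (int i) (int j)"
        have "ev u (e_coef q) \<tau> = cf h p r i j"
          using assms(1-7) c by (intro ev_e_coef) (auto simp: has_dist_def fr fr2)
        then show "ev u (Rd 16 cI cJ \<oplus> (Sc 8 \<lless> Cn 1) \<otimes> e_coef q) \<tau> =
            vars \<sigma> i j + of_bool (dot h p r (vars \<sigma>) < 1) * cf h p r i j"
          using c by (simp add: fr fr2 vars_def dt)
      next
        fix i j assume "i < Suc n" "j < Suc n"
        then have "\<bar>vars \<sigma> i j + of_bool (dot h p r (vars \<sigma>) < 1) * cf h p r i j\<bar> \<le> U + 30 * int q * int n"
          using w[of i j] abs_cf_le[of h p r i j] by (auto simp: of_bool_def)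
        also have "\<dots> \<le> 1000 * int q * int n ^ 3 * U"
        proof -
          have "1 * 1 \<le> int q * int n ^ 3" using q_pos n_pos by (intro mult_mono one_le_power) auto
          then have "1 * U \<le> int q * int n ^ 3 * U" using U_pos by (intro mult_right_mono) auto
          moreover have "(int q * int n) * (1 * 1) \<le> (int q * int n) * (int n ^ 2 * U)"
            using U_pos n_pos by (intro mult_left_mono mult_mono one_le_power) auto
          then have "int q * int n \<le> int q * int n ^ 3 * U" by (simp add: power3_eq_cube power2_eq_square mult.assoc)
          moreover have "0 \<le> int q * int n ^ 3 * U" using U_pos by simp
          ultimately show ?thesis by linarith
        qed
        finally show "\<bar>vars \<sigma> i j + of_bool (dot h p r (vars \<sigma>) < 1) * cf h p r i j\<bar> \<le> W" using W_ge by linarith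
      qed (use W' u1 in \<open>auto simp: vars_def less_Suc_eq_le\<close>)
    qed
  qed
qed

end

context centrum_program
begin

text \<open>After \<open>m\<close> updates, the inner product with a solution \<open>z\<close> of margin \<open>1\<close> is
  at least \<open>m\<close>, whereas the squared norm is at most \<open>m\<close> times that of a constraint. So
  \<open>m\<close> is at most the product of the bounds on the squared norms of a constraint
  (\<open>3600 q\<^sup>2 n\<^sup>4\<close>) and of \<open>z\<close>; multiplying by the former once more gives the bound
  \<open>U\<close> on the entries.\<close>

definition updates :: "(nat \<Rightarrow> nat \<Rightarrow> real) \<Rightarrow> nat \<Rightarrow> (nat \<Rightarrow> nat \<Rightarrow> int) \<Rightarrow> bool" where
  "updates z m w \<longleftrightarrow> real m \<le> (\<Sum>i\<le>n. \<Sum>j\<le>n. z i j * w i j) \<and>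
     (\<Sum>i\<le>n. \<Sum>j\<le>n. (w i j)\<^sup>2) \<le> int m * (3600 * int q ^ 2 * int n ^ 4)"

definition good_margin :: "(nat \<Rightarrow> nat \<Rightarrow> real) \<Rightarrow> bool" where
  "good_margin z \<longleftrightarrow> (\<forall>h p r. p < n \<longrightarrow> r < n \<longrightarrow> 1 \<le> (\<Sum>i\<le>n. \<Sum>j\<le>n. z i j * of_int (cf h p r i j))) \<and>
     (\<Sum>i\<le>n. \<Sum>j\<le>n. (z i j)\<^sup>2) \<le> 360000 * real q ^ 2 * real n ^ 10"

definition step :: "nat \<Rightarrow> nat \<Rightarrow> nat \<Rightarrow> (nat \<Rightarrow> nat \<Rightarrow> int) \<Rightarrow> nat \<Rightarrow> nat \<Rightarrow> int" where
  "step h p r w = (\<lambda>i j. w i j + of_bool (dot h p r w < 1) * cf h p r i j)"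

lemma updates_bound:
  assumes "updates z m w" "good_margin z"
  shows "m \<le> 1296000000 * q ^ 4 * n ^ 14"
proof -
  let ?G = "3600 * int q ^ 2 * int n ^ 4"
  have "real m \<le> of_int ?G * (\<Sum>i\<le>n. \<Sum>j\<le>n. (z i j)\<^sup>2)"
    using perceptron_bound[of m "\<lambda>(i, j). z i j" "\<lambda>(i, j). w i j" "{..n} \<times> {..n}" ?G] assms(1)
    by (simp add: updates_def sum.cartesian_product case_prod_beta')
  also have "\<dots> \<le> of_int ?G * (360000 * real q ^ 2 * real n ^ 10)"
    using assms(2) by (intro mult_left_mono) (auto simp: good_margin_def)
  also have "\<dots> = real (1296000000 * q ^ 4 * n ^ 14)"
  proof -
    have "real q ^ 4 = real q ^ 2 * real q ^ 2" "real n ^ 14 = real n ^ 4 * real n ^ 10"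
      by (simp_all flip: power_add)
    then show ?thesis by (simp add: mult_ac)
  qed
  finally show ?thesis by (simp only: of_nat_le_iff)
qed

lemma updates_abs_le:
  assumes "updates z m w" "good_margin z" "i \<le> n" "j \<le> n"
  shows "\<bar>w i j\<bar> \<le> U"
proof -
  let ?G = "3600 * int q ^ 2 * int n ^ 4"
  have "\<bar>w i j\<bar> \<le> (w i j)\<^sup>2" using abs_le_mult_self by (simp add: power2_eq_square)
  also have "\<dots> \<le> (\<Sum>j\<le>n. (w i j)\<^sup>2)" using assms by (intro member_le_sum) auto
  also have "\<dots> \<le> (\<Sum>i\<le>n. \<Sum>j\<le>n. (w i j)\<^sup>2)"
    using assms by (intro member_le_sum[of i "{..n}" "\<lambda>i. \<Sum>j\<le>n. (w i j)\<^sup>2"] sum_nonneg) auto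
  also have "\<dots> \<le> int m * ?G" using assms by (simp add: updates_def)
  also have "\<dots> \<le> int (1296000000 * q ^ 4 * n ^ 14) * ?G"
  proof (rule mult_right_mono)
    show "int m \<le> int (1296000000 * q ^ 4 * n ^ 14)"
      using updates_bound[OF assms(1,2)] by (simp only: of_nat_le_iff)
  qed simp
  also have "\<dots> = 4665600000000 * (int q ^ 4 * int q ^ 2) * (int n ^ 14 * int n ^ 4)" by (simp add: mult_ac)
  also have "\<dots> = U" unfolding power_add[symmetric] by (simp add: U_def)
  finally show ?thesis .
qed

lemma updates_step:
  assumes "updates z m w" "good_margin z" "p < n" "r < n"
  shows "updates z (if dot h p r w < 1 then Suc m else m) (step h p r w)"
proof (cases "dot h p r w < 1")
  case True
  let ?G = "3600 * int q ^ 2 * int n ^ 4" and ?U = "{..n} \<times> {..n}"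
  let ?a = "\<lambda>(i, j). cf h p r i j" and ?w = "\<lambda>(i, j). w i j" and ?z = "\<lambda>(i, j). z i j"
  have 1: "real m \<le> (\<Sum>u\<in>?U. ?z u * ?w u)" "(\<Sum>u\<in>?U. (?w u)\<^sup>2) \<le> int m * ?G"
    using assms(1) by (simp_all add: updates_def sum.cartesian_product case_prod_beta')
  have 2: "(\<Sum>u\<in>?U. ?a u * ?w u) \<le> 0"
    using True by (simp add: dot_def sum.cartesian_product case_prod_beta')
  have "(\<Sum>i\<le>n. \<Sum>j\<le>n. (cf h p r i j)\<^sup>2) \<le> ?G"
    by (rule coef_norm_le) (use kn ln q f_bounds in auto)
  then have 3: "(\<Sum>u\<in>?U. (?a u)\<^sup>2) \<le> ?G"
    by (simp add: sum.cartesian_product case_prod_beta')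
  have 4: "1 \<le> (\<Sum>u\<in>?U. ?z u * of_int (?a u))"
    using assms(2-4) by (simp add: good_margin_def sum.cartesian_product case_prod_beta')
  from perceptron_step[OF 1 2 3 4] True show ?thesis
    by (simp add: updates_def step_def sum.cartesian_product case_prod_beta')
next
  case False
  then show ?thesis using assms by (simp add: step_def)
qed

definition sat :: "(nat \<times> nat \<times> nat) set \<Rightarrow> (nat \<Rightarrow> nat \<Rightarrow> int) \<Rightarrow> bool" where
  "sat A w \<longleftrightarrow> (\<forall>(h, p, r)\<in>A. 0 < dot h p r w)"

definition cons :: "(nat \<times> nat \<times> nat) set" where
  "cons = {..<5} \<times> {..<n} \<times> {..<n}"

text \<open>Each of the first \<open>s\<close> sweeps either made an update or found all constraints satisfied; in the
  current sweep, \<open>A\<close> is the set of constraints that were visited so far.\<close>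

definition sweep_inv :: "(nat \<Rightarrow> nat \<Rightarrow> real) \<Rightarrow> nat \<Rightarrow> (nat \<times> nat \<times> nat) set \<Rightarrow> (nat \<Rightarrow> nat \<Rightarrow> int) \<Rightarrow> bool" where
  "sweep_inv z s A w \<longleftrightarrow> (\<exists>m. updates z m w \<and> (s < m \<or> sat cons w \<or> (s \<le> m \<and> sat A w)))"

text \<open>An update raises \<open>m\<close> above \<open>s\<close>, since it rules out that all
  constraints were satisfied. Without an update the vector is unchanged, and the current constraint
  joins those known to be satisfied.\<close>

lemma sweep_inv_step:
  assumes "sweep_inv z s A w" "good_margin z" "h < 5" "p < n" "r < n"
  shows "sweep_inv z s (insert (h, p, r) A) (step h p r w)"
proof -
  obtain m where m: "updates z m w" "s < m \<or> sat cons w \<or> (s \<le> m \<and> sat A w)"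
    using assms(1) by (auto simp: sweep_inv_def)
  note u = updates_step[OF m(1) assms(2,4,5), of h]
  show ?thesis
  proof (cases "dot h p r w < 1")
    case True
    then have "\<not> sat cons w" using assms by (force simp: sat_def cons_def)
    then show ?thesis using u m True by (auto simp: sweep_inv_def intro!: exI[of _ "Suc m"])
  next
    case False
    then have "step h p r w = w" by (simp add: step_def)
    then show ?thesis using u m False by (auto simp: sweep_inv_def sat_def intro!: exI[of _ m])
  qed
qed

lemma sweep_inv_mono: "sweep_inv z s A w \<Longrightarrow> B \<subseteq> A \<Longrightarrow> sweep_inv z s B w"
  unfolding sweep_inv_def sat_def by blast

text \<open>A complete sweep either leaves \<open>m\<close> above \<open>s\<close>, so that
  \<open>Suc s \<le> m\<close>, or has found all of \<open>cons\<close> satisfied.\<close>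

lemma sweep_inv_Suc: "sweep_inv z s cons w \<Longrightarrow> sweep_inv z (Suc s) {} w"
  by (force simp: sweep_inv_def sat_def)

lemma dot_cong: "(\<And>i j. i \<le> n \<Longrightarrow> j \<le> n \<Longrightarrow> w i j = w' i j) \<Longrightarrow> dot h p r w = dot h p r w'"
  by (simp add: dot_def)

lemma sweep_inv_cong:
  assumes "\<And>i j. i \<le> n \<Longrightarrow> j \<le> n \<Longrightarrow> w i j = w' i j" "sweep_inv z s A w"
  shows "sweep_inv z s A w'"
  using assms(2) dot_cong[OF assms(1)] assms(1) by (auto simp: sweep_inv_def sat_def updates_def)

lemma htr_p_perceptron:
  assumes z: "good_margin z" and d0: "has_dist \<sigma>" and w0: "\<And>i j. \<sigma> 16 i j = 0"
  shows "htr u W (p_perceptron q) \<sigma> (\<lambda>\<tau>. sat cons (vars \<tau>) \<and> (\<forall>i\<le>n. \<forall>j\<le>n. \<bar>vars \<tau> i j\<bar> \<le> U))"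
proof -
  let ?T = "1296000000 * q ^ 4 * n ^ 14 + 1"
  have mods: "mods (p_update q) = {1, 2, 8, 16}" by (auto simp: p_update_def)
  have W1: "int n \<le> W" "5 \<le> W" using W_big by auto
  have put16: "x \<noteq> 16 \<Longrightarrow> vars (put \<tau> x a b v) = vars \<tau>" for x \<tau> a b v
    by (auto simp: vars_def fun_eq_iff)
  have hd: "has_dist \<tau>" if "\<tau> 15 = \<sigma> 15" for \<tau> using d0 that by (simp add: has_dist_def)
  have T: "ev u (Cn (1296000000 * int q ^ 4) \<otimes> epow eN 14 \<oplus> Cn 1) \<sigma> = int ?T" using u1 by simp
  have TW: "int ?T \<le> W"
  proof -
    have "1 \<le> int q ^ 2" "1 \<le> int n ^ 4" using one_le_power[OF q_pos] one_le_power[OF n_pos] by auto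
    then have "1 * 1 \<le> int q ^ 2 * int n ^ 4" by (intro mult_mono) auto
    then have "1296000000 * int q ^ 4 * int n ^ 14 * 1 \<le> 1296000000 * int q ^ 4 * int n ^ 14 * (int q ^ 2 * int n ^ 4)"
      by (intro mult_left_mono) auto
    also have "\<dots> = 1296000000 * (int q ^ 4 * int q ^ 2) * (int n ^ 14 * int n ^ 4)" by (simp add: mult_ac)
    also have "\<dots> = 1296000000 * int q ^ 6 * int n ^ 18" unfolding power_add[symmetric] by simp
    also have "\<dots> \<le> U" by (simp add: U_def)
    finally show ?thesis using W_big(7) U_pos by simp
  qed
  have "htr u W (p_perceptron q) \<sigma> (\<lambda>\<tau>. sweep_inv z ?T {} (vars \<tau>))"
    unfolding p_perceptron_def
  proof (rule htr_For[OF T TW])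
    have "updates z 0 (vars \<sigma>)" by (simp add: updates_def vars_def w0)
    then show "sweep_inv z 0 {} (vars \<sigma>)" by (auto simp: sweep_inv_def sat_def)
    fix s \<tau>1 assume inv1: "sweep_inv z s {} (vars \<tau>1)"
      and f1: "\<And>k. k \<notin> insert 6 (mods (For 3 (Cn 5) (For 4 eN (For 5 eN (p_update q))))) \<Longrightarrow> \<tau>1 k = \<sigma> k"
    have "htr u W (For 3 (Cn 5) (For 4 eN (For 5 eN (p_update q)))) (put \<tau>1 6 0 0 (int s))
        (\<lambda>\<tau>. sweep_inv z s ({..<5} \<times> {..<n} \<times> {..<n}) (vars \<tau>))"
    proof (rule htr_For[where m = 5 and I = "\<lambda>h \<tau>. sweep_inv z s ({..<h} \<times> {..<n} \<times> {..<n}) (vars \<tau>)"])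
      show "sweep_inv z s ({..<0} \<times> {..<n} \<times> {..<n}) (vars (put \<tau>1 6 0 0 (int s)))"
        using inv1 by (simp add: put16)
      fix h \<tau>2 assume h: "h < (5 :: nat)" and inv2: "sweep_inv z s ({..<h} \<times> {..<n} \<times> {..<n}) (vars \<tau>2)"
        and f2: "\<And>k. k \<notin> insert 3 (mods (For 4 eN (For 5 eN (p_update q)))) \<Longrightarrow> \<tau>2 k = put \<tau>1 6 0 0 (int s) k"
      let ?A = "{..<h} \<times> {..<n} \<times> {..<n}"
      have "htr u W (For 4 eN (For 5 eN (p_update q))) (put \<tau>2 3 0 0 (int h))
          (\<lambda>\<tau>. sweep_inv z s (?A \<union> {h} \<times> {..<n} \<times> {..<n}) (vars \<tau>))"
      proof (rule htr_For[where I = "\<lambda>p \<tau>. sweep_inv z s (?A \<union> {h} \<times> {..<p} \<times> {..<n}) (vars \<tau>)"])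
        show "sweep_inv z s (?A \<union> {h} \<times> {..<0} \<times> {..<n}) (vars (put \<tau>2 3 0 0 (int h)))"
          using inv2 by (simp add: put16)
        fix p \<tau>3 assume p: "p < n" and inv3: "sweep_inv z s (?A \<union> {h} \<times> {..<p} \<times> {..<n}) (vars \<tau>3)"
          and f3: "\<And>k. k \<notin> insert 4 (mods (For 5 eN (p_update q))) \<Longrightarrow> \<tau>3 k = put \<tau>2 3 0 0 (int h) k"
        let ?B = "?A \<union> {h} \<times> {..<p} \<times> {..<n}"
        have "htr u W (For 5 eN (p_update q)) (put \<tau>3 4 0 0 (int p))
            (\<lambda>\<tau>. sweep_inv z s (?B \<union> {h} \<times> {p} \<times> {..<n}) (vars \<tau>))"
        proof (rule htr_For[where I = "\<lambda>r \<tau>. sweep_inv z s (?B \<union> {h} \<times> {p} \<times> {..<r}) (vars \<tau>)"])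
          show "sweep_inv z s (?B \<union> {h} \<times> {p} \<times> {..<0}) (vars (put \<tau>3 4 0 0 (int p)))"
            using inv3 by (simp add: put16)
          fix r \<tau>4 assume r: "r < n" and inv4: "sweep_inv z s (?B \<union> {h} \<times> {p} \<times> {..<r}) (vars \<tau>4)"
            and f4: "\<And>k. k \<notin> insert 5 (mods (p_update q)) \<Longrightarrow> \<tau>4 k = put \<tau>3 4 0 0 (int p) k"
          let ?C = "?B \<union> {h} \<times> {p} \<times> {..<r}" and ?\<tau> = "put \<tau>4 5 0 0 (int r)"
          have c: "?\<tau> 3 0 0 = int h" "?\<tau> 4 0 0 = int p" "?\<tau> 5 0 0 = int r" "?\<tau> 15 = \<sigma> 15"
            using f4[of 3] f4[of 4] f4[of 15] f3[of 3] f3[of 15] f2[of 15] f1[of 15]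
            by (simp_all add: mods put_apply)
          have b: "\<bar>vars ?\<tau> i j\<bar> \<le> U" if "i \<le> n" "j \<le> n" for i j
            using inv4 updates_abs_le[OF _ z that] by (auto simp: sweep_inv_def put16)
          show "htr u W (p_update q) ?\<tau> (\<lambda>\<tau>. sweep_inv z s (?B \<union> {h} \<times> {p} \<times> {..<Suc r}) (vars \<tau>))"
          proof (rule htr_conseq[OF htr_p_update[OF hd[of ?\<tau>, OF c(4)] h p r c(1-3) b]])
            fix \<tau> assume t: "\<forall>i\<le>n. \<forall>j\<le>n. vars \<tau> i j = vars ?\<tau> i j + of_bool (dot h p r (vars ?\<tau>) < 1) * cf h p r i j"
            have "sweep_inv z s (insert (h, p, r) ?C) (step h p r (vars ?\<tau>))"
              using inv4 by (intro sweep_inv_step z h p r) (simp add: put16)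
            then have "sweep_inv z s (insert (h, p, r) ?C) (vars \<tau>)"
              by (rule sweep_inv_cong[rotated]) (use t in \<open>simp add: step_def\<close>)
            then show "sweep_inv z s (?B \<union> {h} \<times> {p} \<times> {..<Suc r}) (vars \<tau>)"
              by (rule sweep_inv_mono) (auto simp: less_Suc_eq)
          qed
        qed (use u1 W1 in auto)
        then show "htr u W (For 5 eN (p_update q)) (put \<tau>3 4 0 0 (int p))
            (\<lambda>\<tau>. sweep_inv z s (?A \<union> {h} \<times> {..<Suc p} \<times> {..<n}) (vars \<tau>))"
          by (rule htr_conseq) (erule sweep_inv_mono, auto simp: less_Suc_eq)
      qed (use u1 W1 in auto)
      then show "htr u W (For 4 eN (For 5 eN (p_update q))) (put \<tau>2 3 0 0 (int h))
          (\<lambda>\<tau>. sweep_inv z s ({..<Suc h} \<times> {..<n} \<times> {..<n}) (vars \<tau>))"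
        by (rule htr_conseq) (erule sweep_inv_mono, auto simp: less_Suc_eq)
    qed (use W1 in auto)
    then show "htr u W (For 3 (Cn 5) (For 4 eN (For 5 eN (p_update q)))) (put \<tau>1 6 0 0 (int s))
        (\<lambda>\<tau>. sweep_inv z (Suc s) {} (vars \<tau>))"
      by (rule htr_conseq) (intro sweep_inv_Suc, simp add: cons_def)
  qed
  then show ?thesis
  proof (rule htr_conseq)
    fix \<tau> assume "sweep_inv z ?T {} (vars \<tau>)"
    then obtain m where m: "updates z m (vars \<tau>)" "?T < m \<or> sat cons (vars \<tau>) \<or> ?T \<le> m"
      by (auto simp: sweep_inv_def)
    \<comment> \<open>There were more sweeps than possible updates, so only satisfaction of all
      constraints remains.\<close>
    have "m < ?T" using updates_bound[OF m(1) z] by simp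
    then show "sat cons (vars \<tau>) \<and> (\<forall>i\<le>n. \<forall>j\<le>n. \<bar>vars \<tau> i j\<bar> \<le> U)"
      using m updates_abs_le[OF m(1) z] by auto
  qed
qed

end

section \<open>Clustering and nearest centers\<close>

lemma htr_scalar_sum:
  assumes m: "\<And>\<tau>. (\<And>k. k \<noteq> S \<Longrightarrow> \<tau> k = \<sigma> k) \<Longrightarrow> ev u N \<tau> = int m" "int m \<le> W" and "S \<noteq> x"
    and e: "\<And>i \<tau>. i < m \<Longrightarrow> (\<And>k. k \<noteq> x \<Longrightarrow> k \<noteq> S \<Longrightarrow> \<tau> k = \<sigma> k) \<Longrightarrow> \<tau> x 0 0 = int i \<Longrightarrow> ev u e \<tau> = g i"
    and K: "\<And>i. i < m \<Longrightarrow> \<bar>g i\<bar> \<le> K" and bound: "int m * K \<le> W"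
  shows "htr u W (setS S (Cn 0) ;; For x N (addS S e)) \<sigma> (\<lambda>\<tau>. \<tau> S 0 0 = (\<Sum>i<m. g i))"
proof (rule htr_Sq)
  show "htr u W (setS S (Cn 0)) \<sigma> (\<lambda>\<tau>. \<tau> S 0 0 = 0)"
    using m(2) by (intro htr_Asg) (auto simp: put_apply)
  fix \<tau>1 :: state assume t: "\<tau>1 S 0 0 = 0" "\<And>k. k \<notin> mods (setS S (Cn 0)) \<Longrightarrow> \<tau>1 k = \<sigma> k"
  then have fr: "k \<noteq> S \<Longrightarrow> \<tau>1 k = \<sigma> k" for k by simp
  have "htr u W (For x N (addS S e)) \<tau>1
    (\<lambda>\<tau>. \<tau> S = (\<lambda>a' b'. if a' = 0 \<and> b' = 0 then \<tau>1 S 0 0 + (\<Sum>i<m. g i) else \<tau>1 S a' b'))"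
    by (rule htr_sum[OF m(1) m(2) \<open>S \<noteq> x\<close> _ e K]) (use fr t(1) bound in auto)
  then show "htr u W (For x N (addS S e)) \<tau>1 (\<lambda>\<tau>. \<tau> S 0 0 = (\<Sum>i<m. g i))"
    by (rule htr_conseq) (use t(1) in auto)
qed

lemma htr_sums:
  assumes m: "ev u N \<sigma> = int m" "int m \<le> W" and neq: "A \<noteq> x" "A \<noteq> y" "x \<noteq> y"
    and m': "\<And>\<tau>. (\<And>k. k \<noteq> x \<Longrightarrow> k \<noteq> y \<Longrightarrow> k \<noteq> A \<Longrightarrow> \<tau> k = \<sigma> k) \<Longrightarrow> ev u N' \<tau> = int m'" "int m' \<le> W"
    and e: "\<And>i j \<tau>. i < m' \<Longrightarrow> j < m \<Longrightarrow> (\<And>k. k \<noteq> x \<Longrightarrow> k \<noteq> y \<Longrightarrow> k \<noteq> A \<Longrightarrow> \<tau> k = \<sigma> k)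
      \<Longrightarrow> \<tau> x 0 0 = int i \<Longrightarrow> \<tau> y 0 0 = int j \<Longrightarrow> ev u e \<tau> = g i j"
    and K: "\<And>i j. i < m' \<Longrightarrow> j < m \<Longrightarrow> \<bar>g i j\<bar> \<le> K" and bound: "int m' * K \<le> W"
  shows "htr u W (For y N (Asg A (Sc y) (Cn 0) (Cn 0) ;;
      For x N' (Asg A (Sc y) (Cn 0) (Ar A (Sc y) \<oplus> e)))) \<sigma>
    (\<lambda>\<tau>. \<forall>j<m. \<tau> A (int j) 0 = (\<Sum>i<m'. g i j))"
proof (rule htr_For[where I = "\<lambda>j \<tau>. \<forall>j'<j. \<tau> A (int j') 0 = (\<Sum>i<m'. g i j')", OF m])
  let ?inner = "For x N' (Asg A (Sc y) (Cn 0) (Ar A (Sc y) \<oplus> e))"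
  fix j \<tau> assume j: "j < m" and inv: "\<forall>j'<j. \<tau> A (int j') 0 = (\<Sum>i<m'. g i j')"
    and frame: "\<And>k. k \<notin> insert y (mods (Asg A (Sc y) (Cn 0) (Cn 0) ;; ?inner)) \<Longrightarrow> \<tau> k = \<sigma> k"
  let ?\<tau> = "put \<tau> y 0 0 (int j)"
  show "htr u W (Asg A (Sc y) (Cn 0) (Cn 0) ;; ?inner) ?\<tau> (\<lambda>\<tau>. \<forall>j'<Suc j. \<tau> A (int j') 0 = (\<Sum>i<m'. g i j'))"
  proof (rule htr_Sq)
    show "htr u W (Asg A (Sc y) (Cn 0) (Cn 0)) ?\<tau> (\<lambda>\<tau>1. \<tau>1 A = (\<lambda>a b. if a = int j \<and> b = 0 then 0 else \<tau> A a b))"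
      using m(2) neq by (intro htr_Asg) (auto simp: put_apply fun_eq_iff)
    fix \<tau>1 :: state assume t: "\<tau>1 A = (\<lambda>a b. if a = int j \<and> b = 0 then 0 else \<tau> A a b)"
      "\<And>k. k \<notin> mods (Asg A (Sc y) (Cn 0) (Cn 0)) \<Longrightarrow> \<tau>1 k = ?\<tau> k"
    have fr: "k \<noteq> x \<Longrightarrow> k \<noteq> y \<Longrightarrow> k \<noteq> A \<Longrightarrow> \<tau>1 k = \<sigma> k" for k using t(2)[of k] frame[of k] by simp
    have y1: "\<tau>1 y 0 0 = int j" using t(2)[of y] neq by (simp add: put_apply)
    have "htr u W ?inner \<tau>1
      (\<lambda>\<tau>. \<tau> A = (\<lambda>a' b'. if a' = int j \<and> b' = 0 then \<tau>1 A (int j) 0 + (\<Sum>i<m'. g i j) else \<tau>1 A a' b'))"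
    proof (rule htr_sum[OF m'(1)[OF fr] m'(2) neq(1), where K = K])
      fix \<tau>2 :: state assume "\<And>k. k \<noteq> x \<Longrightarrow> k \<noteq> A \<Longrightarrow> \<tau>2 k = \<tau>1 k"
      then show "ev u (Sc y) \<tau>2 = int j \<and> ev u (Cn 0) \<tau>2 = 0" using y1 neq by simp
    next
      fix i \<tau>2 assume i: "i < m'" and t2: "\<And>k. k \<noteq> x \<Longrightarrow> k \<noteq> A \<Longrightarrow> \<tau>2 k = \<tau>1 k" "\<tau>2 x 0 0 = int i"
      show "ev u e \<tau>2 = g i j"
        by (rule e[OF i j]) (use t2 fr y1 neq in auto)
    qed (use K j bound t(1) in auto)
    then show "htr u W ?inner \<tau>1 (\<lambda>\<tau>. \<forall>j'<Suc j. \<tau> A (int j') 0 = (\<Sum>i<m'. g i j'))"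
      by (rule htr_conseq) (use t(1) inv in \<open>auto simp: less_Suc_eq\<close>)
  qed
qed simp

section \<open>Programs for costs, representatives and nearest points\<close>

definition p_cost :: cmd where
  "p_cost = For 2 eN (Asg 17 cJ (Cn 0) (Cn 0) ;; For 1 eN (Asg 17 cJ (Cn 0) (Ar 17 cJ \<oplus> e_excess \<otimes> Rd 16 cI cJ)))"

abbreviation eZ :: ex where "eZ \<equiv> Rd 16 eN eN"

text \<open>The test for distance at most \<open>2 + 4 * C j\<close>, multiplied by the common
  denominator \<open>eZ\<close>; array \<open>17\<close> holds costs not yet divided by it, and the
  \<open>1\<close> turns the strict comparison of integers into a weak one.\<close>

definition e_close :: ex where
  "e_close = (eZ \<otimes> eD \<lless> Cn 2 \<otimes> eZ \<oplus> Cn 4 \<otimes> Ar 17 cJ \<oplus> Cn 1)"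

text \<open>Instead of sorting, the outer loop runs through all possible fractional costs, from
  \<open>0\<close> to \<open>30 * n\<^sup>2 * U\<close>, and treats the clients with exactly this
  cost; \<open>139968000000000\<close> is \<open>30\<close> times the factor in
  \<open>U\<close>.\<close>

definition p_cluster :: "nat \<Rightarrow> cmd" where
  "p_cluster q = For 7 (Cn (139968000000000 * int q ^ 6) \<otimes> epow eN 20 \<oplus> Cn 1) (For 2 eN
     ((setS 8 (Cn 0) ;; For 1 eN (addS 8 (Ar 18 cI \<otimes> e_close))) ;;
      Asg 18 cJ (Cn 0) (Ar 18 cJ \<oplus> (Ar 17 cJ \<doteq> Sc 7) \<otimes> (Sc 8 \<doteq> Cn 0))))"

definition p_nearest :: "ex \<Rightarrow> nat \<Rightarrow> nat \<Rightarrow> cmd" where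
  "p_nearest msk A B = For 2 eN (Asg A cJ (Cn 0) (Cn 30 \<otimes> eN \<oplus> Cn 1) ;; Asg B cJ (Cn 0) (Cn 0) ;;
     For 1 eN (setS 8 (msk \<otimes> (eD \<lless> Ar A cJ)) ;;
       Asg B cJ (Cn 0) (Ar B cJ \<oplus> Sc 8 \<otimes> (cI \<ominus> Ar B cJ)) ;;
       Asg A cJ (Cn 0) (Ar A cJ \<oplus> Sc 8 \<otimes> (eD \<ominus> Ar A cJ))))"

context centrum_program
begin

definition cst :: "(nat \<Rightarrow> nat \<Rightarrow> int) \<Rightarrow> nat \<Rightarrow> int" where
  "cst w j = (\<Sum>i<n. f i j * w i j)"

lemma abs_fw_le:
  assumes w: "\<And>i j. i \<le> n \<Longrightarrow> j \<le> n \<Longrightarrow> \<bar>w i j\<bar> \<le> U" and "i < n" "j < n"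
  shows "\<bar>f i j * w i j\<bar> \<le> 30 * int n * U"
proof -
  have "\<bar>f i j\<bar> \<le> 30 * int n" using f_bounds[of i j] assms by simp
  then show ?thesis unfolding abs_mult using w[of i j] assms by (intro mult_mono) auto
qed

lemma abs_cst_le:
  assumes w: "\<And>i j. i \<le> n \<Longrightarrow> j \<le> n \<Longrightarrow> \<bar>w i j\<bar> \<le> U" and j: "j < n"
  shows "\<bar>cst w j\<bar> \<le> 30 * int n ^ 2 * U"
proof -
  have "\<bar>cst w j\<bar> \<le> (\<Sum>i<n. 30 * int n * U)"
    unfolding cst_def using abs_fw_le[of w, OF w] j by (intro order.trans[OF sum_abs] sum_mono) auto
  then show ?thesis by (simp add: power2_eq_square)
qed

lemma nW: "int n \<le> W"
  using W_big by simp

lemma htr_p_cost: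
  assumes "has_dist \<sigma>" and w: "\<forall>i\<le>n. \<forall>j\<le>n. \<bar>vars \<sigma> i j\<bar> \<le> U"
  shows "htr u W p_cost \<sigma> (\<lambda>\<tau>. \<forall>j<n. \<tau> 17 (int j) 0 = cst (vars \<sigma>) j)"
  unfolding p_cost_def cst_def
proof (rule htr_sums[where K = "30 * int n * U"])
  fix i j and \<tau> :: state assume ij: "i < n" "j < n" and fr: "\<And>k. k \<noteq> 1 \<Longrightarrow> k \<noteq> 2 \<Longrightarrow> k \<noteq> 17 \<Longrightarrow> \<tau> k = \<sigma> k"
    and c: "\<tau> 1 0 0 = int i" "\<tau> 2 0 0 = int j"
  have "ev u e_excess \<tau> = f i j"
    by (rule ev_e_excess) (use assms ij c fr in \<open>auto simp: has_dist_def\<close>)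
  then show "ev u (e_excess \<otimes> Rd 16 cI cJ) \<tau> = f i j * vars \<sigma> i j"
    using c fr by (simp add: vars_def)
next
  show "int n * (30 * int n * U) \<le> W"
  proof -
    have "int n * (30 * int n * U) = 30 * (int n ^ 2 * U)" by (simp add: power2_eq_square)
    moreover have "0 \<le> int n ^ 2 * U" using U_pos by simp
    ultimately show ?thesis using W_big(5) by linarith
  qed
next
  show "i < n \<Longrightarrow> j < n \<Longrightarrow> \<bar>f i j * vars \<sigma> i j\<bar> \<le> 30 * int n * U" for i j
    using w by (intro abs_fw_le) auto
qed (use u1 nW in auto)

definition close :: "int \<Rightarrow> (nat \<Rightarrow> int) \<Rightarrow> nat \<Rightarrow> nat \<Rightarrow> bool" where
  "close Z C i j \<longleftrightarrow> Z * d i j < 2 * Z + 4 * C j + 1"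

definition cluster_inv :: "int \<Rightarrow> (nat \<Rightarrow> int) \<Rightarrow> nat set \<Rightarrow> nat set \<Rightarrow> bool" where
  "cluster_inv Z C P R \<longleftrightarrow> R \<subseteq> P \<and> (\<forall>j\<in>P. \<exists>i\<in>R. C i \<le> C j \<and> close Z C i j) \<and>
     (\<forall>i\<in>R. \<forall>j\<in>R. i \<noteq> j \<longrightarrow> \<not> close Z C i j)"

text \<open>The test only uses the radius \<open>2 + 4 * C j\<close> of the new client. As
  \<open>C i \<le> C j\<close> in the order of treatment, a distance beyond it also exceeds the
  radius of \<open>i\<close>, which gives separation in both directions; for the same reason a
  covering \<open>i\<close> has no larger cost than \<open>j\<close>.\<close>

lemma cluster_inv_step:
  assumes inv: "cluster_inv Z C P R" and P: "P \<subseteq> {..<n}" and j: "j < n" "j \<notin> P"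
    and mono: "\<And>i. i \<in> P \<Longrightarrow> C i \<le> C j" and Z: "0 \<le> Z" "0 \<le> C j"
  shows "cluster_inv Z C (insert j P) (if \<exists>i\<in>R. close Z C i j then R else insert j R)"
proof (cases "\<exists>i\<in>R. close Z C i j")
  case True
  then show ?thesis using inv mono by (auto simp: cluster_inv_def)
next
  case False
  have "close Z C j j" using Z j d_self by (simp add: close_def)
  moreover have "\<not> close Z C j i" if "i \<in> R" for i
  proof -
    have i: "i \<in> P" "i < n" using that inv P by (auto simp: cluster_inv_def)
    have "\<not> close Z C i j" using False that by auto
    then show ?thesis using mono[OF i(1)] d_sym[OF i(2) j(1)] by (simp add: close_def)
  qed
  ultimately show ?thesis using inv False by (auto simp: cluster_inv_def)
qed

definition sel :: "nat \<Rightarrow> state \<Rightarrow> nat set" where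
  "sel a \<tau> = {i. i < n \<and> \<tau> a (int i) 0 = 1}"

definition ind :: "nat \<Rightarrow> state \<Rightarrow> bool" where
  "ind a \<tau> \<longleftrightarrow> (\<forall>i<n. \<tau> a (int i) 0 = of_bool (i \<in> sel a \<tau>))"

lemma sum_of_bool_nonneg: "finite A \<Longrightarrow> (\<Sum>i\<in>A. of_bool (P i) :: int) = 0 \<longleftrightarrow> (\<forall>i\<in>A. \<not> P i)"
  by (subst sum_nonneg_eq_0_iff) auto

text \<open>The clients treated before \<open>j\<close> in round \<open>v\<close>: an initial
  segment of the lexicographic order by value and index. It also serves for the choice of
  \<open>T\<close> and for the colouring.\<close>

definition before :: "(nat \<Rightarrow> int) \<Rightarrow> int \<Rightarrow> nat \<Rightarrow> nat set" where
  "before C v j = {i. i < n \<and> (C i < v \<or> (C i = v \<and> i < j))}"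

lemma before_Suc: "j < n \<Longrightarrow> before C v (Suc j) = (if C j = v then insert j (before C v j) else before C v j)"
  by (auto simp: before_def less_Suc_eq)

lemma before_next: "before C v n = before C (v + 1) 0"
  by (auto simp: before_def)

lemma htr_p_cluster:
  assumes hd: "has_dist \<sigma>" and C: "\<And>j. j < n \<Longrightarrow> \<sigma> 17 (int j) 0 = C j"
    and Cb: "\<And>j. j < n \<Longrightarrow> 0 \<le> C j \<and> C j \<le> 30 * int n ^ 2 * U"
    and Z: "0 \<le> vars \<sigma> n n" and R0: "\<And>i. \<sigma> 18 (int i) 0 = 0"
  shows "htr u W (p_cluster q) \<sigma> (\<lambda>\<tau>. ind 18 \<tau> \<and> cluster_inv (vars \<sigma> n n) C {..<n} (sel 18 \<tau>))"
proof -
  let ?Z = "vars \<sigma> n n"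
  define Vm where "Vm = 139968000000000 * q ^ 6 * n ^ 20 + 1"
  have Vm: "int Vm = 30 * int n ^ 2 * U + 1"
  proof -
    have "int n ^ 20 = int n ^ 2 * int n ^ 18" by (simp flip: power_add)
    then show ?thesis by (simp add: Vm_def U_def)
  qed
  have eV: "ev u (Cn (139968000000000 * int q ^ 6) \<otimes> epow eN 20 \<oplus> Cn 1) \<sigma> = int Vm"
    using u1 by (simp add: Vm_def)
  define J where "J = (\<lambda>v j \<tau>. ind 18 \<tau> \<and> cluster_inv ?Z C (before C v j) (sel 18 \<tau>))"
  let ?body = "(setS 8 (Cn 0) ;; For 1 eN (addS 8 (Ar 18 cI \<otimes> e_close))) ;;
      Asg 18 cJ (Cn 0) (Ar 18 cJ \<oplus> (Ar 17 cJ \<doteq> Sc 7) \<otimes> (Sc 8 \<doteq> Cn 0))"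
  have "htr u W (p_cluster q) \<sigma> (\<lambda>\<tau>. J (int Vm) 0 \<tau>)"
    unfolding p_cluster_def
  proof (rule htr_For[where I = "\<lambda>v. J (int v) 0", OF eV])
    show "int Vm \<le> W" unfolding Vm using W_big(5) U_pos n_pos
      mult_mono[of 1 "int n ^ 2" 1 U] one_le_power[OF n_pos, of 2] by simp
    have "before C 0 0 = {}" using Cb by (force simp: before_def)
    then show "J (int 0) 0 \<sigma>"
      using R0 by (auto simp: J_def ind_def sel_def cluster_inv_def)
    fix v \<tau>1 assume inv1: "J (int v) 0 \<tau>1"
      and f1: "\<And>k. k \<notin> insert 7 (mods (For 2 eN ?body)) \<Longrightarrow> \<tau>1 k = \<sigma> k"
    have "htr u W (For 2 eN ?body) (put \<tau>1 7 0 0 (int v)) (J (int v) n)"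
    proof (rule htr_For[where I = "J (int v)"])
      show "J (int v) 0 (put \<tau>1 7 0 0 (int v))" using inv1 by (simp add: J_def ind_def sel_def)
      fix j \<tau>2 assume j: "j < n" and inv2: "J (int v) j \<tau>2"
        and f2: "\<And>k. k \<notin> insert 2 (mods ?body) \<Longrightarrow> \<tau>2 k = put \<tau>1 7 0 0 (int v) k"
      let ?\<tau> = "put \<tau>2 2 0 0 (int j)"
      let ?R = "sel 18 \<tau>2"
      have fr: "?\<tau> k = \<sigma> k" if "k \<notin> {1, 2, 7, 8, 18}" for k
        using f2[of k] f1[of k] that by simp
      have v7: "?\<tau> 7 0 0 = int v" using f2[of 7] by (simp add: put_apply)
      have j2: "?\<tau> 2 0 0 = int j" by (simp add: put_apply)
      have R: "?\<tau> 18 (int i) 0 = of_bool (i \<in> ?R)" if "i < n" for i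
        using inv2 that by (simp add: J_def ind_def)
      show "htr u W ?body ?\<tau> (J (int v) (Suc j))"
      proof (rule htr_Sq)
        show "htr u W (setS 8 (Cn 0) ;; For 1 eN (addS 8 (Ar 18 cI \<otimes> e_close))) ?\<tau>
          (\<lambda>\<tau>. \<tau> 8 0 0 = (\<Sum>i<n. of_bool (i \<in> ?R \<and> close ?Z C i j)))"
        proof (rule htr_scalar_sum[where K = 1])
          fix i \<tau>3 assume i: "i < n" and t3: "\<And>k. k \<noteq> 1 \<Longrightarrow> k \<noteq> 8 \<Longrightarrow> \<tau>3 k = ?\<tau> k" "\<tau>3 1 0 0 = int i"
          have "\<tau>3 16 = \<sigma> 16" "\<tau>3 15 = \<sigma> 15" "\<tau>3 17 = \<sigma> 17" using t3(1) fr by simp_all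
          moreover have "\<tau>3 2 0 0 = int j" "\<tau>3 18 = ?\<tau> 18" using t3(1) j2 by simp_all
          ultimately show "ev u (Ar 18 cI \<otimes> e_close) \<tau>3 = of_bool (i \<in> ?R \<and> close ?Z C i j)"
            using R[OF i] t3(2) C[OF j] hd i j u1
            by (simp add: e_close_def close_def vars_def has_dist_def)
        qed (use u1 nW in auto)
        fix \<tau>4 assume t4: "\<tau>4 8 0 0 = (\<Sum>i<n. of_bool (i \<in> ?R \<and> close ?Z C i j))"
          "\<And>k. k \<notin> mods (setS 8 (Cn 0) ;; For 1 eN (addS 8 (Ar 18 cI \<otimes> e_close))) \<Longrightarrow> \<tau>4 k = ?\<tau> k"
        then have fr4: "\<tau>4 k = ?\<tau> k" if "k \<notin> {1, 8}" for k using that by simp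
        have z: "\<tau>4 8 0 0 = 0 \<longleftrightarrow> \<not> (\<exists>i\<in>?R. close ?Z C i j)"
          unfolding t4(1) by (subst sum_of_bool_nonneg) (auto simp: sel_def)
        define R' where "R' = (if C j = int v \<and> \<not> (\<exists>i\<in>?R. close ?Z C i j) then insert j ?R else ?R)"
        \<comment> \<open>A client is treated only in the round of its own cost and thus was not
          selected before; adding the test to its cell keeps the cell in
          \<open>{0, 1}\<close>.\<close>
        have jR: "C j = int v \<Longrightarrow> j \<notin> ?R"
          using inv2 by (auto simp: J_def cluster_inv_def before_def)
        define \<tau>5 where "\<tau>5 = put \<tau>4 18 (int j) 0 (of_bool (j \<in> R'))"
        have 18: "\<tau>5 18 (int i) 0 = of_bool (i \<in> R')" if "i < n" for i
          using R[OF that] fr4[of 18] by (auto simp: \<tau>5_def put_apply R'_def)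
        have sel5: "sel 18 \<tau>5 = R'"
        proof -
          have "R' \<subseteq> {..<n}" using j by (auto simp: sel_def R'_def)
          then show ?thesis using 18 by (auto simp: sel_def)
        qed
        have "J (int v) (Suc j) \<tau>5"
        proof -
          have inv: "cluster_inv ?Z C (before C (int v) j) ?R" using inv2 by (simp add: J_def)
          have "cluster_inv ?Z C (before C (int v) (Suc j)) R'"
          proof (cases "C j = int v")
            case True
            have "cluster_inv ?Z C (insert j (before C (int v) j)) (if \<exists>i\<in>?R. close ?Z C i j then ?R else insert j ?R)"
              by (rule cluster_inv_step[OF inv]) (use j True Z in \<open>auto simp: before_def\<close>)
            moreover have "R' = (if \<exists>i\<in>?R. close ?Z C i j then ?R else insert j ?R)"
              using True by (simp add: R'_def)
            ultimately show ?thesis using True j by (simp only: before_Suc if_True simp_thms)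
          next
            case False
            then show ?thesis using inv j by (simp add: before_Suc R'_def)
          qed
          then show ?thesis unfolding J_def ind_def sel5 using 18 by simp
        qed
        moreover have "ev u (Ar 18 cJ \<oplus> (Ar 17 cJ \<doteq> Sc 7) \<otimes> (Sc 8 \<doteq> Cn 0)) \<tau>4 = of_bool (j \<in> R')"
          using R[OF j] fr4[of 18] fr4[of 17] fr4[of 7] fr4[of 2] v7 j2 z C[OF j] jR fr[of 17] by (auto simp: R'_def)
        moreover have "ev u cJ \<tau>4 = int j" using fr4[of 2] j2 by simp
        ultimately show "htr u W (Asg 18 cJ (Cn 0) (Ar 18 cJ \<oplus> (Ar 17 cJ \<doteq> Sc 7) \<otimes> (Sc 8 \<doteq> Cn 0))) \<tau>4
          (J (int v) (Suc j))"
          using W_big by (intro htr_Asg) (simp_all add: \<tau>5_def)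
      qed
    qed (use u1 nW in auto)
    then show "htr u W (For 2 eN ?body) (put \<tau>1 7 0 0 (int v)) (J (int (Suc v)) 0)"
      by (rule htr_conseq) (simp add: J_def before_next add.commute)
  qed
  moreover have "before C (int Vm) 0 = {..<n}"
    using Cb unfolding Vm by (force simp: before_def)
  ultimately show ?thesis by (simp add: J_def)
qed

definition nearest :: "(nat \<Rightarrow> nat \<Rightarrow> bool) \<Rightarrow> nat \<Rightarrow> nat \<Rightarrow> int \<Rightarrow> int \<Rightarrow> bool" where
  "nearest mk m j a b \<longleftrightarrow> (a = 30 * int n + 1 \<and> b = 0 \<and> (\<forall>i<m. \<not> mk i j)) \<or>
     (\<exists>i<m. mk i j \<and> b = int i \<and> a = d i j \<and> (\<forall>i'<m. mk i' j \<longrightarrow> d i j \<le> d i' j))"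

lemma nearest_bounds:
  assumes "nearest mk m j a b" "m \<le> n" "j < n"
  shows "0 \<le> a \<and> a \<le> 30 * int n + 1 \<and> 0 \<le> b \<and> b \<le> int n"
  using assms(1) unfolding nearest_def
proof (elim disjE exE conjE)
  fix i assume "i < m" "b = int i" "a = d i j"
  then show ?thesis using d_nonneg[of i j] d_le[of i j] assms(2,3) by simp
qed simp

lemma nearest_Suc:
  assumes "nearest mk m j a b" "m < n" "j < n"
  shows "nearest mk (Suc m) j (if mk m j \<and> d m j < a then d m j else a)
    (if mk m j \<and> d m j < a then int m else b)"
  using assms(1) unfolding nearest_def
proof (elim disjE exE conjE)
  assume a: "a = 30 * int n + 1" "b = 0" "\<forall>i<m. \<not> mk i j"
  then have "d m j < a" using d_le[OF assms(2,3)] by simp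
  then show "((if mk m j \<and> d m j < a then d m j else a) = 30 * int n + 1 \<and>
      (if mk m j \<and> d m j < a then int m else b) = 0 \<and> (\<forall>i<Suc m. \<not> mk i j)) \<or>
    (\<exists>i<Suc m. mk i j \<and> (if mk m j \<and> d m j < a then int m else b) = int i \<and>
      (if mk m j \<and> d m j < a then d m j else a) = d i j \<and> (\<forall>i'<Suc m. mk i' j \<longrightarrow> d i j \<le> d i' j))"
    using a by (cases "mk m j") (auto simp: less_Suc_eq)
next
  fix i assume i: "i < m" "mk i j" "b = int i" "a = d i j" "\<forall>i'<m. mk i' j \<longrightarrow> d i j \<le> d i' j"
  show "((if mk m j \<and> d m j < a then d m j else a) = 30 * int n + 1 \<and>
      (if mk m j \<and> d m j < a then int m else b) = 0 \<and> (\<forall>i<Suc m. \<not> mk i j)) \<or>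
    (\<exists>i<Suc m. mk i j \<and> (if mk m j \<and> d m j < a then int m else b) = int i \<and>
      (if mk m j \<and> d m j < a then d m j else a) = d i j \<and> (\<forall>i'<Suc m. mk i' j \<longrightarrow> d i j \<le> d i' j))"
  proof (cases "mk m j \<and> d m j < a")
    case True
    have "d m j \<le> d i' j" if "i' < Suc m" "mk i' j" for i'
    proof (cases "i' = m")
      case False
      then have "d i j \<le> d i' j" using that i(5) by simp
      then show ?thesis using True i(4) by simp
    qed simp
    then show ?thesis using True by (intro disjI2 exI[of _ m]) auto
  next
    case False
    then have "d i j \<le> d i' j" if "i' < Suc m" "mk i' j" for i'
      using that i(4,5) by (cases "i' = m") auto
    then show ?thesis using False i by (intro disjI2 exI[of _ i]) auto
  qed
qed

lemma htr_p_nearest: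
  assumes hd: "has_dist \<sigma>" and AB: "15 < A" "15 < B" "A \<noteq> B"
    and msk: "\<And>i j \<tau>. i < n \<Longrightarrow> j < n \<Longrightarrow> (\<And>k. k \<notin> {1, 2, 8, A, B} \<Longrightarrow> \<tau> k = \<sigma> k) \<Longrightarrow> \<tau> 1 0 0 = int i
      \<Longrightarrow> \<tau> 2 0 0 = int j \<Longrightarrow> ev u msk \<tau> = of_bool (mk i j)"
  shows "htr u W (p_nearest msk A B) \<sigma> (\<lambda>\<tau>. \<forall>j<n. nearest mk n j (\<tau> A (int j) 0) (\<tau> B (int j) 0))"
proof -
  let ?body = "setS 8 (msk \<otimes> (eD \<lless> Ar A cJ)) ;;
       Asg B cJ (Cn 0) (Ar B cJ \<oplus> Sc 8 \<otimes> (cI \<ominus> Ar B cJ)) ;;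
       Asg A cJ (Cn 0) (Ar A cJ \<oplus> Sc 8 \<otimes> (eD \<ominus> Ar A cJ))"
  let ?outer = "Asg A cJ (Cn 0) (Cn 30 \<otimes> eN \<oplus> Cn 1) ;; Asg B cJ (Cn 0) (Cn 0) ;; For 1 eN ?body"
  define J where "J = (\<lambda>j (\<tau> :: state). \<forall>j'<j. nearest mk n j' (\<tau> A (int j') 0) (\<tau> B (int j') 0))"
  have "htr u W (For 2 eN ?outer) \<sigma> (J n)"
  proof (rule htr_For[where I = J])
    fix j \<tau> assume j: "j < n" and inv: "J j \<tau>" and frame: "\<And>k. k \<notin> insert 2 (mods ?outer) \<Longrightarrow> \<tau> k = \<sigma> k"
    let ?\<tau> = "put \<tau> 2 0 0 (int j)"
    have fr: "?\<tau> k = \<sigma> k" if "k \<notin> {1, 2, 8, A, B}" for k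
      using frame[of k] that by simp
    define K where "K = (\<lambda>i (\<tau>' :: state). \<tau>' 2 0 0 = int j \<and> (\<forall>j'<j. \<tau>' A (int j') 0 = \<tau> A (int j') 0 \<and> \<tau>' B (int j') 0 = \<tau> B (int j') 0)
      \<and> nearest mk i j (\<tau>' A (int j) 0) (\<tau>' B (int j) 0))"
    have "htr u W ?outer ?\<tau> (K n)"
    proof (rule htr_Sq)
      show "htr u W (Asg A cJ (Cn 0) (Cn 30 \<otimes> eN \<oplus> Cn 1)) ?\<tau>
        (\<lambda>\<tau>1. \<tau>1 2 0 0 = int j \<and> (\<forall>j'<j. \<tau>1 A (int j') 0 = \<tau> A (int j') 0) \<and> \<tau>1 A (int j) 0 = 30 * int n + 1)"
        using AB u1 W_big(2) n_pos by (intro htr_Asg) (auto simp: put_apply)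
      fix \<tau>1 assume t1: "\<tau>1 2 0 0 = int j \<and> (\<forall>j'<j. \<tau>1 A (int j') 0 = \<tau> A (int j') 0) \<and> \<tau>1 A (int j) 0 = 30 * int n + 1"
        "\<And>k. k \<notin> mods (Asg A cJ (Cn 0) (Cn 30 \<otimes> eN \<oplus> Cn 1)) \<Longrightarrow> \<tau>1 k = ?\<tau> k"
      show "htr u W (Asg B cJ (Cn 0) (Cn 0) ;; For 1 eN ?body) \<tau>1 (K n)"
      proof (rule htr_Sq)
        show "htr u W (Asg B cJ (Cn 0) (Cn 0)) \<tau>1 (K 0)"
          using t1(1) t1(2)[of B] AB W_big(3)
          by (intro htr_Asg) (auto simp: put_apply K_def nearest_def)
        fix \<tau>2 assume k2: "K 0 \<tau>2" and t2: "\<And>k. k \<notin> mods (Asg B cJ (Cn 0) (Cn 0)) \<Longrightarrow> \<tau>2 k = \<tau>1 k"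
        show "htr u W (For 1 eN ?body) \<tau>2 (K n)"
        proof (rule htr_For[where I = K])
          fix i \<tau>3 assume i: "i < n" and k3: "K i \<tau>3" and t3: "\<And>k. k \<notin> insert 1 (mods ?body) \<Longrightarrow> \<tau>3 k = \<tau>2 k"
          let ?\<tau>3 = "put \<tau>3 1 0 0 (int i)"
          have fr3: "?\<tau>3 k = \<sigma> k" if "k \<notin> {1, 2, 8, A, B}" for k
            using t3[of k] t2[of k] t1(2)[of k] fr[of k] that by simp
          have c: "?\<tau>3 1 0 0 = int i" "?\<tau>3 2 0 0 = int j" using k3 by (simp_all add: K_def put_apply)
          have mv: "ev u msk ?\<tau>3 = of_bool (mk i j)" by (rule msk[OF i j fr3 c])
          have dv: "?\<tau>3 15 (int i) (int j) = d i j" using fr3[of 15] hd i j AB by (simp add: has_dist_def)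
          let ?a = "\<tau>3 A (int j) 0" and ?b = "\<tau>3 B (int j) 0"
          have nr: "nearest mk i j ?a ?b" using k3 by (simp add: K_def)
          have ab: "0 \<le> ?a" "?a \<le> 30 * int n + 1" "0 \<le> ?b" "?b \<le> int n"
            using nearest_bounds[OF nr] i j by auto
          let ?c = "mk i j \<and> d i j < ?a"
          have nr': "nearest mk (Suc i) j (if ?c then d i j else ?a) (if ?c then int i else ?b)"
            by (rule nearest_Suc[OF nr i j])
          show "htr u W ?body ?\<tau>3 (K (Suc i))"
          proof (rule htr_Sq[where P = "\<lambda>\<tau>. \<tau> = put ?\<tau>3 8 0 0 (of_bool ?c)"])
            show "htr u W (setS 8 (msk \<otimes> (eD \<lless> Ar A cJ))) ?\<tau>3 (\<lambda>\<tau>. \<tau> = put ?\<tau>3 8 0 0 (of_bool ?c))"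
              using c mv dv AB W_big(3) by (intro htr_Asg) auto
            fix \<tau>4 assume t4: "\<tau>4 = put ?\<tau>3 8 0 0 (of_bool ?c)"
            have v4: "\<tau>4 A = \<tau>3 A" "\<tau>4 B = \<tau>3 B" "\<tau>4 8 0 0 = of_bool ?c" "\<tau>4 1 0 0 = int i" "\<tau>4 2 0 0 = int j"
              "\<tau>4 15 (int i) (int j) = d i j"
              using t4 AB c dv by (auto simp: put_apply)
            show "htr u W (Asg B cJ (Cn 0) (Ar B cJ \<oplus> Sc 8 \<otimes> (cI \<ominus> Ar B cJ)) ;;
                Asg A cJ (Cn 0) (Ar A cJ \<oplus> Sc 8 \<otimes> (eD \<ominus> Ar A cJ))) \<tau>4 (K (Suc i))"
            proof (rule htr_Sq[where P = "\<lambda>\<tau>. \<tau> = put \<tau>4 B (int j) 0 (if ?c then int i else ?b)"])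
              show "htr u W (Asg B cJ (Cn 0) (Ar B cJ \<oplus> Sc 8 \<otimes> (cI \<ominus> Ar B cJ))) \<tau>4
                 (\<lambda>\<tau>. \<tau> = put \<tau>4 B (int j) 0 (if ?c then int i else ?b))"
                using v4 ab i nW by (intro htr_Asg) auto
              fix \<tau>5 assume t5: "\<tau>5 = put \<tau>4 B (int j) 0 (if ?c then int i else ?b)"
              have v5: "\<tau>5 A = \<tau>3 A" "\<tau>5 8 0 0 = of_bool ?c" "\<tau>5 1 0 0 = int i" "\<tau>5 2 0 0 = int j"
                "\<tau>5 15 (int i) (int j) = d i j" "\<tau>5 B = (\<lambda>a b. if a = int j \<and> b = 0 then if ?c then int i else ?b else \<tau>3 B a b)"
                using t5 AB v4 by (auto simp: put_apply put_same fun_eq_iff)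
              show "htr u W (Asg A cJ (Cn 0) (Ar A cJ \<oplus> Sc 8 \<otimes> (eD \<ominus> Ar A cJ))) \<tau>5 (K (Suc i))"
              proof (rule htr_Asg)
                show "\<bar>ev u (Ar A cJ \<oplus> Sc 8 \<otimes> (eD \<ominus> Ar A cJ)) \<tau>5\<bar> \<le> W"
                  using v5 ab d_le[OF i j] d_nonneg[OF i j] W_big(2) n_pos by auto
                have e: "ev u cJ \<tau>5 = int j" "ev u (Cn 0) \<tau>5 = 0"
                  "ev u (Ar A cJ \<oplus> Sc 8 \<otimes> (eD \<ominus> Ar A cJ)) \<tau>5 = (if ?c then d i j else ?a)"
                  using v5 by auto
                show "K (Suc i) (put \<tau>5 A (ev u cJ \<tau>5) (ev u (Cn 0) \<tau>5) (ev u (Ar A cJ \<oplus> Sc 8 \<otimes> (eD \<ominus> Ar A cJ)) \<tau>5))"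
                  unfolding e using k3 v5 AB nr' by (auto simp: K_def put_apply)
              qed
            qed
          qed
        qed (use k2 u1 nW in auto)
      qed
    qed
    then show "htr u W ?outer ?\<tau> (J (Suc j))"
      by (rule htr_conseq) (use inv in \<open>auto simp: K_def J_def less_Suc_eq\<close>)
  qed (use u1 nW in \<open>auto simp: J_def\<close>)
  then show ?thesis by (simp add: p_nearest_def J_def)
qed

end

section \<open>Choosing the centers\<close>

lemma htr_Asg_eq:
  assumes "ev u a \<sigma> = a'" "ev u b \<sigma> = b'" "ev u e \<sigma> = v" "\<bar>v\<bar> \<le> W" "Q (put \<sigma> k a' b' v)"
  shows "htr u W (Asg k a b e) \<sigma> Q"
  using assms by (intro htr_Asg) auto

lemma htr_Asg_Sq:
  assumes "ev u a \<sigma> = a'" "ev u b \<sigma> = b'" "ev u e \<sigma> = v" "\<bar>v\<bar> \<le> W" "htr u W c (put \<sigma> k a' b' v) Q"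
  shows "htr u W (Asg k a b e ;; c) \<sigma> Q"
  using assms by (simp add: htr_def)

definition e_value :: ex where
  "e_value = Ar 21 cJ \<otimes> ((Ar 22 cJ \<ominus> Cn 2) \<otimes> (Cn 2 \<lless> Ar 22 cJ))"

text \<open>Again a loop over all values, now decreasing: round \<open>s\<close> treats value
  \<open>40 * n\<^sup>2 - 1 - s\<close>. A value is at most \<open>n\<close> clients times
  \<open>30 * n\<close>, hence below \<open>40 * n\<^sup>2\<close>.\<close>

definition p_top :: cmd where
  "p_top = For 7 (Cn 40 \<otimes> epow eN 2) (For 2 eN
     (setS 8 (Ar 18 cJ \<otimes> (Ar 24 cJ \<doteq> Cn 0) \<otimes> (e_value \<doteq> (Cn 40 \<otimes> epow eN 2 \<ominus> Cn 1 \<ominus> Sc 7))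
        \<otimes> (Sc 11 \<lless> Cn 2 \<otimes> eK \<ominus> Sc 10)) ;;
      Asg 24 cJ (Cn 0) (Ar 24 cJ \<oplus> Cn 3 \<otimes> Sc 8) ;;
      addS 11 (Sc 8)))"

text \<open>Colours: \<open>0\<close> none, \<open>1\<close> and \<open>2\<close> the two classes of representatives of which one will be opened,
  \<open>3\<close> representatives that are opened in any case.\<close>

definition p_colour :: cmd where
  "p_colour = For 7 (Cn 30 \<otimes> eN \<oplus> Cn 2) (For 2 eN
     (setS 8 (Ar 18 cJ \<otimes> (Ar 24 cJ \<doteq> Cn 0) \<otimes> (Ar 22 cJ \<doteq> Sc 7)) ;;
      setS 9 (Ar 24 (Ar 23 cJ)) ;;
      Asg 24 cJ (Cn 0) (Ar 24 cJ \<oplus> Sc 8 \<otimes> (Cn 1 \<oplus> (Sc 9 \<doteq> Cn 1))) ;;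
      Asg 24 (Ar 23 cJ) (Cn 0) (Ar 24 (Ar 23 cJ) \<oplus> Sc 8 \<otimes> ((Sc 9 \<doteq> Cn 0) \<otimes> Cn 2))))"

text \<open>\<open>1\<close> plus the test whether class \<open>2\<close> is smaller is the colour
  of a smaller class, which is opened along with colour \<open>3\<close>.\<close>

definition p_open :: cmd where
  "p_open = ((setS 12 (Cn 0) ;; For 2 eN (addS 12 (Ar 24 cJ \<doteq> Cn 1))) ;;
     (setS 13 (Cn 0) ;; For 2 eN (addS 13 (Ar 24 cJ \<doteq> Cn 2))) ;;
     For 2 eN (Asg 25 cJ (Cn 0) ((Ar 24 cJ \<doteq> Cn 3) \<oplus> (Ar 24 cJ \<doteq> Cn 1 \<oplus> (Sc 13 \<lless> Sc 12)))) ;;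
     (setS 14 (Cn 0) ;; For 2 eN (addS 14 (Ar 25 cJ))))"

text \<open>A solution must have exactly \<open>k\<close> centers; additional ones never increase
  the distance to a nearest center.\<close>

definition p_pad :: cmd where
  "p_pad = For 2 eN (setS 8 ((Sc 14 \<lless> eK) \<otimes> (Cn 1 \<ominus> Ar 25 cJ)) ;;
     Asg 25 cJ (Cn 0) (Ar 25 cJ \<oplus> Sc 8) ;; addS 14 (Sc 8))"

definition p_output :: cmd where
  "p_output = (setS 0 (Cn 2 \<otimes> eN) ;;
     For 2 eN (Asg 0 (cJ \<oplus> Cn 1) (Cn 0) (Ar 25 cJ)) ;;
     For 2 eN (Asg 0 (cJ \<oplus> eN \<oplus> Cn 1) (Cn 0) (Ar 27 cJ)))"

context centrum_program
begin

lemma sum_of_bool_lessThan: "(\<Sum>i<m::nat. of_bool (P i) :: int) = int (card {i. i < m \<and> P i})"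
  by (simp add: Int_def)

lemma before_none: "(\<And>i. i < n \<Longrightarrow> 0 \<le> C i) \<Longrightarrow> before C 0 0 = {}"
  by (fastforce simp: before_def)

lemma before_all: "(\<And>i. i < n \<Longrightarrow> C i < v) \<Longrightarrow> before C v 0 = {..<n}"
  by (auto simp: before_def)

definition top_inv :: "(nat \<Rightarrow> int) \<Rightarrow> nat \<Rightarrow> nat set \<Rightarrow> nat set \<Rightarrow> bool" where
  "top_inv C K P T \<longleftrightarrow> T \<subseteq> P \<and> card T \<le> K \<and> (P \<subseteq> T \<or> card T = K) \<and> (\<forall>i\<in>T. \<forall>j\<in>P - T. C i \<le> C j)"

lemma top_inv_step:
  assumes "top_inv C K P T" "finite P" "j \<notin> P" "\<And>i. i \<in> P \<Longrightarrow> C i \<le> C j"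
  shows "top_inv C K (insert j P) (if card T < K then insert j T else T)"
proof -
  have "finite T" "j \<notin> T" using assms finite_subset by (auto simp: top_inv_def)
  then show ?thesis using assms by (auto simp: top_inv_def)
qed

lemma htr_p_top:
  assumes R: "R \<subseteq> {..<n}" "card R \<le> 2 * k" and R18: "\<And>i. i < n \<Longrightarrow> \<sigma> 18 (int i) 0 = of_bool (i \<in> R)"
    and M: "\<sigma> 10 0 0 = int (card R)" and cnt: "\<sigma> 11 0 0 = 0" and col: "\<And>i. \<sigma> 24 (int i) 0 = 0"
    and v: "\<And>j. j < n \<Longrightarrow> \<sigma> 21 (int j) 0 * max 0 (\<sigma> 22 (int j) 0 - 2) = v j"
    and vb: "\<And>j. j < n \<Longrightarrow> 0 \<le> v j \<and> v j < 40 * int n ^ 2"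
  shows "htr u W p_top \<sigma> (\<lambda>\<tau>. \<exists>T\<subseteq>R. card T = min (card R) (2 * k - card R) \<and>
     (\<forall>i<n. \<tau> 24 (int i) 0 = (if i \<in> T then 3 else 0)) \<and> (\<forall>i\<in>T. \<forall>j\<in>R - T. v j \<le> v i))"
proof -
  \<comment> \<open>Reversing the values lets the increasing order of \<open>before\<close> serve
    for a greedy choice: while \<open>T\<close> is not full it contains everything seen, and later
    elements are no better.\<close>
  define C where "C = (\<lambda>i. 40 * int n ^ 2 - 1 - v i)"
  let ?K = "2 * k - card R"
  have K: "int ?K = 2 * int k - int (card R)" using R(2) by simp
  define J where "J = (\<lambda>s j (\<tau> :: state). \<exists>T. top_inv C ?K (R \<inter> before C s j) T \<and>
     (\<forall>i<n. \<tau> 24 (int i) 0 = (if i \<in> T then 3 else 0)) \<and> \<tau> 11 0 0 = int (card T))"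
  let ?body = "setS 8 (Ar 18 cJ \<otimes> (Ar 24 cJ \<doteq> Cn 0) \<otimes> (e_value \<doteq> (Cn 40 \<otimes> epow eN 2 \<ominus> Cn 1 \<ominus> Sc 7))
        \<otimes> (Sc 11 \<lless> Cn 2 \<otimes> eK \<ominus> Sc 10)) ;;
      Asg 24 cJ (Cn 0) (Ar 24 cJ \<oplus> Cn 3 \<otimes> Sc 8) ;; addS 11 (Sc 8)"
  have "0 \<le> int n ^ 2" by simp
  then have W40: "40 * int n ^ 2 \<le> W" using W_big(1) by linarith
  have "htr u W p_top \<sigma> (J (int (40 * n ^ 2)) 0)"
    unfolding p_top_def
  proof (rule htr_For[where I = "\<lambda>s. J (int s) 0" and m = "40 * n ^ 2"])
    have "before C 0 0 = {}"
    proof (rule before_none)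
      show "0 \<le> C i" if "i < n" for i using vb[OF that] by (simp add: C_def)
    qed
    then show "J (int 0) 0 \<sigma>" using col cnt by (auto simp: J_def top_inv_def intro!: exI[of _ "{}"])
    fix s \<tau>1 assume s: "s < 40 * n ^ 2" and inv1: "J (int s) 0 \<tau>1"
      and f1: "\<And>k. k \<notin> insert 7 (mods (For 2 eN ?body)) \<Longrightarrow> \<tau>1 k = \<sigma> k"
    have "htr u W (For 2 eN ?body) (put \<tau>1 7 0 0 (int s)) (J (int s) n)"
    proof (rule htr_For[where I = "J (int s)"])
      show "J (int s) 0 (put \<tau>1 7 0 0 (int s))" using inv1 by (simp add: J_def)
      fix j \<tau>2 assume j: "j < n" and inv2: "J (int s) j \<tau>2"
        and f2: "\<And>k. k \<notin> insert 2 (mods ?body) \<Longrightarrow> \<tau>2 k = put \<tau>1 7 0 0 (int s) k"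
      let ?\<tau> = "put \<tau>2 2 0 0 (int j)"
      have fr: "\<tau>2 k = \<sigma> k" if "k \<notin> {2, 7, 8, 11, 24}" for k
        using f2[of k] f1[of k] that by simp
      have s7: "\<tau>2 7 0 0 = int s" using f2[of 7] by (simp add: put_apply)
      have j2: "?\<tau> 2 0 0 = int j" by (simp add: put_apply)
      obtain T where T: "top_inv C ?K (R \<inter> before C (int s) j) T"
        "\<And>i. i < n \<Longrightarrow> \<tau>2 24 (int i) 0 = (if i \<in> T then 3 else 0)" "\<tau>2 11 0 0 = int (card T)"
        using inv2 by (auto simp: J_def)
      have Tn: "T \<subseteq> {..<n}" using T(1) R by (auto simp: top_inv_def)
      have fT: "finite T" using Tn finite_subset by blast
      have cT: "card T \<le> n" using card_mono[OF _ Tn] by simp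
      have vj: "ev u e_value ?\<tau> = v j"
        using v[OF j] j2 by (cases "2 < \<sigma> 22 (int j) 0") (simp_all add: e_value_def fr)
      define c where "c \<longleftrightarrow> j \<in> R \<and> C j = int s \<and> card T < ?K"
      have jT: "j \<notin> T" if "C j = int s" using T(1) that by (auto simp: top_inv_def before_def)
      have ce: "ev u (Ar 18 cJ \<otimes> (Ar 24 cJ \<doteq> Cn 0) \<otimes> (e_value \<doteq> (Cn 40 \<otimes> epow eN 2 \<ominus> Cn 1 \<ominus> Sc 7))
        \<otimes> (Sc 11 \<lless> Cn 2 \<otimes> eK \<ominus> Sc 10)) ?\<tau> = of_bool c"
      proof -
        have "v j = 40 * int n ^ 2 - 1 - int s \<longleftrightarrow> C j = int s" by (auto simp: C_def)
        moreover have "int (card T) < 2 * int k - int (card R) \<longleftrightarrow> card T < ?K" using K by linarith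
        ultimately show ?thesis
          using vj R18[OF j] T(2)[OF j] T(3) M j2 s7 u1 u2 jT by (auto simp: fr c_def)
      qed
      let ?T = "if c then insert j T else T"
      have J': "J (int s) (Suc j) \<tau>'" if "\<And>i. i < n \<Longrightarrow> \<tau>' 24 (int i) 0 = (if i \<in> ?T then 3 else 0)"
        "\<tau>' 11 0 0 = int (card ?T)" for \<tau>'
      proof -
        have "top_inv C ?K (R \<inter> before C (int s) (Suc j)) ?T"
        proof (cases "j \<in> R \<and> C j = int s")
          case True
          have "top_inv C ?K (insert j (R \<inter> before C (int s) j)) (if card T < ?K then insert j T else T)"
            by (rule top_inv_step[OF T(1)]) (use True in \<open>auto simp: before_def\<close>)
          moreover have "insert j (R \<inter> before C (int s) j) = R \<inter> before C (int s) (Suc j)"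
            using True j by (auto simp: before_Suc)
          ultimately show ?thesis using True by (simp only: c_def simp_thms)
        next
          case False
          then have "R \<inter> before C (int s) (Suc j) = R \<inter> before C (int s) j" using j by (auto simp: before_Suc)
          then show ?thesis using T(1) False by (auto simp: c_def)
        qed
        then show ?thesis using that by (auto simp: J_def)
      qed
      show "htr u W ?body ?\<tau> (J (int s) (Suc j))"
      proof (rule htr_Asg_Sq[OF refl refl ce])
        let ?\<tau>3 = "put ?\<tau> 8 (ev u (Cn 0) ?\<tau>) (ev u (Cn 0) ?\<tau>) (of_bool c)"
        have 3: "?\<tau>3 2 0 0 = int j" "?\<tau>3 8 0 0 = of_bool c" "?\<tau>3 24 = \<tau>2 24" "?\<tau>3 11 = \<tau>2 11"
          by (simp_all add: put_apply)
        show "htr u W (Asg 24 cJ (Cn 0) (Ar 24 cJ \<oplus> Cn 3 \<otimes> Sc 8) ;; addS 11 (Sc 8)) ?\<tau>3 (J (int s) (Suc j))"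
        proof (rule htr_Asg_Sq[where a' = "int j" and b' = 0 and v = "if j \<in> ?T then 3 else 0"])
          show "ev u (Ar 24 cJ \<oplus> Cn 3 \<otimes> Sc 8) ?\<tau>3 = (if j \<in> ?T then 3 else 0)"
            using 3 T(2)[OF j] jT by (auto simp: c_def)
          let ?\<tau>4 = "put ?\<tau>3 24 (int j) 0 (if j \<in> ?T then 3 else 0)"
          show "htr u W (addS 11 (Sc 8)) ?\<tau>4 (J (int s) (Suc j))"
          proof (rule htr_Asg_eq[where v = "int (card ?T)" and a' = 0 and b' = 0])
            show "ev u (Sc 11 \<oplus> Sc 8) ?\<tau>4 = int (card ?T)"
              using 3 T(3) jT fT by (simp add: c_def put_apply)
            show "\<bar>int (card ?T)\<bar> \<le> W" using cT W_big(2) n_pos fT by (simp add: card_insert_if)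
            show "J (int s) (Suc j) (put ?\<tau>4 11 0 0 (int (card ?T)))"
              by (rule J') (use T(2) 3 j in \<open>auto simp: put_apply\<close>)
          qed simp_all
        qed (use 3 W_big(3) in auto)
      qed (use W_big(3) in auto)
    qed (use u1 nW in auto)
    then show "htr u W (For 2 eN ?body) (put \<tau>1 7 0 0 (int s)) (J (int (Suc s)) 0)"
      by (rule htr_conseq) (simp add: J_def before_next add.commute)
  qed (use u1 W40 in auto)
  then show ?thesis
  proof (rule htr_conseq)
    fix \<tau> assume "J (int (40 * n ^ 2)) 0 \<tau>"
    moreover have "before C (int (40 * n ^ 2)) 0 = {..<n}"
    proof (rule before_all)
      show "C i < int (40 * n ^ 2)" if "i < n" for i using vb[OF that] by (simp add: C_def)
    qed
    then have "R \<inter> before C (int (40 * n ^ 2)) 0 = R" using R by auto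
    ultimately obtain T where T: "top_inv C ?K R T" "\<forall>i<n. \<tau> 24 (int i) 0 = (if i \<in> T then 3 else 0)"
      by (auto simp: J_def)
    have fR: "finite R" using R finite_subset by blast
    have "card T = min (card R) ?K"
    proof (cases "R \<subseteq> T")
      case True
      then have "T = R" using T(1) by (auto simp: top_inv_def)
      then show ?thesis using T(1) by (simp add: top_inv_def)
    next
      case False
      then have "card T = ?K" "T \<subseteq> R" using T(1) by (auto simp: top_inv_def)
      then show ?thesis using card_mono[OF fR, of T] by simp
    qed
    then show "\<exists>T\<subseteq>R. card T = min (card R) (2 * k - card R) \<and>
     (\<forall>i<n. \<tau> 24 (int i) 0 = (if i \<in> T then 3 else 0)) \<and> (\<forall>i\<in>T. \<forall>j\<in>R - T. v j \<le> v i)"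
      using T by (intro exI[of _ T]) (auto simp: top_inv_def C_def)
  qed
qed

text \<open>\<open>3 - c i\<close> exchanges the two classes. The second clause ensures that,
  whichever class is opened, an element left closed has an open one within \<open>r\<close>;
  \<open>P\<close> collects the elements already treated.\<close>

definition colour_inv :: "nat set \<Rightarrow> nat set \<Rightarrow> (nat \<Rightarrow> int) \<Rightarrow> nat set \<Rightarrow> (nat \<Rightarrow> int) \<Rightarrow> bool" where
  "colour_inv R T r P c \<longleftrightarrow> (\<forall>i<n. c i \<in> {0, 1, 2, 3} \<and> (c i \<noteq> 0 \<longrightarrow> i \<in> R) \<and> (c i = 3 \<longleftrightarrow> i \<in> T)) \<and>
     (\<forall>i\<in>R. c i = 1 \<or> c i = 2 \<longrightarrow> (\<exists>i'\<in>R. d i' i \<le> r i \<and> (c i' = 3 \<or> c i' = 3 - c i))) \<and>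
     (\<forall>i\<in>P. c i \<noteq> 0)"

lemma colour_inv_init:
  assumes R: "R \<subseteq> {..<n}" "T \<subseteq> R" and c: "\<And>i. i < n \<Longrightarrow> c i = (if i \<in> T then 3 else 0)"
  shows "colour_inv R T r {} c"
proof -
  have "c i \<noteq> 1 \<and> c i \<noteq> 2" if "i \<in> R" for i
  proof -
    have "i < n" using that R by auto
    then show ?thesis using c[of i] by simp
  qed
  moreover have "c i \<in> {0, 1, 2, 3} \<and> (c i \<noteq> 0 \<longrightarrow> i \<in> R) \<and> (c i = 3 \<longleftrightarrow> i \<in> T)" if "i < n" for i
    using c[OF that] R by auto
  ultimately show ?thesis unfolding colour_inv_def by blast
qed

lemma colour_inv_cong:
  assumes inv: "colour_inv R T r P c" and c: "\<And>i. i < n \<Longrightarrow> c' i = c i" and PR: "P \<subseteq> R" "R \<subseteq> {..<n}"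
  shows "colour_inv R T r P c'"
proof -
  have cR: "c' i = c i" if "i \<in> R" for i using that c PR by auto
  have "\<exists>i'\<in>R. d i' i \<le> r i \<and> (c' i' = 3 \<or> c' i' = 3 - c' i)" if i: "i \<in> R" "c' i = 1 \<or> c' i = 2" for i
  proof -
    have "c i = 1 \<or> c i = 2" using i cR by simp
    then obtain i' where "i' \<in> R" "d i' i \<le> r i" "c i' = 3 \<or> c i' = 3 - c i"
      using inv i(1) unfolding colour_inv_def by blast
    then show ?thesis using cR i(1) by (intro bexI[of _ i']) simp_all
  qed
  moreover have "c' i \<in> {0, 1, 2, 3} \<and> (c' i \<noteq> 0 \<longrightarrow> i \<in> R) \<and> (c' i = 3 \<longleftrightarrow> i \<in> T)" if "i < n" for i
    using inv that unfolding c[OF that] colour_inv_def by blast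
  moreover have "c' i \<noteq> 0" if "i \<in> P" for i
  proof -
    have "c i \<noteq> 0" using inv that unfolding colour_inv_def by blast
    then show ?thesis using cR that PR by auto
  qed
  ultimately show ?thesis unfolding colour_inv_def by blast
qed

text \<open>The order by increasing \<open>r\<close> prevents conflicts. If \<open>m\<close> has a
  colour, \<open>j\<close> takes \<open>1\<close>, or \<open>2\<close> if \<open>m\<close> has
  \<open>1\<close>. Otherwise \<open>m\<close> has not been treated, so
  \<open>r j \<le> r m\<close>; with \<open>r m \<le> d j m \<le> r j\<close> this makes
  \<open>j\<close> a nearest neighbour of \<open>m\<close> as well, and the two get opposite colours
  at once.\<close>

lemma colour_inv_step:
  assumes inv: "colour_inv R T r P c" and R: "R \<subseteq> {..<n}" and j: "j \<in> R" "c j = 0"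
    and m: "m \<in> R" "m \<noteq> j" "d m j \<le> r j" and r_le: "\<And>i. i \<in> R \<Longrightarrow> i \<noteq> m \<Longrightarrow> r m \<le> d i m"
    and P: "P \<subseteq> R" "\<And>i. i \<in> R \<Longrightarrow> r i < r j \<Longrightarrow> i \<in> P"
  shows "colour_inv R T r (insert j P) (\<lambda>i. if i = j then 1 + of_bool (c m = 1) else if i = m \<and> c m = 0 then 2 else c i)"
    (is "colour_inv R T r _ ?c")
proof -
  have n: "j < n" "m < n" using R j m by auto
  have keep: "?c i = c i" if "c i \<noteq> 0" for i using that j by auto
  have cm: "c m \<in> {0, 1, 2, 3}" using inv n unfolding colour_inv_def by blast
  have 1: "\<exists>i'\<in>R. d i' i \<le> r i \<and> (?c i' = 3 \<or> ?c i' = 3 - ?c i)" if i: "i \<in> R" "?c i = 1 \<or> ?c i = 2" for i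
  proof -
    consider "i = j" | "i \<noteq> j" "i = m" "c m = 0" | "c i \<noteq> 0" using i(2) by (auto split: if_splits)
    then show ?thesis
    proof cases
      case 1
      then show ?thesis using m cm by (intro bexI[of _ m]) auto
    next
      case 2
      have "m \<notin> P" using inv 2(3) unfolding colour_inv_def by blast
      then have "r j \<le> r m" using P(2)[OF m(1)] by linarith
      then have "d j m \<le> r m" using m d_sym[OF n] r_le[OF j(1)] by simp
      then show ?thesis using 2 j by (intro bexI[of _ j]) auto
    next
      case 3
      then have "c i = 1 \<or> c i = 2" using i(2) keep by auto
      then obtain i' where i': "i' \<in> R" "d i' i \<le> r i" "c i' = 3 \<or> c i' = 3 - c i"
        using inv i(1) unfolding colour_inv_def by blast
      moreover have "c i' \<noteq> 0" using i'(3) \<open>c i = 1 \<or> c i = 2\<close> by auto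
      ultimately show ?thesis using keep 3 by (intro bexI[of _ i']) auto
    qed
  qed
  have 2: "?c i \<in> {0, 1, 2, 3} \<and> (?c i \<noteq> 0 \<longrightarrow> i \<in> R) \<and> (?c i = 3 \<longleftrightarrow> i \<in> T)" if "i < n" for i
  proof -
    have "c i \<in> {0, 1, 2, 3} \<and> (c i \<noteq> 0 \<longrightarrow> i \<in> R) \<and> (c i = 3 \<longleftrightarrow> i \<in> T)"
      using inv that unfolding colour_inv_def by blast
    then show ?thesis using j m by auto
  qed
  have "\<forall>i\<in>P. c i \<noteq> 0" using inv unfolding colour_inv_def by blast
  then have 3: "\<forall>i\<in>insert j P. ?c i \<noteq> 0" by auto
  show ?thesis unfolding colour_inv_def using 1 2 3 by blast
qed

lemma htr_p_colour:
  assumes R: "R \<subseteq> {..<n}" "T \<subseteq> R" and R18: "\<And>i. i < n \<Longrightarrow> \<sigma> 18 (int i) 0 = of_bool (i \<in> R)"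
    and col: "\<And>i. i < n \<Longrightarrow> \<sigma> 24 (int i) 0 = (if i \<in> T then 3 else 0)"
    and r: "\<And>i. i < n \<Longrightarrow> \<sigma> 22 (int i) 0 = r i \<and> 0 \<le> r i \<and> r i \<le> 30 * int n + 1"
    and N: "\<And>i. i < n \<Longrightarrow> \<sigma> 23 (int i) 0 = int (N i) \<and> N i < n"
    and NR: "\<And>j. j \<in> R - T \<Longrightarrow> N j \<in> R \<and> N j \<noteq> j \<and> d (N j) j = r j"
    and r_le: "\<And>i j. i \<in> R \<Longrightarrow> j \<in> R \<Longrightarrow> i \<noteq> j \<Longrightarrow> r j \<le> d i j"
  shows "htr u W p_colour \<sigma> (\<lambda>\<tau>. colour_inv R T r R (\<lambda>i. \<tau> 24 (int i) 0))"
proof -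
  define J where "J = (\<lambda>s j (\<tau> :: state). colour_inv R T r (R \<inter> before r s j) (\<lambda>i. \<tau> 24 (int i) 0))"
  let ?body = "setS 8 (Ar 18 cJ \<otimes> (Ar 24 cJ \<doteq> Cn 0) \<otimes> (Ar 22 cJ \<doteq> Sc 7)) ;;
      setS 9 (Ar 24 (Ar 23 cJ)) ;;
      Asg 24 cJ (Cn 0) (Ar 24 cJ \<oplus> Sc 8 \<otimes> (Cn 1 \<oplus> (Sc 9 \<doteq> Cn 1))) ;;
      Asg 24 (Ar 23 cJ) (Cn 0) (Ar 24 (Ar 23 cJ) \<oplus> Sc 8 \<otimes> ((Sc 9 \<doteq> Cn 0) \<otimes> Cn 2))"
  have "htr u W p_colour \<sigma> (J (int (30 * n + 2)) 0)"
    unfolding p_colour_def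
  proof (rule htr_For[where I = "\<lambda>s. J (int s) 0" and m = "30 * n + 2"])
    have "before r 0 0 = {}"
      by (rule before_none) (use r in blast)
    moreover have "colour_inv R T r {} (\<lambda>i. \<sigma> 24 (int i) 0)" by (rule colour_inv_init[OF R col])
    ultimately show "J (int 0) 0 \<sigma>" by (simp only: J_def of_nat_0 Int_empty_right)
    fix s \<tau>1 assume s: "s < 30 * n + 2" and inv1: "J (int s) 0 \<tau>1"
      and f1: "\<And>k. k \<notin> insert 7 (mods (For 2 eN ?body)) \<Longrightarrow> \<tau>1 k = \<sigma> k"
    have "htr u W (For 2 eN ?body) (put \<tau>1 7 0 0 (int s)) (J (int s) n)"
    proof (rule htr_For[where I = "J (int s)"])
      show "J (int s) 0 (put \<tau>1 7 0 0 (int s))" using inv1 by (simp add: J_def)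
      fix j \<tau>2 assume j: "j < n" and inv2: "J (int s) j \<tau>2"
        and f2: "\<And>k. k \<notin> insert 2 (mods ?body) \<Longrightarrow> \<tau>2 k = put \<tau>1 7 0 0 (int s) k"
      let ?\<tau> = "put \<tau>2 2 0 0 (int j)"
      let ?c = "\<lambda>i. \<tau>2 24 (int i) 0"
      have fr: "\<tau>2 k = \<sigma> k" if "k \<notin> {2, 7, 8, 9, 24}" for k
        using f2[of k] f1[of k] that by simp
      have s7: "\<tau>2 7 0 0 = int s" using f2[of 7] by (simp add: put_apply)
      have j2: "?\<tau> 2 0 0 = int j" by (simp add: put_apply)
      have inv: "colour_inv R T r (R \<inter> before r (int s) j) ?c" using inv2 by (simp add: J_def)
      define a where "a \<longleftrightarrow> j \<in> R \<and> ?c j = 0 \<and> r j = int s"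
      let ?m = "N j"
      have m: "?m < n" "\<tau>2 23 (int j) 0 = int ?m" using N[OF j] by (simp_all add: fr)
      have cb: "?c i \<in> {0, 1, 2, 3}" if "i < n" for i
        using that inv unfolding colour_inv_def by blast
      have col3: "?c i = 3 \<longleftrightarrow> i \<in> T" if "i < n" for i
        using that inv unfolding colour_inv_def by blast
      have ae: "ev u (Ar 18 cJ \<otimes> (Ar 24 cJ \<doteq> Cn 0) \<otimes> (Ar 22 cJ \<doteq> Sc 7)) ?\<tau> = of_bool a"
        using R18[OF j] r[OF j] j2 s7 by (auto simp: fr a_def)
      have am: "?m \<noteq> j" if a
        using that NR[of j] col3[OF j] by (auto simp: a_def)
      let ?c' = "if a then (\<lambda>i. if i = j then 1 + of_bool (?c ?m = 1) else if i = ?m \<and> ?c ?m = 0 then 2 else ?c i) else ?c"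
      have inv': "colour_inv R T r (R \<inter> before r (int s) (Suc j)) ?c'"
      proof (cases a)
        case True
        then have "j \<in> R - T" using col3[OF j] by (auto simp: a_def)
        note nr = NR[OF this]
        have "colour_inv R T r (insert j (R \<inter> before r (int s) j))
            (\<lambda>i. if i = j then 1 + of_bool (?c ?m = 1) else if i = ?m \<and> ?c ?m = 0 then 2 else ?c i)"
        proof (rule colour_inv_step[OF inv R(1)])
          show "j \<in> R" "?c j = 0" using True by (simp_all add: a_def)
          show "?m \<in> R" "?m \<noteq> j" "d ?m j \<le> r j" using nr by simp_all
          show "r ?m \<le> d i ?m" if "i \<in> R" "i \<noteq> ?m" for i by (rule r_le[OF that(1) _ that(2)]) (use nr in simp)
          show "R \<inter> before r (int s) j \<subseteq> R" by simp
          show "i \<in> R \<inter> before r (int s) j" if "i \<in> R" "r i < r j" for i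
            using that True R(1) by (auto simp: a_def before_def)
        qed
        moreover have "insert j (R \<inter> before r (int s) j) = R \<inter> before r (int s) (Suc j)"
          using True j by (auto simp: before_Suc a_def)
        ultimately show ?thesis using True by (simp only: if_True)
      next
        case False
        \<comment> \<open>If a representative \<open>j\<close> is passed over in its own round, it
          already has a colour.\<close>
        have "?c i \<noteq> 0" if i: "i \<in> R \<inter> before r (int s) (Suc j)" for i
        proof (cases "i = j \<and> r j = int s")
          case True
          then show ?thesis using False i by (simp add: a_def)
        next
          case F: False
          then have "i \<in> R \<inter> before r (int s) j" using i j by (auto simp: before_Suc split: if_splits)
          then show ?thesis using inv unfolding colour_inv_def by blast
        qed
        then show ?thesis using inv False by (simp only: colour_inv_def if_False) blast
      qed
      have J': "J (int s) (Suc j) \<tau>'" if "\<And>i. i < n \<Longrightarrow> \<tau>' 24 (int i) 0 = ?c' i" for \<tau>'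
      proof -
        have "colour_inv R T r (R \<inter> before r (int s) (Suc j)) (\<lambda>i. \<tau>' 24 (int i) 0)"
          by (rule colour_inv_cong[OF inv' that]) (use R(1) in auto)
        then show ?thesis by (simp add: J_def)
      qed
      show "htr u W ?body ?\<tau> (J (int s) (Suc j))"
      proof (rule htr_Asg_Sq[where a' = 0 and b' = 0, OF _ _ ae])
        let ?\<tau>3 = "put ?\<tau> 8 0 0 (of_bool a)"
        have 3: "?\<tau>3 2 0 0 = int j" "?\<tau>3 8 0 0 = of_bool a" "?\<tau>3 24 = \<tau>2 24" "?\<tau>3 23 = \<tau>2 23"
          by (simp_all add: put_apply)
        show "htr u W (setS 9 (Ar 24 (Ar 23 cJ)) ;;
            Asg 24 cJ (Cn 0) (Ar 24 cJ \<oplus> Sc 8 \<otimes> (Cn 1 \<oplus> (Sc 9 \<doteq> Cn 1))) ;;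
            Asg 24 (Ar 23 cJ) (Cn 0) (Ar 24 (Ar 23 cJ) \<oplus> Sc 8 \<otimes> ((Sc 9 \<doteq> Cn 0) \<otimes> Cn 2))) ?\<tau>3 (J (int s) (Suc j))"
        proof (rule htr_Asg_Sq[where a' = 0 and b' = 0 and v = "?c ?m"])
          show "ev u (Ar 24 (Ar 23 cJ)) ?\<tau>3 = ?c ?m" using 3 m by simp
          show "\<bar>?c ?m\<bar> \<le> W" using cb[OF m(1)] W_big by auto
          let ?\<tau>4 = "put ?\<tau>3 9 0 0 (?c ?m)"
          let ?x = "if a then 1 + of_bool (?c ?m = 1) else ?c j"
          have 4: "?\<tau>4 2 0 0 = int j" "?\<tau>4 8 0 0 = of_bool a" "?\<tau>4 9 0 0 = ?c ?m" "?\<tau>4 24 = \<tau>2 24" "?\<tau>4 23 = \<tau>2 23"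
            using 3 by (simp_all add: put_apply)
          show "htr u W (Asg 24 cJ (Cn 0) (Ar 24 cJ \<oplus> Sc 8 \<otimes> (Cn 1 \<oplus> (Sc 9 \<doteq> Cn 1))) ;;
            Asg 24 (Ar 23 cJ) (Cn 0) (Ar 24 (Ar 23 cJ) \<oplus> Sc 8 \<otimes> ((Sc 9 \<doteq> Cn 0) \<otimes> Cn 2))) ?\<tau>4 (J (int s) (Suc j))"
          proof (rule htr_Asg_Sq[where a' = "int j" and b' = 0 and v = ?x])
            show "ev u (Ar 24 cJ \<oplus> Sc 8 \<otimes> (Cn 1 \<oplus> (Sc 9 \<doteq> Cn 1))) ?\<tau>4 = ?x"
              using 4 by (simp add: a_def)
            show "\<bar>?x\<bar> \<le> W" using cb[OF j] W_big(3) by auto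
            let ?\<tau>5 = "put ?\<tau>4 24 (int j) 0 ?x"
            have 5: "?\<tau>5 2 0 0 = int j" "?\<tau>5 8 0 0 = of_bool a" "?\<tau>5 9 0 0 = ?c ?m" "?\<tau>5 23 = \<tau>2 23"
              "\<And>i. ?\<tau>5 24 (int i) 0 = (if i = j then ?x else ?c i)"
              using 4 by (simp_all add: put_apply)
            show "htr u W (Asg 24 (Ar 23 cJ) (Cn 0) (Ar 24 (Ar 23 cJ) \<oplus> Sc 8 \<otimes> ((Sc 9 \<doteq> Cn 0) \<otimes> Cn 2))) ?\<tau>5 (J (int s) (Suc j))"
            proof (rule htr_Asg_eq[where a' = "int ?m" and b' = 0 and v = "?c' ?m"])
              show "ev u (Ar 24 (Ar 23 cJ) \<oplus> Sc 8 \<otimes> ((Sc 9 \<doteq> Cn 0) \<otimes> Cn 2)) ?\<tau>5 = ?c' ?m"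
                using 5 m am by auto
              show "\<bar>?c' ?m\<bar> \<le> W" using cb[OF m(1)] W_big(3) by auto
              show "J (int s) (Suc j) (put ?\<tau>5 24 (int ?m) 0 (?c' ?m))"
                by (rule J') (use 5(5) am in \<open>auto simp: put_apply\<close>)
            qed (use 5 m in auto)
          qed (use 4 in auto)
        qed simp_all
      qed (use W_big(3) in auto)
    qed (use u1 nW in auto)
    then show "htr u W (For 2 eN ?body) (put \<tau>1 7 0 0 (int s)) (J (int (Suc s)) 0)"
      by (rule htr_conseq) (simp add: J_def before_next add.commute)
  qed (use u1 W_big(2) n_pos in auto)
  moreover have "before r (int (30 * n + 2)) 0 = {..<n}"
  proof (rule before_all)
    show "r i < int (30 * n + 2)" if "i < n" for i using r[OF that] by simp
  qed
  then have "R \<inter> before r (int (30 * n + 2)) 0 = R" using R by auto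
  ultimately show ?thesis by (simp add: J_def)
qed

lemma htr_p_open:
  assumes c: "\<And>i. i < n \<Longrightarrow> \<sigma> 24 (int i) 0 = c i"
  shows "htr u W p_open \<sigma> (\<lambda>\<tau>. \<exists>b\<in>{1, 2}. card {i. i < n \<and> c i = b} \<le> card {i. i < n \<and> c i = 3 - b} \<and>
     (\<forall>i<n. \<tau> 25 (int i) 0 = of_bool (c i = 3 \<or> c i = b)) \<and> \<tau> 14 0 0 = int (card {i. i < n \<and> (c i = 3 \<or> c i = b)}))" (is "htr u W _ _ ?Q")
proof -
  let ?N = "\<lambda>b. \<Sum>i<n. of_bool (c i = b) :: int"
  have N: "?N b = int (card {i. i < n \<and> c i = b})" for b
    by (rule sum_of_bool_lessThan)
  show ?thesis unfolding p_open_def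
  proof (rule htr_Sq)
    show "htr u W (setS 12 (Cn 0) ;; For 2 eN (addS 12 (Ar 24 cJ \<doteq> Cn 1))) \<sigma> (\<lambda>\<tau>. \<tau> 12 0 0 = ?N 1)"
      by (rule htr_scalar_sum[where K = 1]) (use c nW u1 in auto)
    fix \<tau>1 assume 1: "\<tau>1 12 0 0 = ?N 1"
      "\<And>k. k \<notin> mods (setS 12 (Cn 0) ;; For 2 eN (addS 12 (Ar 24 cJ \<doteq> Cn 1))) \<Longrightarrow> \<tau>1 k = \<sigma> k"
    show "htr u W ((setS 13 (Cn 0) ;; For 2 eN (addS 13 (Ar 24 cJ \<doteq> Cn 2))) ;;
      For 2 eN (Asg 25 cJ (Cn 0) ((Ar 24 cJ \<doteq> Cn 3) \<oplus> (Ar 24 cJ \<doteq> Cn 1 \<oplus> (Sc 13 \<lless> Sc 12)))) ;;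
      (setS 14 (Cn 0) ;; For 2 eN (addS 14 (Ar 25 cJ)))) \<tau>1
      ?Q"
    proof (rule htr_Sq)
      show "htr u W (setS 13 (Cn 0) ;; For 2 eN (addS 13 (Ar 24 cJ \<doteq> Cn 2))) \<tau>1 (\<lambda>\<tau>. \<tau> 13 0 0 = ?N 2)"
        by (rule htr_scalar_sum[where K = 1]) (use c 1 nW u1 in auto)
      fix \<tau>2 assume 2: "\<tau>2 13 0 0 = ?N 2"
        "\<And>k. k \<notin> mods (setS 13 (Cn 0) ;; For 2 eN (addS 13 (Ar 24 cJ \<doteq> Cn 2))) \<Longrightarrow> \<tau>2 k = \<tau>1 k"
      define b :: int where "b = 1 + of_bool (?N 2 < ?N 1)"
      have b: "b \<in> {1, 2}" "card {i. i < n \<and> c i = b} \<le> card {i. i < n \<and> c i = 3 - b}"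
        unfolding b_def N by auto
      have fr2: "\<tau>2 24 = \<sigma> 24" "\<tau>2 12 0 0 = ?N 1" using 1 2 by simp_all
      show "htr u W (For 2 eN (Asg 25 cJ (Cn 0) ((Ar 24 cJ \<doteq> Cn 3) \<oplus> (Ar 24 cJ \<doteq> Cn 1 \<oplus> (Sc 13 \<lless> Sc 12)))) ;;
        (setS 14 (Cn 0) ;; For 2 eN (addS 14 (Ar 25 cJ)))) \<tau>2
       ?Q"
      proof (rule htr_Sq)
        show "htr u W (For 2 eN (Asg 25 cJ (Cn 0) ((Ar 24 cJ \<doteq> Cn 3) \<oplus> (Ar 24 cJ \<doteq> Cn 1 \<oplus> (Sc 13 \<lless> Sc 12))))) \<tau>2
          (\<lambda>\<tau>. (\<forall>i<n. \<tau> 25 (int i) 0 = of_bool (c i = 3 \<or> c i = b)) \<and>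
             (\<forall>a. a \<notin> int ` {..<n} \<longrightarrow> \<tau> 25 a = \<tau>2 25 a))"
        proof (rule htr_map1)
          fix i and \<tau> :: state assume i: "i < n" and fr: "\<And>k. k \<noteq> 2 \<Longrightarrow> k \<noteq> 25 \<Longrightarrow> \<tau> k = \<tau>2 k" and ii: "\<tau> 2 0 0 = int i"
          have "ev u (Cn 1 \<oplus> (Sc 13 \<lless> Sc 12)) \<tau> = b" using fr 2 fr2 by (simp add: b_def)
          then show "ev u ((Ar 24 cJ \<doteq> Cn 3) \<oplus> (Ar 24 cJ \<doteq> Cn 1 \<oplus> (Sc 13 \<lless> Sc 12))) \<tau> = of_bool (c i = 3 \<or> c i = b)"
            using ii c[OF i] fr fr2 b(1) by auto
        qed (use u1 nW W_big(3) in auto)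
        fix \<tau>3 :: state assume 3: "(\<forall>i<n. \<tau>3 25 (int i) 0 = of_bool (c i = 3 \<or> c i = b)) \<and>
             (\<forall>a. a \<notin> int ` {..<n} \<longrightarrow> \<tau>3 25 a = \<tau>2 25 a)"
        have "htr u W (setS 14 (Cn 0) ;; For 2 eN (addS 14 (Ar 25 cJ))) \<tau>3
          (\<lambda>\<tau>. \<tau> 14 0 0 = (\<Sum>i<n. of_bool (c i = 3 \<or> c i = b)))"
        proof (rule htr_scalar_sum[where K = 1])
          fix i and \<tau> :: state assume "i < n" "\<And>k. k \<noteq> 2 \<Longrightarrow> k \<noteq> 14 \<Longrightarrow> \<tau> k = \<tau>3 k" "\<tau> 2 0 0 = int i"
          then show "ev u (Ar 25 cJ) \<tau> = of_bool (c i = 3 \<or> c i = b)" using conjunct1[OF 3] by simp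
        qed (use nW u1 in auto)
        then show "htr u W (setS 14 (Cn 0) ;; For 2 eN (addS 14 (Ar 25 cJ))) \<tau>3
         ?Q"
        proof (rule htr_conseq)
          fix \<tau> :: state assume 4: "\<tau> 14 0 0 = (\<Sum>i<n. of_bool (c i = 3 \<or> c i = b))"
            "\<And>k. k \<notin> mods (setS 14 (Cn 0) ;; For 2 eN (addS 14 (Ar 25 cJ))) \<Longrightarrow> \<tau> k = \<tau>3 k"
          have "\<tau> 25 = \<tau>3 25" by (rule 4(2)) simp
          moreover have "\<tau> 14 0 0 = int (card {i. i < n \<and> (c i = 3 \<or> c i = b)})"
            unfolding 4(1) by (rule sum_of_bool_lessThan)
          ultimately show "?Q \<tau>"
            using b conjunct1[OF 3] by (intro bexI[of _ b]) simp_all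
        qed
      qed
    qed
  qed
qed

lemma htr_p_pad:
  assumes F: "F \<subseteq> {..<n}" "card F \<le> k" and F25: "\<And>i. i < n \<Longrightarrow> \<sigma> 25 (int i) 0 = of_bool (i \<in> F)"
    and c: "\<sigma> 14 0 0 = int (card F)"
  shows "htr u W p_pad \<sigma> (\<lambda>\<tau>. \<exists>G. F \<subseteq> G \<and> G \<subseteq> {..<n} \<and> card G = k \<and> (\<forall>i<n. \<tau> 25 (int i) 0 = of_bool (i \<in> G)))"
proof -
  let ?body = "setS 8 ((Sc 14 \<lless> eK) \<otimes> (Cn 1 \<ominus> Ar 25 cJ)) ;; Asg 25 cJ (Cn 0) (Ar 25 cJ \<oplus> Sc 8) ;; addS 14 (Sc 8)"
  define J where "J = (\<lambda>j (\<tau> :: state). \<exists>G. F \<subseteq> G \<and> G \<subseteq> {..<n} \<and> card G \<le> k \<and> ({..<j} \<subseteq> G \<or> card G = k) \<and>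
    (\<forall>i<n. \<tau> 25 (int i) 0 = of_bool (i \<in> G)) \<and> \<tau> 14 0 0 = int (card G))"
  have "htr u W p_pad \<sigma> (J n)" unfolding p_pad_def
  proof (rule htr_For[where I = J])
    show "J 0 \<sigma>" using assms by (auto simp: J_def)
    fix j \<tau> assume j: "j < n" and inv: "J j \<tau>"
    obtain G where G: "F \<subseteq> G" "G \<subseteq> {..<n}" "card G \<le> k" "{..<j} \<subseteq> G \<or> card G = k"
      "\<And>i. i < n \<Longrightarrow> \<tau> 25 (int i) 0 = of_bool (i \<in> G)" "\<tau> 14 0 0 = int (card G)"
      using inv by (auto simp: J_def)
    have fG: "finite G" using G(2) finite_subset by blast
    let ?\<tau> = "put \<tau> 2 0 0 (int j)"
    have j2: "?\<tau> 2 0 0 = int j" by (simp add: put_apply)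
    define a where "a \<longleftrightarrow> card G < k \<and> j \<notin> G"
    let ?G = "if a then insert j G else G"
    have ae: "ev u ((Sc 14 \<lless> eK) \<otimes> (Cn 1 \<ominus> Ar 25 cJ)) ?\<tau> = of_bool a"
      using G(5)[OF j] G(6) j2 u2 by (auto simp: a_def)
    have J': "J (Suc j) \<tau>'" if "\<And>i. i < n \<Longrightarrow> \<tau>' 25 (int i) 0 = of_bool (i \<in> ?G)" "\<tau>' 14 0 0 = int (card ?G)" for \<tau>'
      unfolding J_def by (rule exI[of _ ?G]) (use that G fG j in \<open>auto simp: a_def less_Suc_eq\<close>)
    show "htr u W ?body ?\<tau> (J (Suc j))"
    proof (rule htr_Asg_Sq[where a' = 0 and b' = 0, OF _ _ ae])
      let ?\<tau>3 = "put ?\<tau> 8 0 0 (of_bool a)"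
      have 3: "?\<tau>3 2 0 0 = int j" "?\<tau>3 8 0 0 = of_bool a" "?\<tau>3 25 = \<tau> 25" "?\<tau>3 14 = \<tau> 14"
        by (simp_all add: put_apply)
      show "htr u W (Asg 25 cJ (Cn 0) (Ar 25 cJ \<oplus> Sc 8) ;; addS 14 (Sc 8)) ?\<tau>3 (J (Suc j))"
      proof (rule htr_Asg_Sq[where a' = "int j" and b' = 0 and v = "of_bool (j \<in> ?G)"])
        show "ev u (Ar 25 cJ \<oplus> Sc 8) ?\<tau>3 = of_bool (j \<in> ?G)" using 3 G(5)[OF j] by (auto simp: a_def)
        let ?\<tau>4 = "put ?\<tau>3 25 (int j) 0 (of_bool (j \<in> ?G))"
        show "htr u W (addS 14 (Sc 8)) ?\<tau>4 (J (Suc j))"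
        proof (rule htr_Asg_eq[where v = "int (card ?G)" and a' = 0 and b' = 0])
          show "ev u (Sc 14 \<oplus> Sc 8) ?\<tau>4 = int (card ?G)"
            using 3 G(6) fG by (simp add: a_def put_apply)
          show "\<bar>int (card ?G)\<bar> \<le> W" using G(3) fG kn nW by (auto simp: a_def)
          show "J (Suc j) (put ?\<tau>4 14 0 0 (int (card ?G)))"
            by (rule J') (use G(5) 3 j in \<open>auto simp: put_apply\<close>)
        qed simp_all
      qed (use 3 W_big(3) in auto)
    qed (use W_big(3) in auto)
  qed (use u1 nW in auto)
  then show ?thesis
  proof (rule htr_conseq)
    fix \<tau> assume "J n \<tau>"
    then obtain G where G: "F \<subseteq> G" "G \<subseteq> {..<n}" "card G \<le> k" "{..<n} \<subseteq> G \<or> card G = k"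
      "\<forall>i<n. \<tau> 25 (int i) 0 = of_bool (i \<in> G)" by (auto simp: J_def)
    \<comment> \<open>As \<open>k < n\<close>, the pass cannot run out of points before
      \<open>k\<close> centers are reached.\<close>
    have "\<not> {..<n} \<subseteq> G"
    proof
      assume "{..<n} \<subseteq> G"
      then have "G = {..<n}" using G(2) by blast
      then show False using G(3) kn by simp
    qed
    then show "\<exists>G. F \<subseteq> G \<and> G \<subseteq> {..<n} \<and> card G = k \<and> (\<forall>i<n. \<tau> 25 (int i) 0 = of_bool (i \<in> G))" using G by blast
  qed
qed

lemma htr_p_output:
  assumes F: "\<And>i. i < n \<Longrightarrow> \<sigma> 25 (int i) 0 = of_bool (i \<in> F)"
    and N: "\<And>i. i < n \<Longrightarrow> \<sigma> 27 (int i) 0 = int (N i) \<and> N i < n"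
  shows "htr u W p_output \<sigma> (\<lambda>\<tau>. \<tau> 0 0 0 = int (2 * n) \<and>
    map (\<lambda>a. \<tau> 0 a 0) [1..int (2 * n)] = encode_solution n F N)" (is "htr u W _ _ ?Q")
  unfolding p_output_def
proof (rule htr_Sq)
  show "htr u W (setS 0 (Cn 2 \<otimes> eN)) \<sigma> (\<lambda>\<tau>. \<tau> 0 0 0 = int (2 * n))"
    using u1 W_big(2) n_pos by (intro htr_Asg) (auto simp: put_apply)
  fix \<tau>1 assume 1: "\<tau>1 0 0 0 = int (2 * n)" "\<And>k. k \<notin> mods (setS 0 (Cn 2 \<otimes> eN)) \<Longrightarrow> \<tau>1 k = \<sigma> k"
  show "htr u W (For 2 eN (Asg 0 (cJ \<oplus> Cn 1) (Cn 0) (Ar 25 cJ)) ;; For 2 eN (Asg 0 (cJ \<oplus> eN \<oplus> Cn 1) (Cn 0) (Ar 27 cJ))) \<tau>1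
    ?Q"
  proof (rule htr_Sq)
    show "htr u W (For 2 eN (Asg 0 (cJ \<oplus> Cn 1) (Cn 0) (Ar 25 cJ))) \<tau>1
      (\<lambda>\<tau>. (\<forall>i<n. \<tau> 0 (int i + 1) 0 = of_bool (i \<in> F)) \<and> (\<forall>b. b \<notin> (\<lambda>i. int i + 1) ` {..<n} \<longrightarrow> \<tau> 0 b = \<tau>1 0 b))"
    proof (rule htr_map1)
      fix i and \<tau> :: state assume "i < n" "\<And>k. k \<noteq> 2 \<Longrightarrow> k \<noteq> 0 \<Longrightarrow> \<tau> k = \<tau>1 k" "\<tau> 2 0 0 = int i"
      then show "ev u (Ar 25 cJ) \<tau> = of_bool (i \<in> F)" using F[of i] 1(2)[of 25] by simp
    qed (use u1 nW W_big(3) in \<open>auto simp: inj_on_def\<close>)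
    fix \<tau>2 assume 2: "(\<forall>i<n. \<tau>2 0 (int i + 1) 0 = of_bool (i \<in> F)) \<and> (\<forall>b. b \<notin> (\<lambda>i. int i + 1) ` {..<n} \<longrightarrow> \<tau>2 0 b = \<tau>1 0 b)"
      "\<And>k. k \<notin> mods (For 2 eN (Asg 0 (cJ \<oplus> Cn 1) (Cn 0) (Ar 25 cJ))) \<Longrightarrow> \<tau>2 k = \<tau>1 k"
    have "htr u W (For 2 eN (Asg 0 (cJ \<oplus> eN \<oplus> Cn 1) (Cn 0) (Ar 27 cJ))) \<tau>2
      (\<lambda>\<tau>. (\<forall>i<n. \<tau> 0 (int i + int n + 1) 0 = int (N i)) \<and> (\<forall>b. b \<notin> (\<lambda>i. int i + int n + 1) ` {..<n} \<longrightarrow> \<tau> 0 b = \<tau>2 0 b))"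
    proof (rule htr_map1)
      fix i assume "i < n"
      then show "\<bar>int (N i)\<bar> \<le> W" using N[of i] nW by simp
      fix \<tau> :: state assume "\<And>k. k \<noteq> 2 \<Longrightarrow> k \<noteq> 0 \<Longrightarrow> \<tau> k = \<tau>2 k" "\<tau> 2 0 0 = int i"
      then show "ev u (Ar 27 cJ) \<tau> = int (N i)" using N[OF \<open>i < n\<close>] 1(2)[of 27] 2(2)[of 27] by simp
    qed (use u1 nW in \<open>auto simp: inj_on_def\<close>)
    then show "htr u W (For 2 eN (Asg 0 (cJ \<oplus> eN \<oplus> Cn 1) (Cn 0) (Ar 27 cJ))) \<tau>2
      ?Q"
    proof (rule htr_conseq)
      fix \<tau> :: state
      assume 3: "(\<forall>i<n. \<tau> 0 (int i + int n + 1) 0 = int (N i)) \<and> (\<forall>b. b \<notin> (\<lambda>i. int i + int n + 1) ` {..<n} \<longrightarrow> \<tau> 0 b = \<tau>2 0 b)"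
      have "0 \<notin> (\<lambda>i. int i + int n + 1) ` {..<n}" "0 \<notin> (\<lambda>i. int i + 1) ` {..<n}"
        by (auto simp: image_iff)
      then have "\<tau> 0 0 = \<tau>2 0 0" "\<tau>2 0 0 = \<tau>1 0 0" using 3 2(1) by blast+
      then have 0: "\<tau> 0 0 0 = int (2 * n)" using 1(1) by simp
      have a: "\<tau> 0 (int i + 1) 0 = of_bool (i \<in> F)" if "i < n" for i
      proof -
        have "int i + 1 \<notin> (\<lambda>i. int i + int n + 1) ` {..<n}" using that by auto
        then have "\<tau> 0 (int i + 1) = \<tau>2 0 (int i + 1)" using 3 by blast
        then show ?thesis using 2(1) that by simp
      qed
      have len: "length [1..int (2 * n)] = 2 * n" by simp
      have "map (\<lambda>a. \<tau> 0 a 0) [1..int (2 * n)] = encode_solution n F N"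
      proof (rule nth_equalityI)
        show "length (map (\<lambda>a. \<tau> 0 a 0) [1..int (2 * n)]) = length (encode_solution n F N)"
          by (simp add: encode_solution_def)
        fix i assume "i < length (map (\<lambda>a. \<tau> 0 a 0) [1..int (2 * n)])"
        then have i: "i < 2 * n" by simp
        then have l: "map (\<lambda>a. \<tau> 0 a 0) [1..int (2 * n)] ! i = \<tau> 0 (int i + 1) 0"
        proof -
          have "[1..int (2 * n)] ! i = 1 + int i" by (rule nth_upto) (use i in simp)
          then show ?thesis using i len by (simp only: nth_map add.commute)
        qed
        show "map (\<lambda>a. \<tau> 0 a 0) [1..int (2 * n)] ! i = encode_solution n F N ! i"
        proof (cases "i < n")
          case True
          then show ?thesis unfolding l using a[OF True] by (simp add: encode_solution_def nth_append)
        next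
          case False
          then have e: "int (i - n) + int n = int i" "i - n < n" using i by auto
          have "\<tau> 0 (int (i - n) + int n + 1) 0 = int (N (i - n))" using 3 e(2) by blast
          then have "\<tau> 0 (int i + 1) 0 = int (N (i - n))" by (simp only: e(1))
          then show ?thesis unfolding l using False i e(2) by (simp add: encode_solution_def nth_append)
        qed
      qed
      then show "?Q \<tau>"
        using 0 by simp
    qed
  qed
qed

end

section \<open>The whole program and its correctness\<close>

definition p_weights :: cmd where
  "p_weights = For 2 eN (Asg 21 cJ (Cn 0) (Cn 0) ;; For 1 eN (Asg 21 cJ (Cn 0) (Ar 21 cJ \<oplus> (Ar 20 cI \<doteq> cJ))))"

definition p_count :: cmd where
  "p_count = (setS 10 (Cn 0) ;; For 2 eN (addS 10 (Ar 18 cJ)))"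

text \<open>Admits representatives of no larger cost; the \<open>1\<close> makes the comparison
  weak. The clustering provides one of these that is close, so the nearest of them is close too and
  can serve as \<open>rep\<close>.\<close>

definition m_assign :: ex where "m_assign = Ar 18 cI \<otimes> (Ar 17 cI \<lless> Ar 17 cJ \<oplus> Cn 1)"
definition m_other :: ex where "m_other = Ar 18 cI \<otimes> (Cn 1 \<ominus> (cI \<doteq> cJ))"
definition m_open :: ex where "m_open = Ar 25 cI"

definition p_main :: "nat \<Rightarrow> cmd" where
  "p_main q = (p_dist ;; p_perceptron q ;; p_cost ;; p_cluster q ;; p_nearest m_assign 19 20 ;;
     p_weights ;; p_count ;; p_nearest m_other 22 23 ;; p_top ;; p_colour ;; p_open ;; p_pad ;;
     p_nearest m_open 26 27 ;; p_output)"

text \<open>With explicit sets, frame conditions become membership tests; they carry each array from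
  the phase that fills it to those that read it.\<close>

lemma mods_phases:
  "mods p_dist = {1, 2, 15}" "mods (p_perceptron q) = {1, 2, 3, 4, 5, 6, 8, 16}"
  "mods p_cost = {1, 2, 17}" "mods (p_cluster q) = {1, 2, 7, 8, 18}"
  "mods (p_nearest e a b) = {1, 2, 8, a, b}" "mods p_weights = {1, 2, 21}" "mods p_count = {2, 10}"
  "mods p_top = {2, 7, 8, 11, 24}" "mods p_colour = {2, 7, 8, 9, 24}"
  "mods p_open = {2, 12, 13, 14, 25}" "mods p_pad = {2, 8, 14, 25}" "mods p_output = {0, 2}"
  unfolding p_dist_def p_perceptron_def p_update_def p_cost_def p_cluster_def p_nearest_def
    p_weights_def p_count_def p_top_def p_colour_def p_open_def p_pad_def p_output_def mods.simps
  by blast+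

context centrum_program
begin

lemma htr_p_weights:
  "htr u W p_weights \<sigma> (\<lambda>\<tau>. \<forall>j<n. \<tau> 21 (int j) 0 = int (card {i. i < n \<and> \<sigma> 20 (int i) 0 = int j}))"
  unfolding p_weights_def
proof (rule htr_conseq[OF htr_sums[where K = 1 and m = n and m' = n and g = "\<lambda>i j. of_bool (\<sigma> 20 (int i) 0 = int j)"]])
  fix i j and \<tau> :: state assume "\<And>k. k \<noteq> 1 \<Longrightarrow> k \<noteq> 2 \<Longrightarrow> k \<noteq> 21 \<Longrightarrow> \<tau> k = \<sigma> k" "\<tau> 1 0 0 = int i" "\<tau> 2 0 0 = int j"
  then show "ev u (Ar 20 cI \<doteq> cJ) \<tau> = of_bool (\<sigma> 20 (int i) 0 = int j)" by simp
next
  fix \<tau> :: state assume "\<forall>j<n. \<tau> 21 (int j) 0 = (\<Sum>i<n. of_bool (\<sigma> 20 (int i) 0 = int j))"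
  then show "\<forall>j<n. \<tau> 21 (int j) 0 = int (card {i. i < n \<and> \<sigma> 20 (int i) 0 = int j})"
    by (simp only: sum_of_bool_lessThan) 
qed (use u1 nW in auto)

lemma htr_p_count:
  assumes "R \<subseteq> {..<n}" "\<And>i. i < n \<Longrightarrow> \<sigma> 18 (int i) 0 = of_bool (i \<in> R)"
  shows "htr u W p_count \<sigma> (\<lambda>\<tau>. \<tau> 10 0 0 = int (card R))"
  unfolding p_count_def
proof (rule htr_conseq[OF htr_scalar_sum[where K = 1 and m = n and g = "\<lambda>i. of_bool (i \<in> R)"]])
  fix \<tau> :: state assume "\<tau> 10 0 0 = (\<Sum>i<n. of_bool (i \<in> R))"
  moreover have "{i. i < n \<and> i \<in> R} = R" using assms(1) by auto
  ultimately show "\<tau> 10 0 0 = int (card R)" by (simp only: sum_of_bool_lessThan)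
qed (use assms(2) u1 nW in auto)

lemma sat_lin:
  assumes "sat cons w" "h < 5" "p < n" "r < n"
  shows "0 < lin n k l q f h p r w"
proof -
  have "dot h p r w = lin n k l q f h p r w"
    using sum_coef[OF assms(3,4), of w k l q f h] by (simp add: dot_def mult.commute)
  then show ?thesis using assms by (force simp: sat_def cons_def)
qed

definition feasible :: "(nat \<Rightarrow> nat \<Rightarrow> int) \<Rightarrow> bool" where
  "feasible w \<longleftrightarrow> 0 < w n n \<and> (\<forall>i<n. \<forall>j<n. 0 < w i j \<and> w i j < w i n) \<and> (\<forall>j<n. w n n < (\<Sum>i<n. w i j)) \<and>
     4 * int q * (\<Sum>i<n. w i n) < (4 * int q * int k + 1) * w n n \<and>
     int q * (\<Sum>j<n. cst w j) < (int q + 1) * int l * w n n"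

text \<open>Positivity of the denominator is not one of the constraints. It follows from the budget:
  each \<open>y\<close> exceeds a positive \<open>x\<close>, so
  \<open>(4 * q * k + 1) * w n n\<close> exceeds a positive sum.\<close>

lemma feasible:
  assumes "sat cons w"
  shows "feasible w"
proof -
  have n0: "0 < n" using kn by simp
  have x: "0 < w i j \<and> w i j < w i n" if "i < n" "j < n" for i j
    using sat_lin[OF assms _ that, of 0] sat_lin[OF assms _ that, of 1] by (simp add: lin_def)
  have y: "4 * int q * (\<Sum>i<n. w i n) < (4 * int q * int k + 1) * w n n"
    using sat_lin[OF assms _ n0 n0, of 3] by (simp add: lin_def)
  have "0 < w i n" if "i < n" for i using x[OF that n0] by linarith
  then have "0 < (\<Sum>i<n. w i n)" using n0 by (intro sum_pos) auto
  then have "0 < (4 * int q * int k + 1) * w n n" using y q_pos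
    by (intro order.strict_trans[OF _ y] mult_pos_pos) auto
  then have z: "0 < w n n" using zero_less_mult_pos[of "4 * int q * int k + 1" "w n n"] by simp
  have c: "w n n < (\<Sum>i<n. w i j)" if "j < n" for j
    using sat_lin[OF assms _ n0 that, of 2] by (simp add: lin_def)
  have "(\<Sum>j<n. cst w j) = (\<Sum>i<n. \<Sum>j<n. f i j * w i j)"
    unfolding cst_def by (rule sum.swap)
  then have "int q * (\<Sum>j<n. cst w j) < (int q + 1) * int l * w n n"
    using sat_lin[OF assms _ n0 n0, of 4] by (simp add: lin_def)
  then show ?thesis using x y z c by (simp add: feasible_def)
qed

lemma cst_nonneg: "feasible w \<Longrightarrow> j < n \<Longrightarrow> 0 \<le> cst w j"
  unfolding cst_def using f_bounds by (intro sum_nonneg mult_nonneg_nonneg) (auto simp: feasible_def less_imp_le)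

text \<open>Division by \<open>w n n\<close> turns the integer inequalities into those of the
  locale; strictness is retained for the positivity of \<open>x\<close> and for the
  separation.\<close>

lemma fractional_clustering:
  assumes w: "feasible w" and R: "cluster_inv (w n n) (cst w) {..<n} R"
  shows "fractional_clustering n k l q (\<lambda>i j. of_int (d i j)) (\<lambda>i j. w i j / w n n) (\<lambda>i. w i n / w n n)
    (\<lambda>j. cst w j / w n n) R"
proof
  have z: "0 < real_of_int (w n n)" using w by (simp add: feasible_def)
  show "1 \<le> q" "1 \<le> k" using q kn by auto
  show "0 \<le> real_of_int (d i j)" if "i < n" "j < n" for i j using d_nonneg[OF that] by simp
  show "real_of_int (d i j) = real_of_int (d j i)" if "i < n" "j < n" for i j using d_sym[OF that] by simp
  show "real_of_int (d i j) \<le> real_of_int (d i h) + real_of_int (d h j)" if "i < n" "j < n" "h < n" for i j h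
    using d_tri[OF that] by linarith
  show "0 < real_of_int (w i j) / real_of_int (w n n)" if "i < n" "j < n" for i j
    using w that z by (simp add: feasible_def)
  show "real_of_int (w i j) / real_of_int (w n n) \<le> real_of_int (w i n) / real_of_int (w n n)" if "i < n" "j < n" for i j
  proof -
    have "w i j \<le> w i n" using w that by (auto simp: feasible_def less_imp_le)
    then show ?thesis using z by (simp add: divide_right_mono)
  qed
  show "1 \<le> (\<Sum>i<n. real_of_int (w i j) / real_of_int (w n n))" if "j < n" for j
  proof -
    have "w n n < (\<Sum>i<n. w i j)" using w that by (simp add: feasible_def)
    then have "real_of_int (w n n) \<le> (\<Sum>i<n. real_of_int (w i j))"
      by (simp only: of_int_sum[symmetric] of_int_le_iff less_imp_le)
    then show ?thesis using z by (simp add: sum_divide_distrib[symmetric])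
  qed
  show "(\<Sum>i<n. real_of_int (w i n) / real_of_int (w n n)) \<le> real k + 1 / (4 * real q)"
  proof -
    have "4 * int q * (\<Sum>i<n. w i n) \<le> (4 * int q * int k + 1) * w n n" using w by (simp add: feasible_def)
    then have "real_of_int (4 * int q * (\<Sum>i<n. w i n)) \<le> real_of_int ((4 * int q * int k + 1) * w n n)"
      by (simp only: of_int_le_iff)
    then have "4 * real q * (\<Sum>i<n. real_of_int (w i n)) \<le> (4 * real q * real k + 1) * real_of_int (w n n)" by simp
    then show ?thesis using z q by (simp add: sum_divide_distrib[symmetric] field_simps)
  qed
  show "cst w j / real_of_int (w n n) = (\<Sum>i<n. max 0 (real_of_int (d i j) - 1) * (real_of_int (w i j) / real_of_int (w n n)))"
    if "j < n" for j
  proof -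
    have "max 0 (real_of_int (d i j) - 1) = real_of_int (f i j)" for i by (simp add: f_def max_def)
    then show ?thesis by (simp add: cst_def sum_divide_distrib)
  qed
  show "(\<Sum>j<n. cst w j / real_of_int (w n n)) \<le> (1 + 1 / real q) * real l"
  proof -
    have "int q * (\<Sum>j<n. cst w j) \<le> (int q + 1) * int l * w n n" using w by (simp add: feasible_def)
    then have "real_of_int (int q * (\<Sum>j<n. cst w j)) \<le> real_of_int ((int q + 1) * int l * w n n)"
      by (simp only: of_int_le_iff)
    then have "real q * (\<Sum>j<n. real_of_int (cst w j)) \<le> (real q + 1) * real l * real_of_int (w n n)" by simp
    then show ?thesis using z q by (simp add: sum_divide_distrib[symmetric] field_simps)
  qed
  show "R \<subseteq> {..<n}" using R by (simp add: cluster_inv_def)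
  show "2 + 4 * (cst w j / real_of_int (w n n)) < real_of_int (d i j)" if "i \<in> R" "j \<in> R" "i \<noteq> j" for i j
  proof -
    have "\<not> close (w n n) (cst w) i j" using R that by (simp add: cluster_inv_def)
    then have "2 * w n n + 4 * cst w j < w n n * d i j" by (simp add: close_def)
    then have "real_of_int (2 * w n n + 4 * cst w j) < real_of_int (w n n * d i j)" by (simp only: of_int_less_iff)
    then show ?thesis using z by (simp add: field_simps)
  qed
qed

lemma nearest_exists:
  assumes "nearest mk n j a b" "i < n" "mk i j"
  shows "nat b < n" "mk (nat b) j" "b = int (nat b)" "a = d (nat b) j" "\<And>i'. i' < n \<Longrightarrow> mk i' j \<Longrightarrow> d (nat b) j \<le> d i' j"
proof -
  obtain i0 where "i0 < n" "mk i0 j" "b = int i0" "a = d i0 j" "\<forall>i'<n. mk i' j \<longrightarrow> d i0 j \<le> d i' j"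
    using assms unfolding nearest_def by blast
  then show "nat b < n" "mk (nat b) j" "b = int (nat b)" "a = d (nat b) j"
    "\<And>i'. i' < n \<Longrightarrow> mk i' j \<Longrightarrow> d (nat b) j \<le> d i' j" by simp_all
qed

lemma nearest_less:
  assumes "nearest mk n j a b"
  shows "b = int (nat b) \<and> nat b < n"
  using assms kn by (auto simp: nearest_def)

text \<open>The smaller class has at most half of \<open>R - T\<close>. If \<open>R\<close> has more
  than \<open>k\<close> elements, the size of \<open>T\<close> gives
  \<open>card T + card (R - T) / 2 = k\<close>; otherwise \<open>R - T\<close> is empty. An element
  of the closed class is served by the second clause of \<open>colour_inv\<close>.\<close>

lemma colour_open:
  assumes c: "colour_inv R T r R c" and R: "R \<subseteq> {..<n}" and T: "T \<subseteq> R" "card T = min (card R) (2 * k - card R)"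
    and b: "b \<in> {1, 2}" "card {i. i < n \<and> c i = b} \<le> card {i. i < n \<and> c i = 3 - b}" and cR: "card R \<le> 2 * k"
  shows "card {i. i < n \<and> (c i = 3 \<or> c i = b)} \<le> k" "T \<subseteq> {i. i < n \<and> (c i = 3 \<or> c i = b)}"
    "\<And>j. j \<in> R - T \<Longrightarrow> \<exists>i\<in>{i. i < n \<and> (c i = 3 \<or> c i = b)}. d i j \<le> r j \<or> i = j"
proof -
  have c1: "c i \<in> {0, 1, 2, 3} \<and> (c i \<noteq> 0 \<longrightarrow> i \<in> R) \<and> (c i = 3 \<longleftrightarrow> i \<in> T)" if "i < n" for i
    using c that unfolding colour_inv_def by blast
  have c2: "\<exists>i'\<in>R. d i' i \<le> r i \<and> (c i' = 3 \<or> c i' = 3 - c i)" if "i \<in> R" "c i = 1 \<or> c i = 2" for i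
    using c that unfolding colour_inv_def by blast
  have c3: "c i \<noteq> 0" if "i \<in> R" for i using c that unfolding colour_inv_def by blast
  let ?A = "\<lambda>b. {i. i < n \<and> c i = b}"
  have fR: "finite R" by (rule finite_subset[OF R]) simp
  then have fT: "finite T" by (rule finite_subset[OF T(1)])
  have "c i = 3 \<longleftrightarrow> i \<in> T" if "i < n" for i using c1[OF that] by blast
  then have A3: "?A 3 = T" using R T(1) by blast
  have "i \<in> R - T" if "i \<in> ?A b \<union> ?A (3 - b)" for i
  proof -
    have "i < n" "c i = 1 \<or> c i = 2" using that b(1) by auto
    then show ?thesis using c1[of i] by auto
  qed
  then have "?A b \<union> ?A (3 - b) \<subseteq> R - T" by blast
  then have "card (?A b \<union> ?A (3 - b)) \<le> card (R - T)" using fR by (intro card_mono) auto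
  moreover have "card (?A b \<union> ?A (3 - b)) = card (?A b) + card (?A (3 - b))"
    using b(1) by (intro card_Un_disjoint) auto
  moreover have "card (R - T) = card R - card T" using fT T(1) by (simp add: card_Diff_subset)
  ultimately have h: "2 * card (?A b) \<le> card R - card T" using b(2) by linarith
  have "{i. i < n \<and> (c i = 3 \<or> c i = b)} = ?A 3 \<union> ?A b" by auto
  then have "card {i. i < n \<and> (c i = 3 \<or> c i = b)} \<le> card T + card (?A b)"
    using card_Un_le[of "?A 3" "?A b"] by (simp add: A3)
  then show "card {i. i < n \<and> (c i = 3 \<or> c i = b)} \<le> k" using h T(2) cR by linarith
  show "T \<subseteq> {i. i < n \<and> (c i = 3 \<or> c i = b)}" using A3 by blast
  fix j assume j: "j \<in> R - T"
  then have jn: "j < n" using R by auto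
  have cj: "c j = 1 \<or> c j = 2" using c1[OF jn] c3[of j] j by auto
  show "\<exists>i\<in>{i. i < n \<and> (c i = 3 \<or> c i = b)}. d i j \<le> r j \<or> i = j"
  proof (cases "c j = b")
    case True
    then show ?thesis using jn by auto
  next
    case False
    then have "3 - c j = b" using cj b(1) by auto
    moreover obtain i where "i \<in> R" "d i j \<le> r j" "c i = 3 \<or> c i = 3 - c j" using c2[of j] cj j by blast
    ultimately show ?thesis using R by (intro bexI[of _ i]) auto
  qed
qed

definition centre_cost :: "(nat \<Rightarrow> nat) \<Rightarrow> real" where
  "centre_cost N = (\<Sum>j<n. max 0 (real_of_int (d (N j) j) - 4))"

lemma htr_p_main:
  assumes z: "good_margin z"
  shows "htr u W (p_main q) (\<lambda>_ _ _. 0) (\<lambda>\<tau>. \<tau> 0 0 0 = int (2 * n) \<and> (\<exists>F N.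
    map (\<lambda>a. \<tau> 0 a 0) [1..int (2 * n)] = encode_solution n F N \<and> F \<subseteq> {..<n} \<and> card F = k \<and>
    (\<forall>j<n. N j \<in> F) \<and> centre_cost N \<le> (8 + 16 / q) * l))" (is "htr u W _ _ ?Q")
  unfolding p_main_def
proof (rule htr_Sq[OF htr_p_dist])
  let ?p12 = "p_nearest m_open 26 27 ;; p_output"
  let ?p11 = "p_pad ;; ?p12"
  let ?p10 = "p_open ;; ?p11"
  let ?p9 = "p_colour ;; ?p10"
  let ?p8 = "p_top ;; ?p9"
  let ?p7 = "p_nearest m_other 22 23 ;; ?p8"
  let ?p6 = "p_count ;; ?p7"
  let ?p5 = "p_weights ;; ?p6"
  let ?p4 = "p_nearest m_assign 19 20 ;; ?p5"
  let ?p3 = "p_cluster q ;; ?p4"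
  let ?p2 = "p_cost ;; ?p3"
  let ?p1 = "p_perceptron q ;; ?p2"
  fix \<tau>1 assume d1: "has_dist \<tau>1" and f1: "\<And>k. k \<notin> mods p_dist \<Longrightarrow> \<tau>1 k = (\<lambda>_ _. 0)"
  note f1 = f1[unfolded mods_phases]
  show "htr u W ?p1 \<tau>1 ?Q"
  proof (rule htr_Sq[OF htr_p_perceptron[OF z d1]])
    show "\<tau>1 16 i j = 0" for i j using f1[of 16] by simp
    fix \<tau>2 assume s2: "sat cons (vars \<tau>2) \<and> (\<forall>i\<le>n. \<forall>j\<le>n. \<bar>vars \<tau>2 i j\<bar> \<le> U)"
      and f2: "\<And>k. k \<notin> mods (p_perceptron q) \<Longrightarrow> \<tau>2 k = \<tau>1 k"
    note f2 = f2[unfolded mods_phases]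
    define w where "w = vars \<tau>2"
    have w: "feasible w" using s2 feasible by (simp add: w_def)
    have hd: "has_dist \<tau>" if "\<tau> 15 = \<tau>2 15" for \<tau>
      using that d1 f2[of 15] by (simp add: has_dist_def)
    show "htr u W ?p2 \<tau>2 ?Q"
    proof (rule htr_Sq[OF htr_p_cost[OF hd[of \<tau>2, OF refl] conjunct2[OF s2]]])
      fix \<tau>3 assume c3: "\<forall>j<n. \<tau>3 17 (int j) 0 = cst (vars \<tau>2) j"
        and f3: "\<And>k. k \<notin> mods p_cost \<Longrightarrow> \<tau>3 k = \<tau>2 k"
      note f3 = f3[unfolded mods_phases]
      have c3: "\<tau>3 17 (int j) 0 = cst w j" if "j < n" for j using c3 that by (simp add: w_def)
      have w3: "vars \<tau>3 n n = w n n" using f3[of 16] by (simp add: vars_def w_def)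
      show "htr u W ?p3 \<tau>3 ?Q"
      proof (rule htr_Sq[OF htr_p_cluster[where C = "cst w"]])
        show "has_dist \<tau>3" by (rule hd) (simp add: f3)
        show "\<tau>3 17 (int j) 0 = cst w j" if "j < n" for j using c3 that .
        show "0 \<le> cst w j \<and> cst w j \<le> 30 * int n ^ 2 * U" if "j < n" for j
          using cst_nonneg[OF w that] abs_cst_le[of w j] s2 that by (auto simp: w_def)
        show "0 \<le> vars \<tau>3 n n" using w w3 by (simp add: feasible_def)
        show "\<tau>3 18 (int i) 0 = 0" for i using f3[of 18] f2[of 18] f1[of 18] by simp
        fix \<tau>4 assume i4: "ind 18 \<tau>4 \<and> cluster_inv (vars \<tau>3 n n) (cst w) {..<n} (sel 18 \<tau>4)"
          and f4: "\<And>k. k \<notin> mods (p_cluster q) \<Longrightarrow> \<tau>4 k = \<tau>3 k"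
        note f4 = f4[unfolded mods_phases]
        define R where "R = sel 18 \<tau>4"
        have R: "cluster_inv (w n n) (cst w) {..<n} R" using i4 w3 by (simp add: R_def)
        have Rn: "R \<subseteq> {..<n}" using R by (simp add: cluster_inv_def)
        have R4: "\<tau>4 18 (int i) 0 = of_bool (i \<in> R)" if "i < n" for i
          using i4 that by (simp add: ind_def R_def)
        interpret fc: fractional_clustering n k l q "\<lambda>i j. of_int (d i j)" "\<lambda>i j. w i j / w n n" "\<lambda>i. w i n / w n n"
          "\<lambda>j. cst w j / w n n" R by (rule fractional_clustering[OF w R])
        show "htr u W ?p4 \<tau>4 ?Q"
        proof (rule htr_Sq[OF htr_p_nearest[where mk = "\<lambda>i j. i \<in> R \<and> cst w i \<le> cst w j"]])
          show "has_dist \<tau>4" by (rule hd) (simp add: f3 f4)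
          fix i j and \<tau> :: state assume "i < n" "j < n" "\<And>k. k \<notin> {1, 2, 8, 19, 20} \<Longrightarrow> \<tau> k = \<tau>4 k" "\<tau> 1 0 0 = int i" "\<tau> 2 0 0 = int j"
          then show "ev u m_assign \<tau> = of_bool (i \<in> R \<and> cst w i \<le> cst w j)"
            using R4 c3 by (simp add: m_assign_def f4)
        next
          fix \<tau>5 assume n5: "\<forall>j<n. nearest (\<lambda>i j. i \<in> R \<and> cst w i \<le> cst w j) n j (\<tau>5 19 (int j) 0) (\<tau>5 20 (int j) 0)"
            and f5: "\<And>k. k \<notin> mods (p_nearest m_assign 19 20) \<Longrightarrow> \<tau>5 k = \<tau>4 k"
          note f5 = f5[unfolded mods_phases]
          define rp where "rp = (\<lambda>j. nat (\<tau>5 20 (int j) 0))"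
          have rp: "rp j \<in> R \<and> cst w (rp j) \<le> cst w j \<and> close (w n n) (cst w) (rp j) j" "\<tau>5 20 (int j) 0 = int (rp j)"
            if j: "j < n" for j
          proof -
            obtain i where i: "i \<in> R" "cst w i \<le> cst w j" "close (w n n) (cst w) i j"
              using R j unfolding cluster_inv_def by blast
            note ne = nearest_exists[OF n5[rule_format, OF j], of i]
            have "i < n" using i Rn by auto
            note ne = ne[OF this conjI[OF i(1,2)]]
            have "w n n * d (rp j) j \<le> w n n * d i j"
              using ne(5)[of i] i \<open>i < n\<close> w by (intro mult_left_mono) (auto simp: rp_def feasible_def)
            then have "close (w n n) (cst w) (rp j) j" using i(3) by (simp add: close_def)
            then show "rp j \<in> R \<and> cst w (rp j) \<le> cst w j \<and> close (w n n) (cst w) (rp j) j"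
              using ne(2) by (simp add: rp_def)
            show "\<tau>5 20 (int j) 0 = int (rp j)" using ne(3) by (simp only: rp_def)
          qed
          show "htr u W ?p5 \<tau>5 ?Q"
          proof (rule htr_Sq[OF htr_p_weights])
            fix \<tau>6 assume w6: "\<forall>j<n. \<tau>6 21 (int j) 0 = int (card {i. i < n \<and> \<tau>5 20 (int i) 0 = int j})"
              and f6: "\<And>k. k \<notin> mods p_weights \<Longrightarrow> \<tau>6 k = \<tau>5 k"
            note f6 = f6[unfolded mods_phases]
            define wt where "wt = (\<lambda>j. card {a. a < n \<and> rp a = j})"
            have wt: "\<tau>6 21 (int j) 0 = int (wt j)" if "j < n" for j
            proof -
              have "{i. i < n \<and> \<tau>5 20 (int i) 0 = int j} = {a. a < n \<and> rp a = j}" using rp(2) by auto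
              then show ?thesis using w6 that by (simp add: wt_def)
            qed
            have wt_le: "wt j \<le> n" for j
              using card_mono[of "{..<n}" "{a. a < n \<and> rp a = j}"] by (auto simp: wt_def)
            show "htr u W ?p6 \<tau>6 ?Q"
            proof (rule htr_Sq[OF htr_p_count[OF Rn]])
              show "\<tau>6 18 (int i) 0 = of_bool (i \<in> R)" if "i < n" for i
                using R4[OF that] f6[of 18] f5[of 18] by simp
              fix \<tau>7 assume c7: "\<tau>7 10 0 0 = int (card R)" and f7: "\<And>k. k \<notin> mods p_count \<Longrightarrow> \<tau>7 k = \<tau>6 k"
              note f7 = f7[unfolded mods_phases]
              show "htr u W ?p7 \<tau>7 ?Q"
              proof (rule htr_Sq[OF htr_p_nearest[where mk = "\<lambda>i j. i \<in> R \<and> i \<noteq> j"]])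
                show "has_dist \<tau>7" by (rule hd) (simp add: f3 f4 f5 f6 f7)
                fix i j and \<tau> :: state assume "i < n" "j < n" "\<And>k. k \<notin> {1, 2, 8, 22, 23} \<Longrightarrow> \<tau> k = \<tau>7 k" "\<tau> 1 0 0 = int i" "\<tau> 2 0 0 = int j"
                then show "ev u m_other \<tau> = of_bool (i \<in> R \<and> i \<noteq> j)"
                  using R4 by (simp add: m_other_def f5 f6 f7)
              next
                fix \<tau>8 assume n8: "\<forall>j<n. nearest (\<lambda>i j. i \<in> R \<and> i \<noteq> j) n j (\<tau>8 22 (int j) 0) (\<tau>8 23 (int j) 0)"
                  and f8: "\<And>k. k \<notin> mods (p_nearest m_other 22 23) \<Longrightarrow> \<tau>8 k = \<tau>7 k"
                note f8 = f8[unfolded mods_phases]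
                define r where "r = (\<lambda>j. \<tau>8 22 (int j) 0)"
                define N where "N = (\<lambda>j. nat (\<tau>8 23 (int j) 0))"
                have rb: "0 \<le> r j \<and> r j \<le> 30 * int n + 1" if "j < n" for j
                  using nearest_bounds[OF n8[rule_format, OF that] order_refl that] by (simp add: r_def)
                have Nb: "\<tau>8 23 (int j) 0 = int (N j) \<and> N j < n" if "j < n" for j
                  using nearest_less[OF n8[rule_format, OF that]] by (simp only: N_def)
                have r_le: "r j \<le> d i j" if "i \<in> R" "j \<in> R" "i \<noteq> j" for i j
                proof -
                  have "i < n" "j < n" using that Rn by auto
                  then show ?thesis using nearest_exists[OF n8[rule_format, of j], of i] that by (simp add: r_def)
                qed
                have N_R: "N j \<in> R \<and> N j \<noteq> j \<and> d (N j) j = r j" if "i \<in> R" "j \<in> R" "i \<noteq> j" for i j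
                proof -
                  have "i < n" "j < n" using that Rn by auto
                  then show ?thesis using nearest_exists[OF n8[rule_format, of j], of i] that by (simp add: r_def N_def)
                qed
                define v where "v = (\<lambda>j. int (wt j) * max 0 (r j - 2))"
                show "htr u W ?p8 \<tau>8 ?Q"
                proof (rule htr_Sq[OF htr_p_top[OF Rn fc.card_R, where v = v]])
                  show "\<tau>8 18 (int i) 0 = of_bool (i \<in> R)" if "i < n" for i
                    using R4[OF that] by (simp add: f5 f6 f7 f8)
                  show "\<tau>8 10 0 0 = int (card R)" using c7 by (simp add: f8)
                  show "\<tau>8 11 0 0 = 0" "\<tau>8 24 (int i) 0 = 0" for i by (simp_all add: f1 f2 f3 f4 f5 f6 f7 f8)
                  show "\<tau>8 21 (int j) 0 * max 0 (\<tau>8 22 (int j) 0 - 2) = v j" if "j < n" for j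
                    using wt[OF that] by (simp add: f7 f8 v_def r_def)
                  show "0 \<le> v j \<and> v j < 40 * int n ^ 2" if "j < n" for j
                  proof -
                    have "v j \<le> int n * (30 * int n)"
                      unfolding v_def using wt_le[of j] rb[OF that] n_pos by (intro mult_mono) auto
                    moreover have "0 < int n ^ 2" using n_pos by simp
                    ultimately show ?thesis by (simp add: v_def power2_eq_square)
                  qed
                  fix \<tau>9 assume "\<exists>T\<subseteq>R. card T = min (card R) (2 * k - card R) \<and>
                      (\<forall>i<n. \<tau>9 24 (int i) 0 = (if i \<in> T then 3 else 0)) \<and> (\<forall>i\<in>T. \<forall>j\<in>R - T. v j \<le> v i)"
                    and f9: "\<And>k. k \<notin> mods p_top \<Longrightarrow> \<tau>9 k = \<tau>8 k"
                  then obtain T where T: "T \<subseteq> R" "card T = min (card R) (2 * k - card R)"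
                    "\<And>i. i < n \<Longrightarrow> \<tau>9 24 (int i) 0 = (if i \<in> T then 3 else 0)"
                    "\<And>i j. i \<in> T \<Longrightarrow> j \<in> R - T \<Longrightarrow> v j \<le> v i" by blast
                  note f9 = f9[unfolded mods_phases]
                  \<comment> \<open>The default of \<open>p_nearest\<close> does not occur here: if
                    \<open>j\<close> were the only representative, then
                    \<open>card R = 1 \<le> k\<close> would put it into \<open>T\<close>.\<close>
                  have N_T: "N j \<in> R \<and> N j \<noteq> j \<and> d (N j) j = r j" if j: "j \<in> R - T" for j
                  proof -
                    have "\<exists>i\<in>R. i \<noteq> j"
                    proof (rule ccontr)
                      assume "\<not> (\<exists>i\<in>R. i \<noteq> j)"
                      then have "R = {j}" using j by auto
                      then have "T = R" using T(1,2) kn fc.fin_R by (intro card_subset_eq) auto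
                      then show False using j by auto
                    qed
                    then show ?thesis using N_R j by blast
                  qed
                  have rp': "rp j \<in> R \<and> cst w (rp j) / w n n \<le> cst w j / w n n \<and>
                      real_of_int (d (rp j) j) \<le> 2 + 4 * (cst w j / w n n)" if "j < n" for j
                  proof -
                    have z: "0 < real_of_int (w n n)" using w by (simp add: feasible_def)
                    have "w n n * d (rp j) j \<le> 2 * w n n + 4 * cst w j" using rp(1)[OF that] by (simp add: close_def)
                    then have "real_of_int (w n n * d (rp j) j) \<le> real_of_int (2 * w n n + 4 * cst w j)"
                      by (simp only: of_int_le_iff)
                    then show ?thesis using z rp(1)[OF that] by (simp add: field_simps)
                  qed
                  interpret C: centrum_rounding n k l q "\<lambda>i j. of_int (d i j)" "\<lambda>i j. w i j / w n n" "\<lambda>i. w i n / w n n"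
                    "\<lambda>j. cst w j / w n n" R rp "\<lambda>j. of_int (r j)" T
                  proof
                    show "real_of_int (r j) \<le> real_of_int (d i j)" if "i \<in> R" "j \<in> R" "i \<noteq> j" for i j
                      using r_le[OF that] by simp
                    show "real (card {a. a < n \<and> rp a = j}) * max 0 (real_of_int (r j) - 2)
                        \<le> real (card {a. a < n \<and> rp a = i}) * max 0 (real_of_int (r i) - 2)" if "i \<in> T" "j \<in> R - T" for i j
                    proof -
                      have "real_of_int (v a) = real (card {x. x < n \<and> rp x = a}) * max 0 (real_of_int (r a) - 2)" for a
                        by (simp add: v_def wt_def max_def)
                      then show ?thesis using T(4)[OF that] by (metis of_int_le_iff)
                    qed
                  qed (use rp' T in auto)
                  show "htr u W ?p9 \<tau>9 ?Q"
                  proof (rule htr_Sq[OF htr_p_colour[OF Rn T(1), where r = r and N = N]])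
                    show "\<tau>9 18 (int i) 0 = of_bool (i \<in> R)" if "i < n" for i
                      using R4[OF that] by (simp add: f5 f6 f7 f8 f9)
                    show "\<tau>9 24 (int i) 0 = (if i \<in> T then 3 else 0)" if "i < n" for i by (rule T(3)[OF that])
                    show "\<tau>9 22 (int i) 0 = r i \<and> 0 \<le> r i \<and> r i \<le> 30 * int n + 1" if "i < n" for i
                      using rb[OF that] by (simp add: r_def f9)
                    show "\<tau>9 23 (int i) 0 = int (N i) \<and> N i < n" if "i < n" for i
                      using Nb[OF that] by (simp add: f9)
                    show "N j \<in> R \<and> N j \<noteq> j \<and> d (N j) j = r j" if "j \<in> R - T" for j using N_T[OF that] .
                    show "r j \<le> d i j" if "i \<in> R" "j \<in> R" "i \<noteq> j" for i j using r_le[OF that] .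
                    fix \<tau>10 assume c10: "colour_inv R T r R (\<lambda>i. \<tau>10 24 (int i) 0)"
                      and f10: "\<And>k. k \<notin> mods p_colour \<Longrightarrow> \<tau>10 k = \<tau>9 k"
                    note f10 = f10[unfolded mods_phases]
                    define c where "c = (\<lambda>i. \<tau>10 24 (int i) 0)"
                    have c: "colour_inv R T r R c" using c10 by (simp add: c_def)
                    show "htr u W ?p10 \<tau>10 ?Q"
                    proof (rule htr_Sq[OF htr_p_open[where c = c]])
                      show "\<tau>10 24 (int i) 0 = c i" for i by (simp add: c_def)
                      fix \<tau>11 assume "\<exists>b\<in>{1, 2}. card {i. i < n \<and> c i = b} \<le> card {i. i < n \<and> c i = 3 - b} \<and>
                        (\<forall>i<n. \<tau>11 25 (int i) 0 = of_bool (c i = 3 \<or> c i = b)) \<and>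
                        \<tau>11 14 0 0 = int (card {i. i < n \<and> (c i = 3 \<or> c i = b)})"
                        and f11: "\<And>k. k \<notin> mods p_open \<Longrightarrow> \<tau>11 k = \<tau>10 k"
                      then obtain b where b: "b \<in> {1, 2}" "card {i. i < n \<and> c i = b} \<le> card {i. i < n \<and> c i = 3 - b}"
                        "\<And>i. i < n \<Longrightarrow> \<tau>11 25 (int i) 0 = of_bool (c i = 3 \<or> c i = b)"
                        "\<tau>11 14 0 0 = int (card {i. i < n \<and> (c i = 3 \<or> c i = b)})" by blast
                      note f11 = f11[unfolded mods_phases]
                      define F where "F = {i. i < n \<and> (c i = 3 \<or> c i = b)}"
                      note open_F = colour_open[OF c Rn T(1,2) b(1,2) fc.card_R, folded F_def]
                      show "htr u W ?p11 \<tau>11 ?Q"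
                      proof (rule htr_Sq[OF htr_p_pad[of F]])
                        show "F \<subseteq> {..<n}" "card F \<le> k" using open_F(1) by (auto simp: F_def)
                        show "\<tau>11 25 (int i) 0 = of_bool (i \<in> F)" if "i < n" for i
                          using b(3)[OF that] that by (simp add: F_def)
                        show "\<tau>11 14 0 0 = int (card F)" using b(4) by (simp add: F_def)
                        fix \<tau>12 assume "\<exists>G. F \<subseteq> G \<and> G \<subseteq> {..<n} \<and> card G = k \<and> (\<forall>i<n. \<tau>12 25 (int i) 0 = of_bool (i \<in> G))"
                          and f12: "\<And>k. k \<notin> mods p_pad \<Longrightarrow> \<tau>12 k = \<tau>11 k"
                        then obtain G where G: "F \<subseteq> G" "G \<subseteq> {..<n}" "card G = k"
                          "\<And>i. i < n \<Longrightarrow> \<tau>12 25 (int i) 0 = of_bool (i \<in> G)" by blast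
                        note f12 = f12[unfolded mods_phases]
                        show "htr u W ?p12 \<tau>12 ?Q"
                        proof (rule htr_Sq[OF htr_p_nearest[where mk = "\<lambda>i j. i \<in> G"]])
                          show "has_dist \<tau>12" by (rule hd) (simp add: f3 f4 f5 f6 f7 f8 f9 f10 f11 f12)
                          fix i j and \<tau> :: state assume "i < n" "j < n" "\<And>k. k \<notin> {1, 2, 8, 26, 27} \<Longrightarrow> \<tau> k = \<tau>12 k" "\<tau> 1 0 0 = int i" "\<tau> 2 0 0 = int j"
                          then show "ev u m_open \<tau> = of_bool (i \<in> G)"
                            using G(4) by (simp add: m_open_def)
                        next
                          fix \<tau>13 assume n13: "\<forall>j<n. nearest (\<lambda>i j. i \<in> G) n j (\<tau>13 26 (int j) 0) (\<tau>13 27 (int j) 0)"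
                            and f13: "\<And>k. k \<notin> mods (p_nearest m_open 26 27) \<Longrightarrow> \<tau>13 k = \<tau>12 k"
                          note f13 = f13[unfolded mods_phases]
                          define M where "M = (\<lambda>j. nat (\<tau>13 27 (int j) 0))"
                          have "G \<noteq> {}" using G(3) kn by auto
                          then obtain g where g: "g \<in> G" "g < n" using G(2) by auto
                          have M: "M j \<in> G" "M j < n" "\<tau>13 27 (int j) 0 = int (M j)" "\<And>i. i \<in> G \<Longrightarrow> d (M j) j \<le> d i j"
                            if "j < n" for j
                          proof -
                            note ne = nearest_exists[OF n13[rule_format, OF that] g(2,1)]
                            show "M j \<in> G" "M j < n" using ne(1,2) by (simp_all add: M_def)
                            show "\<tau>13 27 (int j) 0 = int (M j)" using ne(3) by (simp only: M_def)
                            show "d (M j) j \<le> d i j" if "i \<in> G" for i using ne(5)[of i] G(2) that by (auto simp: M_def)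
                          qed
                          have "centre_cost M \<le> (8 + 16 / q) * l"
                            unfolding centre_cost_def
                          proof (rule C.rounding_cost)
                            show "G \<subseteq> {..<n}" by (rule G(2))
                            show "T \<subseteq> G" using open_F(2) G(1) by auto
                            show "\<exists>i\<in>G. real_of_int (d i j) \<le> real_of_int (r j) \<or> i = j" if "j \<in> R - T" for j
                              using open_F(3)[OF that] G(1) by auto
                            show "real_of_int (d (M j) j) \<le> real_of_int (d i j)" if "i \<in> G" "j < n" for i j
                              using M(4)[OF that(2,1)] by simp
                            show "real_of_int (d i i) = 0" if "i < n" for i using d_self[OF that] by simp
                          qed
                          moreover have "htr u W p_output \<tau>13 (\<lambda>\<tau>. \<tau> 0 0 0 = int (2 * n) \<and>
                            map (\<lambda>a. \<tau> 0 a 0) [1..int (2 * n)] = encode_solution n G M)"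
                          proof (rule htr_p_output)
                            show "\<tau>13 25 (int i) 0 = of_bool (i \<in> G)" if "i < n" for i
                              using G(4)[OF that] by (simp add: f13)
                            show "\<tau>13 27 (int i) 0 = int (M i) \<and> M i < n" if "i < n" for i using M[OF that] by simp
                          qed
                          ultimately show "htr u W p_output \<tau>13 ?Q"
                            using G(2,3) M(1) by (elim htr_conseq) blast
                        qed simp_all
                      qed
                    qed
                  qed
                qed
              qed simp_all
            qed
          qed
        qed simp_all
      qed
    qed
  qed
qed

end

section \<open>Correctness on encoded instances\<close>

lemma nth_concat_map:
  assumes len: "\<And>i. i < n \<Longrightarrow> length (g i) = m" and "i < n" "r < m"
  shows "concat (map g [0..<n]) ! (i * m + r) = g i ! r" and "length (concat (map g [0..<n])) = n * m"
proof -
  have *: "length (concat (map g [0..<n'])) = n' * m" if "n' \<le> n" for n'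
    using that len by (induction n') auto
  then show "length (concat (map g [0..<n])) = n * m" by simp
  have "concat (map g [0..<n']) ! (i * m + r) = g i ! r" if "i < n'" "n' \<le> n" for n'
    using that
  proof (induction n')
    case (Suc n')
    have l: "length (concat (map g [0..<n'])) = n' * m" using * Suc.prems by simp
    show ?case
    proof (cases "i = n'")
      case True
      then show ?thesis using l by (simp add: nth_append)
    next
      case False
      then have "Suc i * m \<le> n' * m" using Suc.prems by (intro mult_le_mono1) simp
      then have "i * m + r < n' * m" using assms(3) by simp
      then show ?thesis using l Suc False by (simp add: nth_append)
    qed
  qed simp
  then show "concat (map g [0..<n]) ! (i * m + r) = g i ! r" using assms(2) by blast
qed

lemma length_encode_instance: "length (encode_instance (n, k, l, c, B)) = 5 + n * (n * 2)"
proof -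
  have "length (concat (map (\<lambda>j. encode_rat (c i j)) [0..<m])) = m * 2" for i m
    by (induction m) (auto simp: encode_rat_def)
  then have "length (concat (map (\<lambda>i. concat (map (\<lambda>j. encode_rat (c i j)) [0..<n])) [0..<m])) = m * (n * 2)" for m
    by (induction m) auto
  then show ?thesis by (simp add: encode_rat_def)
qed

lemma input_memory_encode:
  fixes n k l c B
  defines "u \<equiv> input_memory (encode_instance (n, k, l, c, B))"
  shows "u 1 = int n" "u 2 = int k" "u 3 = int l" "u 4 = fst (quotient_of B)" "u 5 = snd (quotient_of B)"
    and "\<And>i j. i < n \<Longrightarrow> j < n \<Longrightarrow> u (6 + 2 * (int i * int n + int j)) = fst (quotient_of (c i j))"
    and "\<And>i j. i < n \<Longrightarrow> j < n \<Longrightarrow> u (7 + 2 * (int i * int n + int j)) = snd (quotient_of (c i j))"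
proof -
  let ?xs = "encode_instance (n, k, l, c, B)"
  have u: "u (int a + 1) = ?xs ! a" if "a < length ?xs" for a
    using that by (simp add: u_def input_memory_def)
  show "u 1 = int n" using u[of 0] by (simp add: length_encode_instance del: encode_instance.simps) (simp add: encode_rat_def)
  show "u 2 = int k" using u[of 1] by (simp add: length_encode_instance del: encode_instance.simps) (simp add: encode_rat_def)
  show "u 3 = int l" using u[of 2] by (simp add: length_encode_instance del: encode_instance.simps) (simp add: encode_rat_def)
  show "u 4 = fst (quotient_of B)" using u[of 3] by (simp add: length_encode_instance del: encode_instance.simps) (simp add: encode_rat_def)
  show "u 5 = snd (quotient_of B)" using u[of 4] by (simp add: length_encode_instance del: encode_instance.simps) (simp add: encode_rat_def)
  fix i j assume ij: "i < n" "j < n"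
  define row where "row = (\<lambda>i. concat (map (\<lambda>j. encode_rat (c i j)) [0..<n]))"
  have row_len: "length (row i) = n * 2" for i
    using nth_concat_map(2)[of n "\<lambda>j. encode_rat (c i j)" 2 0 0] ij by (simp add: row_def encode_rat_def)
  have entry: "concat (map row [0..<n]) ! (i * (n * 2) + (j * 2 + b)) = encode_rat (c i j) ! b" if "b < 2" for b
  proof -
    have "j * 2 + b < n * 2" using ij(2) that by simp
    then have "concat (map row [0..<n]) ! (i * (n * 2) + (j * 2 + b)) = row i ! (j * 2 + b)"
      using ij by (intro nth_concat_map(1) row_len) auto
    also have "\<dots> = encode_rat (c i j) ! b"
      unfolding row_def using ij that by (intro nth_concat_map(1)) (auto simp: encode_rat_def)
    finally show ?thesis .
  qed
  have lt: "5 + (i * (n * 2) + (j * 2 + b)) < length ?xs" if "b < 2" for b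
  proof -
    have "Suc i * (n * 2) \<le> n * (n * 2)" using ij by (intro mult_le_mono1) simp
    moreover have "j * 2 + b < n * 2" using ij(2) that by simp
    ultimately show ?thesis unfolding length_encode_instance by simp
  qed
  have xs: "?xs = [int n, int k, int l, fst (quotient_of B), snd (quotient_of B)] @ concat (map row [0..<n])"
    by (simp add: encode_rat_def row_def)
  have get: "?xs ! (5 + (i * (n * 2) + (j * 2 + b))) = encode_rat (c i j) ! b" if "b < 2" for b
    unfolding xs using entry[OF that] by (simp add: nth_append)
  have "u (int (5 + (i * (n * 2) + (j * 2 + 0))) + 1) = fst (quotient_of (c i j))"
    using u[OF lt[of 0]] get[of 0] by (simp add: encode_rat_def del: encode_instance.simps)
  moreover have "int (5 + (i * (n * 2) + (j * 2 + 0))) + 1 = 6 + 2 * (int i * int n + int j)" by simp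
  ultimately show "u (6 + 2 * (int i * int n + int j)) = fst (quotient_of (c i j))" by (simp only:)
  have "u (int (5 + (i * (n * 2) + (j * 2 + 1))) + 1) = snd (quotient_of (c i j))"
    using u[OF lt[of 1]] get[of 1] by (simp add: encode_rat_def del: encode_instance.simps)
  moreover have "int (5 + (i * (n * 2) + (j * 2 + 1))) + 1 = 7 + 2 * (int i * int n + int j)" by simp
  ultimately show "u (7 + 2 * (int i * int n + int j)) = snd (quotient_of (c i j))" by (simp only:)
qed

lemma le_input_size: "n \<le> input_size (encode_instance (n, k, l, c, B))"
proof -
  let ?xs = "encode_instance (n, k, l, c, B)"
  have "length ?xs \<le> input_size ?xs"
    unfolding input_size_def using sum_list_mono[of ?xs "\<lambda>_. 1" int_size] int_size_pos by (simp add: sum_list_triv)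
  moreover have "n \<le> n * (n * 2)" by (cases n) auto
  ultimately show ?thesis unfolding length_encode_instance by linarith
qed

lemma real_of_rat_quotient:
  "real_of_rat r = real_of_int (fst (quotient_of r)) / real_of_int (snd (quotient_of r))"
proof -
  have "r = of_int (fst (quotient_of r)) / of_int (snd (quotient_of r))"
    by (rule quotient_of_div) simp
  then have "real_of_rat r = real_of_rat (of_int (fst (quotient_of r)) / of_int (snd (quotient_of r)))" by simp
  then show ?thesis by (simp add: of_rat_divide)
qed

section \<open>Rescaled distances and positivity of the bound\<close>

definition scaled_dist :: "nat \<Rightarrow> nat \<Rightarrow> (nat \<Rightarrow> nat \<Rightarrow> rat) \<Rightarrow> rat \<Rightarrow> nat \<Rightarrow> nat \<Rightarrow> int" where
  "scaled_dist n l c B i j = min \<lceil>real_dist c i j / (real_of_rat B / l)\<rceil> (30 * int n)"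

lemma scaled_dist_eq:
  assumes "0 < B" "0 < l"
  shows "scaled_dist n l c B i j =
    min (- ((- (fst (quotient_of (c i j)) * int l * snd (quotient_of B))) div (snd (quotient_of (c i j)) * fst (quotient_of B))))
      (30 * int n)"
proof -
  let ?p = "fst (quotient_of (c i j))" and ?r = "snd (quotient_of (c i j))"
  let ?a = "fst (quotient_of B)" and ?b = "snd (quotient_of B)"
  have "0 < ?r" "0 < ?b" by (rule quotient_of_denom_pos')+
  have "real_dist c i j / (real_of_rat B / l) = real_of_int (?p * int l * ?b) / real_of_int (?r * ?a)"
    unfolding real_of_rat_quotient using \<open>0 < ?r\<close> \<open>0 < ?b\<close> by (simp add: field_simps)
  then show ?thesis unfolding scaled_dist_def by (simp only: ceiling_divide_eq_div)
qed

lemma lp_feasible_pos: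
  assumes "lp_feasible {..<n} k x y" "0 < n"
  shows "1 \<le> k"
proof -
  have "1 \<le> (\<Sum>i<n. x i 0)" using assms by (simp add: lp_feasible_def)
  also have "\<dots> \<le> (\<Sum>i<n. y i)" using assms by (intro sum_mono) (auto simp: lp_feasible_def)
  finally show ?thesis using assms by (simp add: lp_feasible_def)
qed

lemma lp_opt_less:
  assumes "lp_opt D c k l B < ereal b"
  obtains x y where "lp_feasible D k x y" "(\<Sum>j\<in>D. \<Sum>i\<in>D. thresh l B (c i j) * x i j) < b"
  using assms unfolding lp_opt_def by (auto simp: INF_less_iff)

text \<open>With fewer centers than points, some client is at least partially assigned to another point.\<close>

lemma lp_opt_bound_pos:
  assumes M: "Metric_space {..<n} c" and k: "k < n" and B: "0 \<le> B" and opt: "lp_opt {..<n} c k l B \<le> ereal B"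
  shows "0 < B"
proof (rule ccontr)
  assume "\<not> 0 < B"
  then have B0: "B = 0" using B by simp
  interpret Metric_space "{..<n}" c by fact
  let ?S = "(\<lambda>(i, j). c i j) ` {(i, j). i < n \<and> j < n \<and> i \<noteq> j}"
  have "{(i, j). i < n \<and> j < n \<and> i \<noteq> j} \<subseteq> {..<n} \<times> {..<n}" by auto
  then have fin: "finite (insert 1 ?S)" by (meson finite_SigmaI finite_imageI finite_insert finite_lessThan finite_subset)
  \<comment> \<open>A positive lower bound for all distances between different points; the
    \<open>1\<close> covers the case of a single point.\<close>
  define \<delta> where "\<delta> = Min (insert 1 ?S)"
  have "\<delta> \<in> insert 1 ?S" unfolding \<delta>_def using fin by (intro Min_in) auto
  then have \<delta>: "0 < \<delta>" by (auto intro!: mdist_pos_less)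
  have \<delta>_le: "\<delta> \<le> c i j" if "i < n" "j < n" "i \<noteq> j" for i j
    unfolding \<delta>_def using fin that by (intro Min_le) auto
  have "lp_opt {..<n} c k l B < ereal \<delta>" using opt \<delta> B0 by (metis ereal_less(2) le_less_trans zero_ereal_def)
  then obtain x y where xy: "lp_feasible {..<n} k x y" "(\<Sum>j<n. \<Sum>i<n. thresh l B (c i j) * x i j) < \<delta>"
    by (rule lp_opt_less)
  have x0: "0 \<le> x i j" "x i j \<le> y i" if "i < n" "j < n" for i j using xy(1) that by (auto simp: lp_feasible_def)
  \<comment> \<open>With \<open>B = 0\<close> every positive distance passes the threshold, and at
    most \<open>y j\<close> of client \<open>j\<close> is served by \<open>j\<close> itself. Summed
    over \<open>j\<close>, the cost is at least \<open>\<delta> * (n - k) \<ge> \<delta>\<close>, a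
    contradiction.\<close>
  have "\<delta> * (1 - y j) \<le> (\<Sum>i<n. thresh l B (c i j) * x i j)" if j: "j < n" for j
  proof -
    have "1 - y j \<le> (\<Sum>i<n. x i j) - x j j"
      using xy(1) j x0[OF j j] by (auto simp: lp_feasible_def intro!: diff_mono)
    also have "\<dots> = (\<Sum>i\<in>{..<n} - {j}. x i j)" using j by (simp add: sum_diff1)
    finally have "\<delta> * (1 - y j) \<le> \<delta> * (\<Sum>i\<in>{..<n} - {j}. x i j)" using \<delta> by (intro mult_left_mono) auto
    also have "\<dots> \<le> (\<Sum>i\<in>{..<n} - {j}. thresh l B (c i j) * x i j)"
      unfolding sum_distrib_left
    proof (rule sum_mono)
      fix i assume "i \<in> {..<n} - {j}"
      then have "\<delta> \<le> c i j" "0 \<le> x i j" using \<delta>_le[of i j] x0[of i j] j by auto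
      then show "\<delta> * x i j \<le> thresh l B (c i j) * x i j"
        using \<delta> by (simp add: thresh_def B0 mult_right_mono)
    qed
    also have "\<dots> \<le> (\<Sum>i<n. thresh l B (c i j) * x i j)"
      using j x0 by (intro sum_mono2) (auto simp: thresh_def)
    finally show ?thesis .
  qed
  then have "(\<Sum>j<n. \<delta> * (1 - y j)) \<le> (\<Sum>j<n. \<Sum>i<n. thresh l B (c i j) * x i j)" by (intro sum_mono) auto
  also have "\<dots> < \<delta>" by (rule xy)
  finally have "\<delta> * (real n - (\<Sum>j<n. y j)) < \<delta> * 1" by (simp add: sum_distrib_left[symmetric] sum_subtractf)
  then have "real n - (\<Sum>j<n. y j) < 1" using \<delta> by (simp only: mult_less_cancel_left_pos)
  moreover have "(\<Sum>j<n. y j) \<le> k" using xy(1) by (simp add: lp_feasible_def)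
  ultimately show False using k by simp
qed

lemma centrum_algorithm:
  assumes I: "(n, k, l, c, B) \<in> admissible_instances \<epsilon>" and q: "1 \<le> q"
    and W: "1000 * int q * int n ^ 3 * (4665600000000 * int q ^ 6 * int n ^ 18) \<le> W"
  shows "htr (input_memory (encode_instance (n, k, l, c, B))) W (p_main q) (\<lambda>_ _ _. 0)
    (\<lambda>\<tau>. \<tau> 0 0 0 = int (2 * n) \<and> (\<exists>F N. map (\<lambda>a. \<tau> 0 a 0) [1..int (2 * n)] = encode_solution n F N \<and>
       centrum_solution {..<n} k F N \<and>
       centrum_cost {..<n} (real_dist c) l N \<le> (12 + 16 / q) * real_of_rat B))"
proof -
  let ?B = "real_of_rat B" and ?c = "real_dist c"
  have M: "Metric_space {..<n} ?c" and kn: "k < n" and l: "1 \<le> l" "l \<le> n" and B0: "0 \<le> B"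
    and opt: "lp_opt {..<n} ?c k l ?B \<le> ereal ?B"
    using I by (auto simp: admissible_instances_def)
  interpret Metric_space "{..<n}" ?c by (rule M)
  have B: "0 < ?B" by (rule lp_opt_bound_pos[OF M kn _ opt]) (use B0 in simp)
  then have Bp: "0 < B" by simp
  define t where "t = ?B / l"
  have t: "0 < t" using B l by (simp add: t_def)
  define d where "d = scaled_dist n l c B"
  have dd: "d i j = min \<lceil>?c i j / t\<rceil> (30 * int n)" for i j by (simp add: d_def scaled_dist_def t_def)
  note u = input_memory_encode[where n = n and k = k and l = l and c = c and B = B]
  \<comment> \<open>The optimum is an infimum. Instead of showing that it is attained, a solution
    slightly above it is taken, which is possible as \<open>B\<close> is positive; the loss
    \<open>1 / (8 * q)\<close> is small against the relaxation \<open>1 / q\<close>.\<close>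
  have "?B < ?B + ?B / (8 * real q)" using B q by simp
  then have "lp_opt {..<n} ?c k l ?B < ereal (?B + ?B / (8 * real q))" using opt by (simp add: le_less_trans)
  then obtain x y where xy: "lp_feasible {..<n} k x y"
    and cost: "(\<Sum>j<n. \<Sum>i<n. thresh l ?B (?c i j) * x i j) < ?B + ?B / (8 * real q)"
    by (rule lp_opt_less)
  have k: "1 \<le> k" by (rule lp_feasible_pos[OF xy]) (use kn in simp)
  interpret P: centrum_program "input_memory (encode_instance (n, k, l, c, B))" W n k l q d
  proof
    show "d i j = min (- (- (input_memory (encode_instance (n, k, l, c, B)) (6 + 2 * (int i * int n + int j)) * int l *
        input_memory (encode_instance (n, k, l, c, B)) 5) div
        (input_memory (encode_instance (n, k, l, c, B)) (7 + 2 * (int i * int n + int j)) *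
         input_memory (encode_instance (n, k, l, c, B)) 4))) (30 * int n)" if "i < n" "j < n" for i j
      unfolding u(4,5) u(6)[OF that] u(7)[OF that] d_def using l by (intro scaled_dist_eq[OF Bp]) simp
    show "0 \<le> d i j" for i j
    proof -
      have "0 \<le> ?c i j / t" by (rule divide_nonneg_pos[OF nonneg t])
      then have "(0 :: int) \<le> \<lceil>?c i j / t\<rceil>" by linarith
      then show ?thesis by (simp add: dd)
    qed
    show "d i i = 0" if "i < n" for i using that by (simp add: dd)
    show "d i j = d j i" for i j by (simp add: dd commute)
    show "d i j \<le> d i h + d h j" if "i < n" "j < n" "h < n" for i j h
    proof -
      have "?c i j \<le> ?c i h + ?c h j" using triangle[of i h j] that by simp
      then have "?c i j / t \<le> ?c i h / t + ?c h j / t" using t by (simp add: add_divide_distrib[symmetric] divide_right_mono)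
      then have "\<lceil>?c i j / t\<rceil> \<le> \<lceil>?c i h / t\<rceil> + \<lceil>?c h j / t\<rceil>"
        by (meson ceiling_add_le ceiling_mono order.trans)
      moreover have "(0 :: int) \<le> \<lceil>?c i h / t\<rceil>" "(0 :: int) \<le> \<lceil>?c h j / t\<rceil>"
        using divide_nonneg_pos[OF nonneg t, of i h] divide_nonneg_pos[OF nonneg t, of h j] by linarith+
      \<comment> \<open>Rounding up is subadditive, and a cut-off of nonnegative numbers preserves
        this.\<close>
      ultimately show ?thesis unfolding dd by linarith
    qed
  qed (use u(1-3) k kn l q W in auto)
  \<comment> \<open>Here rounding and threshold match: beyond \<open>t\<close>, subtracting
    \<open>1\<close> undoes the rounding up; up to \<open>t\<close>, the rounded distance is at most
    \<open>1\<close> and the excess vanishes.\<close>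
  have f_le: "real_of_int (P.f i j) \<le> thresh l ?B (?c i j) / t" if "i < n" "j < n" for i j
  proof (cases "?c i j > t")
    case True
    have "real_of_int \<lceil>?c i j / t\<rceil> \<le> ?c i j / t + 1" by linarith
    moreover have "real_of_int (d i j) \<le> real_of_int \<lceil>?c i j / t\<rceil>" by (simp add: dd)
    moreover have "0 \<le> ?c i j / t" by (rule divide_nonneg_pos[OF nonneg t])
    moreover have "real_of_int (P.f i j) = max 0 (real_of_int (d i j) - 1)" by (simp add: P.f_def max_def)
    ultimately have "real_of_int (P.f i j) \<le> ?c i j / t" by linarith
    moreover have "thresh l ?B (?c i j) = ?c i j" using True by (simp add: thresh_def t_def)
    ultimately show ?thesis by simp
  next
    case False
    then have "?c i j / t \<le> 1" using t by simp
    then have "\<lceil>?c i j / t\<rceil> \<le> 1" by (simp only: ceiling_le_iff of_int_1)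
    then have "d i j \<le> 1" unfolding dd by linarith
    then show ?thesis using False t by (simp add: P.f_def thresh_def t_def[symmetric])
  qed
  have x: "0 \<le> x i j \<and> x i j \<le> y i" if "i < n" "j < n" for i j using xy that by (simp add: lp_feasible_def)
  have "(\<Sum>i<n. \<Sum>j<n. of_int (P.f i j) * x i j) = (\<Sum>j<n. \<Sum>i<n. of_int (P.f i j) * x i j)" by (rule sum.swap)
  also have "\<dots> \<le> (\<Sum>j<n. \<Sum>i<n. thresh l ?B (?c i j) / t * x i j)"
    using f_le x by (intro sum_mono mult_right_mono) auto
  also have "\<dots> = (\<Sum>j<n. \<Sum>i<n. thresh l ?B (?c i j) * x i j) / t"
    by (simp add: sum_divide_distrib)
  also have "\<dots> \<le> (?B + ?B / (8 * real q)) / t" using cost t by (intro divide_right_mono) auto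
  also have "\<dots> = l * (1 + 1 / (8 * real q))" using B l by (simp add: t_def field_simps)
  finally have fc: "(\<Sum>i<n. \<Sum>j<n. of_int (P.f i j) * x i j) \<le> l * (1 + 1 / (8 * real q))" .
  obtain z where z: "P.good_margin z"
    using margin[OF k kn l(1) q x _ _ P.f_bounds fc] xy unfolding P.good_margin_def lp_feasible_def by auto
  show ?thesis
  proof (rule htr_conseq[OF P.htr_p_main[OF z]])
    fix \<tau> :: state
    assume "\<tau> 0 0 0 = int (2 * n) \<and> (\<exists>F N. map (\<lambda>a. \<tau> 0 a 0) [1..int (2 * n)] = encode_solution n F N \<and>
      F \<subseteq> {..<n} \<and> card F = k \<and> (\<forall>j<n. N j \<in> F) \<and> P.centre_cost N \<le> (8 + 16 / q) * l)"
    then obtain F N where out: "\<tau> 0 0 0 = int (2 * n)" "map (\<lambda>a. \<tau> 0 a 0) [1..int (2 * n)] = encode_solution n F N"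
      and F: "F \<subseteq> {..<n}" "card F = k" "\<And>j. j < n \<Longrightarrow> N j \<in> F" and cc: "P.centre_cost N \<le> (8 + 16 / q) * l"
      by blast
    \<comment> \<open>A single excess is at most the sum of all, hence at most
      \<open>24 * n\<close>, so the distance is at most \<open>24 * n + 4 < 30 * n\<close>: the
      cut-off is not reached.\<close>
    have excess: "max 0 (?c (N j) j - 4 * t) \<le> t * max 0 (real_of_int (d (N j) j) - 4)" if j: "j < n" for j
    proof -
      have "max 0 (real_of_int (d (N j) j) - 4) \<le> P.centre_cost N"
        unfolding P.centre_cost_def using j by (intro member_le_sum) auto
      also have "\<dots> \<le> 24 * real n"
      proof -
        have "16 / real q \<le> 16" using q by (simp add: field_simps)
        then have "(8 + 16 / real q) * l \<le> 24 * real n" using l by (intro mult_mono) auto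
        then show ?thesis using cc by linarith
      qed
      finally have "real_of_int (d (N j) j) < real_of_int (30 * int n)" using kn by simp
      then have "d (N j) j < 30 * int n" by (simp only: of_int_less_iff)
      then have "d (N j) j = \<lceil>?c (N j) j / t\<rceil>" by (simp add: dd min_def split: if_splits)
      then have "?c (N j) j / t \<le> d (N j) j" by simp
      then have "?c (N j) j \<le> t * d (N j) j" using t by (simp add: field_simps)
      then have "?c (N j) j - 4 * t \<le> t * (real_of_int (d (N j) j) - 4)" by (simp add: algebra_simps)
      also have "\<dots> \<le> t * max 0 (real_of_int (d (N j) j) - 4)" using t by (intro mult_left_mono) auto
      finally show ?thesis using t by simp
    qed
    \<comment> \<open>As \<open>l * t = B\<close>, the threshold contributes \<open>4 * B\<close>
      and the excesses \<open>(8 + 16 / q) * B\<close>.\<close>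
    have "centrum_cost {..<n} ?c l N \<le> real l * (4 * t) + (\<Sum>j<n. max 0 (?c (N j) j - 4 * t))"
      unfolding centrum_cost_def using t by (intro top_sum_le) auto
    also have "(\<Sum>j<n. max 0 (?c (N j) j - 4 * t)) \<le> t * P.centre_cost N"
      unfolding P.centre_cost_def sum_distrib_left using excess by (intro sum_mono) auto
    also have "\<dots> \<le> t * ((8 + 16 / q) * l)" using cc t by (intro mult_left_mono) auto
    also have "real l * (4 * t) + t * ((8 + 16 / q) * l) = (12 + 16 / q) * ?B"
      using l by (simp add: t_def field_simps)
    finally have "centrum_cost {..<n} ?c l N \<le> (12 + 16 / q) * ?B" by simp
    then show "\<tau> 0 0 0 = int (2 * n) \<and> (\<exists>F N. map (\<lambda>a. \<tau> 0 a 0) [1..int (2 * n)] = encode_solution n F N \<and>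
       centrum_solution {..<n} k F N \<and> centrum_cost {..<n} ?c l N \<le> (12 + 16 / q) * ?B)"
      using out F by (auto simp: centrum_solution_def)
  qed
qed

theorem theorem1:
  "\<exists>g h :: real \<Rightarrow> real. g \<in> O[at_right 0](\<lambda>\<epsilon>. \<epsilon>) \<and> h \<in> O[at_right 0](\<lambda>\<epsilon>. \<epsilon>) \<and>
     (\<forall>\<epsilon>>0. \<exists>P. poly_time_algorithm P encode_instance (admissible_instances \<epsilon>)
        (\<lambda>(n, k, l, c, B) out. \<exists>F i. out = encode_solution n F i \<and>
           centrum_solution {..<n} k F i \<and>
           centrum_cost {..<n} (real_dist c) l i \<le> (12 + g \<epsilon>) * real_of_rat B \<and>
           ereal ((12 + g \<epsilon>) * real_of_rat B)
             \<le> ereal (12 + h \<epsilon>) * centrum_opt {..<n} (real_dist c) k l))"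
\<comment> \<open>\<open>16 * \<epsilon>\<close> comes from \<open>16 / q\<close> and
  \<open>1 / q \<le> \<epsilon>\<close>; the second witness is
  \<open>(12 + 16 * \<epsilon>) * (1 + \<epsilon>) - 12\<close>.\<close>
proof (rule exI[where x = "\<lambda>\<epsilon>. 16 * \<epsilon>"], rule exI[where x = "\<lambda>\<epsilon>. 28 * \<epsilon> + 16 * \<epsilon>\<^sup>2"], intro conjI allI impI)
  let ?g = "\<lambda>\<epsilon> :: real. 16 * \<epsilon>" and ?h = "\<lambda>\<epsilon> :: real. 28 * \<epsilon> + 16 * \<epsilon>\<^sup>2"
  show "?g \<in> O[at_right 0](\<lambda>\<epsilon>. \<epsilon>)" by simp
  show "?h \<in> O[at_right 0](\<lambda>\<epsilon>. \<epsilon>)"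
  proof (rule bigoI)
    have "\<forall>\<^sub>F \<epsilon> in at_right 0. \<epsilon> \<in> {0<..<1 :: real}" by (rule eventually_at_right_real) simp
    then show "\<forall>\<^sub>F \<epsilon> in at_right 0. norm (28 * \<epsilon> + 16 * \<epsilon>\<^sup>2) \<le> 44 * norm (\<epsilon> :: real)"
    proof eventually_elim
      case (elim \<epsilon>)
      then have "\<epsilon> * \<epsilon> \<le> \<epsilon> * 1" by (intro mult_left_mono) auto
      then show ?case using elim by (simp add: power2_eq_square)
    qed
  qed
  fix \<epsilon> :: real assume \<epsilon>: "0 < \<epsilon>"
  define q where "q = nat \<lceil>1 / \<epsilon>\<rceil>"
  have q: "1 \<le> q" "1 / real q \<le> \<epsilon>"
  proof -
    have e: "0 < 1 / \<epsilon>" using \<epsilon> by simp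
    then show "1 \<le> q" unfolding q_def by linarith
    have "1 / \<epsilon> \<le> real q" unfolding q_def using e by linarith
    then show "1 / real q \<le> \<epsilon>" using \<epsilon> \<open>1 \<le> q\<close> by (simp add: field_simps)
  qed
  \<comment> \<open>A constant for fixed \<open>\<epsilon>\<close>; the degree \<open>21\<close> of
    \<open>w\<close> adds \<open>n ^ 3\<close> and the power \<open>n ^ 18\<close> of the bound
    \<open>U\<close>.\<close>
  define C where "C = 1000 * q * 4665600000000 * q ^ 6"
  define w where "w = monom C 21"
  show "\<exists>P. poly_time_algorithm P encode_instance (admissible_instances \<epsilon>)
        (\<lambda>(n, k, l, c, B) out. \<exists>F i. out = encode_solution n F i \<and>
           centrum_solution {..<n} k F i \<and>
           centrum_cost {..<n} (real_dist c) l i \<le> (12 + ?g \<epsilon>) * real_of_rat B \<and>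
           ereal ((12 + ?g \<epsilon>) * real_of_rat B)
             \<le> ereal (12 + ?h \<epsilon>) * centrum_opt {..<n} (real_dist c) k l)"
  proof (rule poly_time_algorithm_cmd[where w = w and c = "p_main q"])
    fix I assume I: "I \<in> admissible_instances \<epsilon>"
    obtain n k l c B where inst: "I = (n, k, l, c, B)" by (cases I) auto
    let ?s = "input_size (encode_instance I)"
    let ?W = "poly w ?s"
    have ns: "n \<le> ?s" unfolding inst by (rule le_input_size)
    have Bs: "0 \<le> real_of_rat B" "ereal (real_of_rat B) \<le> ereal (1 + \<epsilon>) * centrum_opt {..<n} (real_dist c) k l" "0 < n"
      using I by (auto simp: inst admissible_instances_def)
    have pw: "poly w x = C * x ^ 21" for x by (simp add: w_def poly_monom)
    have le: "C * n ^ 21 \<le> ?W" unfolding pw using ns by (intro mult_left_mono power_mono) auto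
    have n21: "n ^ 21 = n ^ 3 * n ^ 18" by (simp flip: power_add)
    have "1000 * int q * int n ^ 3 * (4665600000000 * int q ^ 6 * int n ^ 18) = int (C * n ^ 21)"
      unfolding C_def n21 by simp
    also have "\<dots> \<le> int ?W" using le by (simp only: of_nat_le_iff)
    finally have W: "1000 * int q * int n ^ 3 * (4665600000000 * int q ^ 6 * int n ^ 18) \<le> int ?W" .
    \<comment> \<open>The output has \<open>2 * n\<close> entries, and its length must respect the
      same polynomial.\<close>
    have "2 * n \<le> C * n ^ 21"
    proof -
      have "1 \<le> q ^ 6" using q(1) by simp
      then have "2 * 1 \<le> C" unfolding C_def using q(1) by (intro order.trans[OF _ mult_mono[of 2 "1000 * q * 4665600000000" 1 "q ^ 6"]]) auto
      moreover have "n ^ 1 \<le> n ^ 21" using Bs(3) by (intro power_increasing) auto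
      ultimately show ?thesis by (intro mult_mono) auto
    qed
    then have "2 * n \<le> ?W" using le by linarith
    moreover have "htr (input_memory (encode_instance I)) (int ?W) (p_main q) (\<lambda>_ _ _. 0)
      (\<lambda>\<tau>. \<tau> 0 0 0 = int (2 * n) \<and> (\<exists>F i. map (\<lambda>a. \<tau> 0 a 0) [1..int (2 * n)] = encode_solution n F i \<and>
           centrum_solution {..<n} k F i \<and>
           centrum_cost {..<n} (real_dist c) l i \<le> (12 + ?g \<epsilon>) * real_of_rat B \<and>
           ereal ((12 + ?g \<epsilon>) * real_of_rat B)
             \<le> ereal (12 + ?h \<epsilon>) * centrum_opt {..<n} (real_dist c) k l))"
      unfolding inst
    proof (rule htr_conseq[OF centrum_algorithm[OF I[unfolded inst] q(1) W[unfolded inst]]])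
      fix \<tau> :: state
      have "(12 + 16 / real q) * real_of_rat B \<le> (12 + ?g \<epsilon>) * real_of_rat B"
        using q(2) Bs(1) by (intro mult_right_mono) auto
      moreover have "ereal ((12 + ?g \<epsilon>) * real_of_rat B) \<le> ereal (12 + ?h \<epsilon>) * centrum_opt {..<n} (real_dist c) k l"
      proof -
        have "ereal ((12 + ?g \<epsilon>) * real_of_rat B) = ereal (12 + ?g \<epsilon>) * ereal (real_of_rat B)" by simp
        also have "\<dots> \<le> ereal (12 + ?g \<epsilon>) * (ereal (1 + \<epsilon>) * centrum_opt {..<n} (real_dist c) k l)"
          using Bs(2) \<epsilon> by (intro ereal_mult_left_mono) auto
        also have "\<dots> = ereal ((12 + ?g \<epsilon>) * (1 + \<epsilon>)) * centrum_opt {..<n} (real_dist c) k l"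
          by (simp only: mult.assoc[symmetric] times_ereal.simps)
        also have "(12 + ?g \<epsilon>) * (1 + \<epsilon>) = 12 + ?h \<epsilon>" by (simp add: algebra_simps power2_eq_square)
        finally show ?thesis .
      qed
      moreover assume "\<tau> 0 0 0 = int (2 * n) \<and> (\<exists>F N. map (\<lambda>a. \<tau> 0 a 0) [1..int (2 * n)] = encode_solution n F N \<and>
        centrum_solution {..<n} k F N \<and> centrum_cost {..<n} (real_dist c) l N \<le> (12 + 16 / q) * real_of_rat B)"
      ultimately show "\<tau> 0 0 0 = int (2 * n) \<and> (\<exists>F i. map (\<lambda>a. \<tau> 0 a 0) [1..int (2 * n)] = encode_solution n F i \<and>
           centrum_solution {..<n} k F i \<and>
           centrum_cost {..<n} (real_dist c) l i \<le> (12 + ?g \<epsilon>) * real_of_rat B \<and>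
           ereal ((12 + ?g \<epsilon>) * real_of_rat B)
             \<le> ereal (12 + ?h \<epsilon>) * centrum_opt {..<n} (real_dist c) k l)"
        by (meson order.trans)
    qed
    ultimately show "\<exists>L. htr (input_memory (encode_instance I)) (int ?W) (p_main q) (\<lambda>_ _ _. 0)
      (\<lambda>\<sigma>. \<sigma> 0 0 0 = int L \<and> L \<le> ?W \<and> (case I of (n, k, l, c, B) \<Rightarrow> \<lambda>out. \<exists>F i. out = encode_solution n F i \<and>
           centrum_solution {..<n} k F i \<and>
           centrum_cost {..<n} (real_dist c) l i \<le> (12 + ?g \<epsilon>) * real_of_rat B \<and>
           ereal ((12 + ?g \<epsilon>) * real_of_rat B)
             \<le> ereal (12 + ?h \<epsilon>) * centrum_opt {..<n} (real_dist c) k l) (map (\<lambda>a. \<sigma> 0 a 0) [1..int L]))"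
      by (intro exI[of _ "2 * n"]) (simp add: inst)
  qed
qed

end
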